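(* Let $r \ge 2$ be an integer and let $K_r$ denote the complete graph on $r$ vertices. There is an algorithm which, given an undirected graph $G=(V,E)$ on $n$ vertices of tree-width at most $t$ together with a nice tree decomposition of $G$ of width at most $t$ having $O(n)$ nodes, decides in time $O(2^{t + r\log t}\, n)$ whether $V$ can be partitioned into two non-empty sets $A, B$ such that neither of the induced subgraphs $G[A]$ and $G[B]$ contains $K_r$ as a subgraph.
   Context: A tree decomposition of $G=(V,E)$ is a pair $(T,\{X_i : i\in I\})$ with $T$ a tree on node set $I$ and bags $X_i\subseteq V$ such that every vertex lies in some bag, every edge has both endpoints in some bag, and for each vertex $v$ the nodes whose bags contain $v$ induce a connected subtree of $T$; its width is $\max_i |X_i|-1$, and the tree-width of $G$ is the minimum width over all tree decompositions. A nice tree decomposition is a rooted tree decomposition in which every node is a leaf node (empty bag), an introduce node (one child, bag equals the child's bag plus one vertex), a forget node (one child, bag equals the child's bag minus one vertex), or a join node (two children with bags equal to its own). Every graph has a nice tree decomposition with $O(n)$ nodes and width equal to its tree-width. For $S\subseteq V$, $G[S]$ is the induced subgraph on $S$. *)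

theory Defs
  imports Complex_Main "Graph_Theory.Graph_Theory"
begin

section \<open>Graphs and tree decompositions\<close>

text \<open>
  A finite simple undirected graph is a \<^locale>\<open>pair_graph\<close>: an undirected edge is a pair of
  opposite arcs. Consequently every edge gives rise to an arc cycle of length 2, so the predicate
  \<^const>\<open>tree\<close> of the library is never satisfied by such a graph with an edge; cycles of an
  undirected graph are the arc cycles of length at least 3.
\<close>

definition contains_complete :: "nat \<Rightarrow> ('a, 'b) pre_digraph \<Rightarrow> bool" where
  "contains_complete r H \<longleftrightarrow> (\<exists>K. subgraph K H \<and> complete_digraph r K)"

definition undirected_tree :: "'i pair_pre_digraph \<Rightarrow> bool" where
  "undirected_tree T \<longleftrightarrow> pair_graph T \<and> Digraph_Component.connected (with_proj T) \<and>
     \<not> (\<exists>p. pre_digraph.cycle (with_proj T) p \<and> 3 \<le> length p)"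

definition tree_decomposition ::
  "'a pair_pre_digraph \<Rightarrow> 'i pair_pre_digraph \<Rightarrow> ('i \<Rightarrow> 'a set) \<Rightarrow> bool" where
  "tree_decomposition G T X \<longleftrightarrow>
     undirected_tree T \<and>
     (\<forall>i\<in>pverts T. X i \<subseteq> pverts G) \<and>
     (\<forall>v\<in>pverts G. \<exists>i\<in>pverts T. v \<in> X i) \<and>
     (\<forall>(u, v)\<in>parcs G. \<exists>i\<in>pverts T. u \<in> X i \<and> v \<in> X i) \<and>
     (\<forall>v\<in>pverts G. Digraph_Component.connected (with_proj T \<restriction> {i\<in>pverts T. v \<in> X i}))"

text \<open>
  The width is a natural number, so if all bags are empty (which happens only for the graph
  without vertices) it is 0 instead of -1.
\<close>

definition width :: "'i pair_pre_digraph \<Rightarrow> ('i \<Rightarrow> 'a set) \<Rightarrow> nat" where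
  "width T X = Max ((\<lambda>i. card (X i)) ` pverts T) - 1"

text \<open>Trees are finite, so it is no restriction that their nodes are natural numbers.\<close>

definition treewidth :: "'a pair_pre_digraph \<Rightarrow> nat" where
  "treewidth G = (LEAST w. \<exists>(T :: nat pair_pre_digraph) X. tree_decomposition G T X \<and> width T X = w)"

text \<open>
  In the tree \<open>T\<close> rooted at \<open>\<rho>\<close>, the children of \<open>i\<close> are the nodes \<open>j\<close> such that the path
  from \<open>\<rho>\<close> to \<open>j\<close> ends with the arc from \<open>i\<close> to \<open>j\<close>.
\<close>

definition children :: "'i pair_pre_digraph \<Rightarrow> 'i \<Rightarrow> 'i \<Rightarrow> 'i set" where
  "children T \<rho> i = {j. \<exists>p. pre_digraph.apath (with_proj T) \<rho> (p @ [(i, j)]) j}"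

definition nice_tree_decomposition ::
  "'a pair_pre_digraph \<Rightarrow> 'i pair_pre_digraph \<Rightarrow> 'i \<Rightarrow> ('i \<Rightarrow> 'a set) \<Rightarrow> bool" where
  "nice_tree_decomposition G T \<rho> X \<longleftrightarrow>
     tree_decomposition G T X \<and> \<rho> \<in> pverts T \<and>
     (\<forall>i\<in>pverts T.
        \<comment> \<open>leaf\<close>
        (children T \<rho> i = {} \<and> X i = {}) \<or>
        \<comment> \<open>introduce\<close>
        (\<exists>j v. children T \<rho> i = {j} \<and> v \<notin> X j \<and> X i = insert v (X j)) \<or>
        \<comment> \<open>forget\<close>
        (\<exists>j v. children T \<rho> i = {j} \<and> v \<in> X j \<and> X i = X j - {v}) \<or>
        \<comment> \<open>join\<close>
        (\<exists>j k. j \<noteq> k \<and> children T \<rho> i = {j, k} \<and> X i = X j \<and> X i = X k))"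

definition has_bipartition_without_complete :: "nat \<Rightarrow> 'a pair_pre_digraph \<Rightarrow> bool" where
  "has_bipartition_without_complete r G \<longleftrightarrow>
     (\<exists>A B. A \<noteq> {} \<and> B \<noteq> {} \<and> A \<union> B = pverts G \<and> A \<inter> B = {} \<and>
        \<not> contains_complete r (with_proj G \<restriction> A) \<and> \<not> contains_complete r (with_proj G \<restriction> B))"

section \<open>Random access machine\<close>

text \<open>
  Algorithms are programs of a random access machine under the uniform cost criterion. The
  machine has registers, of which a program uses finitely many, and a memory of cells that are
  addressed by natural numbers; registers and cells hold natural numbers. The arithmetic
  operations are addition and truncated subtraction only: unit-cost multiplication would make the
  machine unreasonably powerful. Every constant, register access, memory access, arithmetic or
  Boolean operation, assignment and branch takes one unit of time. Programs are structured
  (loops instead of jumps), which affects running times by a constant factor at most.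
\<close>

type_synonym state = "(string \<Rightarrow> nat) \<times> (nat \<Rightarrow> nat)"

datatype aexp = Const nat | Reg string | Mem aexp | Plus aexp aexp | Minus aexp aexp

datatype bexp = Less aexp aexp | Eq aexp aexp | Neg bexp | Conj bexp bexp

datatype com =
    Skip
  | Assign string aexp
  | Store aexp aexp
  | Seq com com
  | Cond bexp com com
  | While bexp com

fun aval :: "aexp \<Rightarrow> state \<Rightarrow> nat" where
  "aval (Const k) s = k"
| "aval (Reg x) s = fst s x"
| "aval (Mem a) s = snd s (aval a s)"
| "aval (Plus a b) s = aval a s + aval b s"
| "aval (Minus a b) s = aval a s - aval b s"

fun bval :: "bexp \<Rightarrow> state \<Rightarrow> bool" where
  "bval (Less a b) s \<longleftrightarrow> aval a s < aval b s"
| "bval (Eq a b) s \<longleftrightarrow> aval a s = aval b s"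
| "bval (Neg b) s \<longleftrightarrow> \<not> bval b s"
| "bval (Conj b c) s \<longleftrightarrow> bval b s \<and> bval c s"

fun acost :: "aexp \<Rightarrow> nat" where
  "acost (Const k) = 1"
| "acost (Reg x) = 1"
| "acost (Mem a) = acost a + 1"
| "acost (Plus a b) = acost a + acost b + 1"
| "acost (Minus a b) = acost a + acost b + 1"

fun bcost :: "bexp \<Rightarrow> nat" where
  "bcost (Less a b) = acost a + acost b + 1"
| "bcost (Eq a b) = acost a + acost b + 1"
| "bcost (Neg b) = bcost b + 1"
| "bcost (Conj b c) = bcost b + bcost c + 1"

text \<open>
  \<open>exec c s k s'\<close>: started in state \<open>s\<close>, the program \<open>c\<close> halts after time \<open>k\<close> in state \<open>s'\<close>.
\<close>

inductive exec :: "com \<Rightarrow> state \<Rightarrow> nat \<Rightarrow> state \<Rightarrow> bool" where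
  Skip: "exec Skip s 1 s"
| Assign: "exec (Assign x a) s (acost a + 1) ((fst s)(x := aval a s), snd s)"
| Store: "exec (Store a b) s (acost a + acost b + 1) (fst s, (snd s)(aval a s := aval b s))"
| Seq: "exec c s k s' \<Longrightarrow> exec d s' l s'' \<Longrightarrow> exec (Seq c d) s (k + l) s''"
| CondTrue: "bval b s \<Longrightarrow> exec c s k s' \<Longrightarrow> exec (Cond b c d) s (bcost b + 1 + k) s'"
| CondFalse: "\<not> bval b s \<Longrightarrow> exec d s k s' \<Longrightarrow> exec (Cond b c d) s (bcost b + 1 + k) s'"
| WhileFalse: "\<not> bval b s \<Longrightarrow> exec (While b c) s (bcost b + 1) s"
| WhileTrue: "bval b s \<Longrightarrow> exec c s k s' \<Longrightarrow> exec (While b c) s' l s'' \<Longrightarrow>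
    exec (While b c) s (bcost b + 1 + k + l) s''"

inductive_cases exec_SkipE: "exec Skip s k s'"
inductive_cases exec_AssignE: "exec (Assign x a) s k s'"
inductive_cases exec_StoreE: "exec (Store a b) s k s'"
inductive_cases exec_SeqE: "exec (Seq c d) s k s'"
inductive_cases exec_CondE: "exec (Cond b c d) s k s'"
inductive_cases exec_WhileE: "exec (While b c) s k s'"

text \<open>Programs are deterministic: the final state and the running time are unique.\<close>

lemma exec_deterministic:
  "exec c s k s' \<Longrightarrow> exec c s l s'' \<Longrightarrow> k = l \<and> s' = s''"
proof (induction arbitrary: l s'' rule: exec.induct)
  case (Seq c s k s' d m s3)
  from Seq.prems obtain k2 t2 m2
    where "exec c s k2 t2" "exec d t2 m2 s''" "l = k2 + m2"
    by (rule exec_SeqE)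
  with Seq.IH show ?case by metis
next
  case (CondTrue b s c k s' d)
  from CondTrue.prems CondTrue.hyps(1) obtain k2 where "exec c s k2 s''" "l = bcost b + 1 + k2"
    by (auto elim: exec_CondE)
  with CondTrue.IH show ?case by metis
next
  case (CondFalse b s d k s' c)
  from CondFalse.prems CondFalse.hyps(1) obtain k2 where "exec d s k2 s''" "l = bcost b + 1 + k2"
    by (auto elim: exec_CondE)
  with CondFalse.IH show ?case by metis
next
  case (WhileFalse b s c)
  from WhileFalse.prems WhileFalse.hyps show ?case by (auto elim: exec_WhileE)
next
  case (WhileTrue b s c k s' m s3)
  from WhileTrue.prems WhileTrue.hyps(1) obtain k2 t2 m2
    where "exec c s k2 t2" "exec (While b c) t2 m2 s''" "l = bcost b + 1 + k2 + m2"
    by (auto elim: exec_WhileE)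
  with WhileTrue.IH show ?case by metis
qed (auto elim: exec_SkipE exec_AssignE exec_StoreE)

definition initial_state :: "nat list \<Rightarrow> state" where
  "initial_state xs = (\<lambda>_. 0, \<lambda>a. if a < length xs then xs ! a else 0)"

definition answers_within :: "com \<Rightarrow> nat list \<Rightarrow> bool \<Rightarrow> real \<Rightarrow> bool" where
  "answers_within c xs Q \<tau> \<longleftrightarrow>
     (\<exists>k s. exec c (initial_state xs) k s \<and> real k \<le> \<tau> \<and> fst s ''out'' = (if Q then 1 else 0))"

section \<open>Encoding of the input\<close>

text \<open>
  The vertices of \<open>G\<close> and the nodes of \<open>T\<close> are numbered from 0. The input consists of the
  number of vertices, the adjacency lists of \<open>G\<close>, the number of nodes, the root, and for each
  node the list of its children and the list of the elements of its bag; each list is preceded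
  by its length. The numberings and the order within the lists are arbitrary.
\<close>

definition with_length :: "nat list \<Rightarrow> nat list" where
  "with_length xs = length xs # xs"

definition encodes ::
  "nat list \<Rightarrow> nat pair_pre_digraph \<Rightarrow> nat pair_pre_digraph \<Rightarrow> nat \<Rightarrow> (nat \<Rightarrow> nat set) \<Rightarrow> bool" where
  "encodes xs G T \<rho> X \<longleftrightarrow>
     (\<exists>n m adj ch bag.
        pverts G = {..<n} \<and> pverts T = {..<m} \<and>
        (\<forall>v<n. distinct (adj v) \<and> set (adj v) = {w. (v, w) \<in> parcs G}) \<and>
        (\<forall>i<m. distinct (ch i) \<and> set (ch i) = children T \<rho> i) \<and>
        (\<forall>i<m. distinct (bag i) \<and> set (bag i) = X i) \<and>
        xs = [n] @ concat (map (\<lambda>v. with_length (adj v)) [0..<n]) @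
             [m, \<rho>] @ concat (map (\<lambda>i. with_length (ch i) @ with_length (bag i)) [0..<m]))"

end

theory Submission
  imports Defs "HOL-Library.Nat_Bijection"
begin

text \<open>
  Moving one vertex shows that for at least two vertices the non-emptiness of the two parts is no
  restriction, since \<open>2 \<le> r\<close>. The rest is a dynamic program along the tree: a set \<open>S\<close> is
  extendable at a node \<open>i\<close> if it is the trace on the bag of \<open>i\<close> of one part of a bipartition of all
  vertices in bags below \<open>i\<close>. Because a clique among these vertices lies in the bag of \<open>i\<close> or
  below a single child, \<open>S\<close> is extendable iff \<open>S\<close> and its complement in the bag contain no
  \<open>K\<^sub>r\<close> and, for every child \<open>j\<close>, the set \<open>S \<inter> X j\<close> is the trace of a set extendable at \<open>j\<close>. This
  recursion does not distinguish the four types of nodes.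

  All subsets of a bag are enumerated by doubling. Their clique numbers, obtained from
  \<open>\<omega>(S \<union> {v}) = max (\<omega> S) (1 + \<omega>(S \<inter> N(v)))\<close>, cost constant time each, so a node costs
  \<open>O(2\<^sup>t)\<close>; the number of arcs, and hence the length of the input, is \<open>O(t\<^sup>2 n)\<close>, which
  \<open>t\<^sup>r\<close> absorbs. A set of vertices is stored as the number with these binary digits; it indexes
  tables in the large, initially zero memory without any translation between nodes.
\<close>

section \<open>Rooted trees\<close>

text \<open>The machine can only add and subtract, and this shapes the data: intersections with a
  fixed set are obtained by adding marks, complements within a bag by subtracting codes, powers of 2
  and row addresses by repeated addition. A row has room for \<open>2 ^ n\<close> cells, yet a table
  costs no more than its bag, because only the cells of traces that occur are written. A child's
  table is indexed by the trace on the bag of the parent, not on its own bag. All extendable sets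
  with the same trace thus fall into one cell, and the existential quantifier over the sets at the
  child becomes one memory access per subset at the parent. Cliques are found without listing sets
  of \<open>r\<close> vertices, since the clique numbers of all subsets of a bag are tabulated;
  \<open>r\<close> occurs in the program merely as the threshold for these numbers. Hence the
  program depends on \<open>r\<close>, while the constant of the time bound,
  \<open>4300 * (d + 1)\<close>, depends on the factor \<open>d\<close> in the number of
  nodes.\<close>

lemma (in pair_graph) apath_unique:
  assumes acyclic: "\<not> (\<exists>p. cycle p \<and> 3 \<le> length p)"
    and "apath u p v" "apath u q v"
  shows "p = q"
  using assms(2,3)
proof (induction p arbitrary: u q)
  case Nil
  then have "u = v" by (simp add: apath_Nil_iff)
  with Nil.prems(2) show ?case
    by (metis apath_ends)
next
  case (Cons e p1)
  then have "u \<noteq> v" by (metis apath_ends list.distinct(1))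
  with Cons.prems(2) obtain f q1 where q: "q = f # q1"
    by (cases q) (auto simp: apath_Nil_iff)
  obtain a b where e: "e = (u, a)" and f: "f = (u, b)"
    using Cons.prems q by (cases e; cases f) (auto simp: apath_Cons_iff)
  have p1: "(u, a) \<in> parcs G" "apath a p1 v" "u \<notin> set (awalk_verts a p1)"
    using Cons.prems(1) e by (auto simp: apath_Cons_iff)
  have q1: "(u, b) \<in> parcs G" "apath b q1 v" "u \<notin> set (awalk_verts b q1)"
    using Cons.prems(2) q f by (auto simp: apath_Cons_iff)
  show ?case
  proof (cases "a = b")
    case True
    then show ?thesis using Cons.IH p1(2) q1(2) q e f by blast
  next
    case False
    \<comment> \<open>Two paths that leave \<open>u\<close> by different arcs are joined into a walk
      from \<open>a\<close> along \<open>p1\<close> to \<open>v\<close>, back along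
      \<open>q1\<close> to \<open>b\<close> and on to \<open>u\<close>. It avoids the arc
      \<open>(a, u)\<close>, because neither path returns to \<open>u\<close> and \<open>a\<close>
      differs from \<open>b\<close>.\<close>
    let ?s = "p1 @ rev_path q1 @ [(b, u)]"
    have wp: "awalk a p1 v" and wq: "awalk b q1 v" using p1 q1 by (auto simp: apath_def)
    have arc: "awalk b [(b, u)] u"
      using q1(1) arcs_symmetric by (auto simp: awalk_simps wellformed')
    have wr: "awalk v (rev_path q1) b" using wq by simp
    have ws: "awalk a ?s u" using wp wr arc by (intro awalk_appendI)
    have "(a, u) \<notin> set p1"
      using p1(3) awalk_verts_arc2[OF wp] by (metis snd_conv)
    moreover have "(a, u) \<notin> set (rev_path q1)"
    proof
      assume "(a, u) \<in> set (rev_path q1)"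
      then have "u \<in> set (awalk_verts v (rev_path q1))"
        using awalk_verts_arc2[OF wr] by (metis snd_conv)
      then show False using awalk_verts_rev_path[OF wq] q1(3) by simp
    qed
    ultimately have nin: "(a, u) \<notin> set ?s" using False by auto
    obtain s where s: "apath a s u" "set s \<subseteq> set ?s"
      using apath_awalk_to_apath[OF ws] awalk_to_apath_subset[OF ws] by blast
    have "a \<noteq> u" using p1(1) no_loops' by blast
    \<comment> \<open>A path of length 1 would be the arc \<open>(a, u)\<close>. With the arc
      \<open>(u, a)\<close> in front, \<open>s\<close> therefore closes to a cycle of length at
      least 3, unlike the back-and-forth cycle that every edge yields.\<close>
    have "2 \<le> length s"
    proof (rule ccontr)
      assume "\<not> 2 \<le> length s"
      then consider "s = []" | g where "s = [g]"
        by (metis One_nat_def Suc_1 length_0_conv length_Suc_conv less_2_cases not_le)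
      then show False
        using s nin \<open>a \<noteq> u\<close> by cases (auto simp: apath_def awalk_simps)
    qed
    have "cycle ((u, a) # s)"
      unfolding cycle_def
      using s(1) p1(1) by (intro exI[of _ u]) (auto simp: apath_def awalk_simps wellformed')
    then show ?thesis using acyclic \<open>2 \<le> length s\<close> by fastforce
  qed
qed

lemma pcas_snoc: "pcas u (p @ [e]) v \<longleftrightarrow> pcas u p (fst e) \<and> snd e = v"
  by (induction p arbitrary: u) auto

lemma pawalk_verts_snoc:
  "pcas u (p @ [e]) v \<Longrightarrow> pawalk_verts u (p @ [e]) = pawalk_verts u p @ [v]"
  by (induction p arbitrary: u) auto

locale rooted_tree =
  fixes T :: "'i pair_pre_digraph" and \<rho> :: 'i
  assumes tree: "undirected_tree T" and root: "\<rho> \<in> pverts T"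
begin

sublocale pair_graph T
  using tree unfolding undirected_tree_def by blast

abbreviation "ch \<equiv> children T \<rho>"

lemma path_unique: "apath u p v \<Longrightarrow> apath u q v \<Longrightarrow> p = q"
  using tree apath_unique unfolding undirected_tree_def by blast

lemma child_arc: "j \<in> ch i \<Longrightarrow> (i, j) \<in> parcs T"
proof -
  assume "j \<in> ch i"
  then obtain p where "apath \<rho> (p @ [(i, j)]) j" by (auto simp: children_def)
  then have "set (p @ [(i, j)]) \<subseteq> parcs T" unfolding apath_def awalk_def by blast
  then show ?thesis by simp
qed

lemma child_verts: "j \<in> ch i \<Longrightarrow> i \<in> pverts T \<and> j \<in> pverts T"
  using child_arc wellformed' by blast

lemma parent_unique: "j \<in> ch i \<Longrightarrow> j \<in> ch i' \<Longrightarrow> i = i'"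
proof -
  assume "j \<in> ch i" "j \<in> ch i'"
  then obtain p q where "apath \<rho> (p @ [(i, j)]) j" "apath \<rho> (q @ [(i', j)]) j"
    unfolding children_def by blast
  then have "p @ [(i, j)] = q @ [(i', j)]" by (rule path_unique)
  then show ?thesis by simp
qed

lemma root_not_child: "\<rho> \<notin> ch i"
proof
  assume "\<rho> \<in> ch i"
  then obtain p where "apath \<rho> (p @ [(i, \<rho>)]) \<rho>" by (auto simp: children_def)
  then show False using apath_ends by blast
qed

text \<open>Connectedness is strong connectedness of the symmetric closure, and a symmetric graph is
  its own closure. \<open>H\<close> is arbitrary because the lemma also serves for the subtree of
  all nodes whose bags contain a given vertex.\<close>

lemma symmetric_reach:
  assumes "Digraph_Component.connected (with_proj H)" "pair_sym_digraph H"
    "u \<in> pverts H" "v \<in> pverts H"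
  shows "\<exists>p. pre_digraph.awalk (with_proj H) u p v"
proof -
  interpret H: pair_sym_digraph H by fact
  have "mk_symmetric (with_proj H) = H"
    using H.arcs_symmetric unfolding mk_symmetric_def
    by (intro pair_pre_digraph.equality) auto
  then have "u \<rightarrow>\<^sup>*\<^bsub>with_proj H\<^esub> v"
    using assms by (auto simp: Digraph_Component.connected_def strongly_connected_def)
  then show ?thesis using H.reachable_awalk by blast
qed

lemma root_path: "v \<in> pverts T \<Longrightarrow> \<exists>p. apath \<rho> p v"
proof -
  assume "v \<in> pverts T"
  then obtain p where "awalk \<rho> p v"
    using symmetric_reach[OF _ pair_sym_digraph_axioms root] tree
    unfolding undirected_tree_def by blast
  then show ?thesis using apath_awalk_to_apath by blast
qed

text \<open>A measure that strictly increases from parent to child; it excludes that a node lies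
  below its own child.\<close>

definition depth :: "'i \<Rightarrow> nat" where
  "depth v = length (THE p. apath \<rho> p v)"

text \<open>If the root path of \<open>x\<close> avoids \<open>y\<close>, it can be prolonged by the
  arc \<open>(x, y)\<close>. If it meets \<open>y\<close>, its part after \<open>y\<close> is a path
  from \<open>y\<close> to \<open>x\<close>, which by uniqueness is the single arc
  \<open>(y, x)\<close>.\<close>

lemma arc_cases:
  assumes "(x, y) \<in> parcs T"
  shows "y \<in> ch x \<or> x \<in> ch y"
proof -
  obtain p where p: "apath \<rho> p x" using root_path wellformed' assms by blast
  show ?thesis
  proof (cases "y \<in> set (awalk_verts \<rho> p)")
    case False
    then have "apath \<rho> (p @ [(x, y)]) y"
      using p assms unfolding apath_def awalk_def
      by (auto simp: pcas_snoc pawalk_verts_snoc simp del: cas_append_iff)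
    then show ?thesis unfolding children_def by blast
  next
    case True
    then obtain q s where qs: "p = q @ s" "awalk \<rho> q y" "awalk y s x"
      using p awalk_decomp[OF _ True] unfolding apath_def by blast
    have "apath \<rho> (q @ s) x" using p qs(1) by (rule subst[rotated])
    note this[THEN iffD1[OF apath_append_iff], THEN conjunct2, THEN conjunct1]
    then have s: "apath y s x" by (simp only: awlast_of_awalk[OF qs(2), simplified])
    have "apath y [(y, x)] x"
      using assms arcs_symmetric no_loops' by (auto simp: apath_def awalk_simps wellformed')
    with s have "s = [(y, x)]" by (rule path_unique)
    then have "apath \<rho> (q @ [(y, x)]) x" using p qs(1) by simp
    then show ?thesis unfolding children_def by blast
  qed
qed

inductive_set desc :: "'i \<Rightarrow> 'i set" for i where
  self: "i \<in> desc i"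
| step: "x \<in> desc i \<Longrightarrow> y \<in> ch x \<Longrightarrow> y \<in> desc i"

lemma desc_cases: "y \<in> desc i \<Longrightarrow> y = i \<or> (\<exists>x\<in>desc i. y \<in> ch x)"
  by (erule desc.cases) auto

lemma desc_trans: "y \<in> desc x \<Longrightarrow> x \<in> desc i \<Longrightarrow> y \<in> desc i"
proof (induction rule: desc.induct)
  case (step u v)
  show ?case by (rule desc.step[OF step.IH[OF step.prems] step.hyps(2)])
qed

lemma desc_child: "j \<in> ch i \<Longrightarrow> y \<in> desc j \<Longrightarrow> y \<in> desc i"
  using desc_trans[OF _ desc.step[OF desc.self]] .

lemma desc_unfold: "desc i = insert i (\<Union>j\<in>ch i. desc j)"
proof -
  have "y = i \<or> (\<exists>j\<in>ch i. y \<in> desc j)" if "y \<in> desc i" for y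
    using that
  proof induction
    case (step x y)
    show ?case
    proof (cases "x = i")
      case True
      then have "y \<in> ch i" using step.hyps(2) by simp
      then show ?thesis using desc.self[of y] by (intro disjI2 bexI)
    next
      case False
      then obtain j where "j \<in> ch i" "x \<in> desc j" using step.IH by blast
      then show ?thesis using desc.step[OF _ step.hyps(2), of j] by blast
    qed
  qed simp
  then show ?thesis using desc_child[of _ i] desc.self[of i] by blast
qed

lemma desc_verts: "i \<in> pverts T \<Longrightarrow> desc i \<subseteq> pverts T"
proof
  fix y assume "y \<in> desc i" "i \<in> pverts T"
  then show "y \<in> pverts T" by induction (auto dest: child_verts)
qed

lemma apath_butlast: "apath u (p @ [(x, v)]) v \<Longrightarrow> apath u p x"
  unfolding apath_def awalk_def
  by (auto simp: pcas_snoc pawalk_verts_snoc simp del: cas_append_iff)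

lemma desc_root: "desc \<rho> = pverts T"
proof
  show "desc \<rho> \<subseteq> pverts T" using root by (rule desc_verts)
  have "v \<in> desc \<rho>" if "apath \<rho> p v" for p v
    using that
  proof (induction p arbitrary: v rule: rev_induct)
    case Nil
    then have "v = \<rho>" by (simp add: apath_Nil_iff)
    then show ?case by (simp only: desc.self)
  next
    case (snoc e p)
    obtain x where e: "e = (x, v)" using snoc.prems 
      by (cases e) (simp add: apath_def awalk_def pcas_snoc del: cas_append_iff)
    have pv: "apath \<rho> (p @ [(x, v)]) v" using snoc.prems e by simp
    then have "x \<in> desc \<rho>" using apath_butlast snoc.IH by blast
    moreover have "v \<in> ch x" using pv unfolding children_def by blast
    ultimately show ?case by (rule desc.step)
  qed
  then show "pverts T \<subseteq> desc \<rho>" using root_path by blast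
qed

lemma child_length: "j \<in> ch i \<Longrightarrow> apath \<rho> p i \<Longrightarrow> apath \<rho> q j \<Longrightarrow> length q = Suc (length p)"
proof -
  assume a: "j \<in> ch i" "apath \<rho> p i" "apath \<rho> q j"
  then obtain p' where p': "apath \<rho> (p' @ [(i, j)]) j" by (auto simp: children_def)
  then have "apath \<rho> p' i" by (rule apath_butlast)
  with a(2) have "p' = p" by (rule path_unique[rotated])
  moreover have "q = p' @ [(i, j)]" using a(3) p' by (rule path_unique)
  ultimately show ?thesis by simp
qed

lemma depth_eq: "apath \<rho> p v \<Longrightarrow> depth v = length p"
  unfolding depth_def by (subst the_equality[of _ p]) (auto intro: path_unique)

lemma depth_child: "j \<in> ch i \<Longrightarrow> depth j = Suc (depth i)"
proof -
  assume j: "j \<in> ch i"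
  then obtain p q where "apath \<rho> p i" "apath \<rho> q j" using root_path child_verts by blast
  then show ?thesis using child_length[OF j] depth_eq by simp
qed

lemma depth_desc: "y \<in> desc i \<Longrightarrow> depth i \<le> depth y"
proof (induction rule: desc.induct)
  case (step x y)
  then show ?case using depth_child[OF step.hyps(2)] by linarith
qed simp

lemma parent_not_desc: "j \<in> ch i \<Longrightarrow> i \<notin> desc j"
  using depth_child[of j i] depth_desc[of i j] by linarith

text \<open>Descendants are closed under children, so the arc leads upwards from \<open>x\<close> to
  its parent \<open>y\<close>; and every descendant of \<open>j\<close> except \<open>j\<close>
  itself has its parent among the descendants. This is the tree side of the separation property of
  bags.\<close>

lemma desc_crossing:
  assumes "j \<in> ch i" "(x, y) \<in> parcs T" "x \<in> desc j" "y \<notin> desc j"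
  shows "x = j \<and> y = i"
proof -
  have "y \<notin> ch x" using desc.step[OF assms(3)] assms(4) by blast
  then have x: "x \<in> ch y" using arc_cases[OF assms(2)] by blast
  then have "x = j" using desc_cases[OF assms(3)] parent_unique[OF x] assms(4) by blast
  then show ?thesis using parent_unique[OF x] assms(1) by blast
qed

text \<open>Induction down the subtree of \<open>j\<close>: the first node to enter the subtree of
  \<open>k\<close> could only be \<open>k\<close>, whose parent is \<open>i\<close>, and
  \<open>i\<close> does not lie below its child \<open>j\<close>.\<close>

lemma desc_disjoint:
  assumes "j \<in> ch i" "k \<in> ch i" "j \<noteq> k"
  shows "desc j \<inter> desc k = {}"
proof -
  have "x \<notin> desc k" if "x \<in> desc j" for x
    using that
  proof induction
    case self
    show ?case
    proof
      assume "j \<in> desc k"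
      then obtain x where "x \<in> desc k" "j \<in> ch x" using desc_cases[of j k] assms(3) by blast
      then show False
        using parent_unique[OF assms(1)] parent_not_desc[OF assms(2)] by blast
    qed
  next
    case (step x y)
    show ?case
    proof
      assume "y \<in> desc k"
      moreover have "y \<noteq> k"
        using step.hyps parent_unique[OF assms(2)] parent_not_desc[OF assms(1)] by blast
      ultimately show False
        using desc_cases[of y k] parent_unique[OF step.hyps(2)] step.IH by blast
    qed
  qed
  then show ?thesis by blast
qed

end

section \<open>Cliques and partial bipartitions below a node\<close>

definition clique :: "'a pair_pre_digraph \<Rightarrow> 'a set \<Rightarrow> bool" where
  "clique G K \<longleftrightarrow> (\<forall>x\<in>K. \<forall>y\<in>K. x \<noteq> y \<longrightarrow> (x, y) \<in> parcs G)"

definition clique_free :: "'a pair_pre_digraph \<Rightarrow> nat \<Rightarrow> 'a set \<Rightarrow> bool" where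
  "clique_free G r S \<longleftrightarrow> \<not> (\<exists>K\<subseteq>S. finite K \<and> card K = r \<and> clique G K)"

definition clique_number :: "'a pair_pre_digraph \<Rightarrow> 'a set \<Rightarrow> nat" where
  "clique_number G S = Max (card ` {K. K \<subseteq> S \<and> clique G K})"

definition nbrs :: "'a pair_pre_digraph \<Rightarrow> 'a \<Rightarrow> 'a set" where
  "nbrs G v = {w. (v, w) \<in> parcs G}"

lemma clique_subset: "clique G K \<Longrightarrow> L \<subseteq> K \<Longrightarrow> clique G L"
  unfolding clique_def by blast

lemma clique_free_subset: "clique_free G r S \<Longrightarrow> R \<subseteq> S \<Longrightarrow> clique_free G r R"
  unfolding clique_free_def by blast

lemma clique_number_ge:
  assumes "finite S" "K \<subseteq> S" "clique G K"
  shows "card K \<le> clique_number G S"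
  unfolding clique_number_def using assms by (intro Max_ge) auto

lemma clique_number_attained:
  assumes "finite S"
  obtains K where "K \<subseteq> S" "clique G K" "card K = clique_number G S"
proof -
  have "clique_number G S \<in> card ` {K. K \<subseteq> S \<and> clique G K}"
    unfolding clique_number_def using assms
    by (intro Max_in) (auto simp: clique_def)
  then show ?thesis using that by auto
qed

text \<open>Subsets of cliques are cliques, so a clique with at least \<open>r\<close> vertices
  contains one with exactly \<open>r\<close>.\<close>

lemma clique_free_iff:
  assumes "finite S"
  shows "clique_free G r S \<longleftrightarrow> clique_number G S < r"
proof
  assume free: "clique_free G r S"
  obtain K where K: "K \<subseteq> S" "clique G K" "card K = clique_number G S"
    using clique_number_attained assms by blast
  show "clique_number G S < r"
  proof (rule ccontr)
    assume "\<not> clique_number G S < r"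
    then obtain L where "L \<subseteq> K" "card L = r" "finite L"
      using K(3) obtain_subset_with_card_n[of r K] by (metis not_le)
    moreover from this(1) have "L \<subseteq> S" "clique G L" using K(1) clique_subset[OF K(2)] by auto
    ultimately show False using free unfolding clique_free_def by blast
  qed
next
  assume less: "clique_number G S < r"
  show "clique_free G r S"
    unfolding clique_free_def
  proof clarify
    fix K assume "K \<subseteq> S" "clique G K" "r = card K"
    then show False using clique_number_ge[OF assms, of K G] less by linarith
  qed
qed

lemma clique_number_empty: "clique_number G {} = 0"
  using clique_number_attained[of "{}" G] by fastforce

text \<open>A clique through \<open>v\<close> is \<open>v\<close> together with a clique among the
  neighbours of \<open>v\<close> in \<open>S\<close>; every other clique lies in
  \<open>S\<close>.\<close>

lemma (in pair_graph) clique_number_insert: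
  assumes "finite S" "v \<notin> S"
  shows "clique_number G (insert v S)
    = max (clique_number G S) (Suc (clique_number G (S \<inter> nbrs G v)))"
proof (rule antisym)
  obtain K where K: "K \<subseteq> insert v S" "clique G K" "card K = clique_number G (insert v S)"
    using clique_number_attained assms by (metis finite.insertI)
  have "finite K" using K(1) assms(1) finite_subset by blast
  show "clique_number G (insert v S)
    \<le> max (clique_number G S) (Suc (clique_number G (S \<inter> nbrs G v)))"
  proof (cases "v \<in> K")
    case True
    have "card (K - {v}) \<le> clique_number G (S \<inter> nbrs G v)"
      using K(1,2) True assms
      by (intro clique_number_ge) (auto simp: clique_def nbrs_def)
    moreover have "card K = Suc (card (K - {v}))"
      using True \<open>finite K\<close> by (metis card_Suc_Diff1)
    ultimately show ?thesis using K(3) by linarith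
  next
    case False
    then have "card K \<le> clique_number G S"
      using K(1,2) assms(1) by (intro clique_number_ge) auto
    then show ?thesis using K(3) by linarith
  qed
next
  obtain K where K: "K \<subseteq> S" "clique G K" "card K = clique_number G S"
    using clique_number_attained assms by metis
  have "card K \<le> clique_number G (insert v S)"
    using K assms by (intro clique_number_ge) auto
  moreover
  obtain L where L: "L \<subseteq> S \<inter> nbrs G v" "clique G L" "card L = clique_number G (S \<inter> nbrs G v)"
    using clique_number_attained assms by (metis finite_Int)
  have "clique G (insert v L)"
    using L(1,2) arcs_symmetric unfolding clique_def nbrs_def by blast
  then have "card (insert v L) \<le> clique_number G (insert v S)"
    using L(1) assms by (intro clique_number_ge) auto
  moreover have "card (insert v L) = Suc (card L)"
    using L(1) assms finite_subset by (subst card_insert_disjoint) auto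
  ultimately show "max (clique_number G S) (Suc (clique_number G (S \<inter> nbrs G v)))
    \<le> clique_number G (insert v S)"
    using K(3) L(3) by simp
qed

text \<open>A complete subgraph has all possible arcs between its vertices, so it is determined by
  its vertex set; conversely a clique \<open>K\<close> carries the complete digraph
  \<open>L\<close>. From here on only vertex sets are considered.\<close>

lemma contains_complete_iff:
  assumes "pair_graph G"
  shows "contains_complete r (with_proj G \<restriction> A) \<longleftrightarrow> \<not> clique_free G r A"
proof
  let ?H = "with_proj G \<restriction> A"
  assume "contains_complete r ?H"
  then obtain K where K: "subgraph K ?H" "complete_digraph r K"
    by (auto simp: contains_complete_def)
  interpret K: graph K using K(2) by (simp add: complete_digraph_def)
  have "verts K \<subseteq> A" using K(1) by (auto simp: subgraph_def)
  moreover have "arcs_ends K \<subseteq> parcs G"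
  proof -
    have "arcs K \<subseteq> parcs G" "tail K = fst" "head K = snd"
      using K(1) by (auto simp: subgraph_def compatible_def)
    then show ?thesis by (auto simp: arcs_ends_conv)
  qed
  moreover have "arcs_ends K = {(u, v). (u, v) \<in> verts K \<times> verts K \<and> u \<noteq> v}" "card (verts K) = r"
    using K(2) by (simp_all add: complete_digraph_def)
  ultimately have "verts K \<subseteq> A" "card (verts K) = r" "clique G (verts K)"
    unfolding clique_def by auto
  then show "\<not> clique_free G r A" using K.finite_verts unfolding clique_free_def by blast
next
  interpret pair_graph G by fact
  let ?H = "with_proj G \<restriction> A"
  assume "\<not> clique_free G r A"
  then obtain K where K: "K \<subseteq> A" "finite K" "card K = r" "clique G K"
    by (auto simp: clique_free_def)
  define L where "L = \<lparr>pverts = K, parcs = {(u, v). (u, v) \<in> K \<times> K \<and> u \<noteq> v}\<rparr>"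
  have L: "complete_digraph r (with_proj L)"
    using K by (simp add: complete_digraph_pair_def L_def)
  then interpret L: graph "with_proj L" by (simp add: complete_digraph_def)
  have wf: "wf_digraph ?H"
    by unfold_locales auto
  have "subgraph (with_proj L) ?H"
    unfolding subgraph_def
    using K(1,4) wf L.wf_digraph_axioms
    by (auto simp: L_def compatible_def clique_def)
  then show "contains_complete r ?H" using L by (auto simp: contains_complete_def)
qed

lemma has_bipartition_iff:
  assumes "pair_graph G" "2 \<le> r"
  shows "has_bipartition_without_complete r G \<longleftrightarrow>
    2 \<le> card (pverts G) \<and> (\<exists>A\<subseteq>pverts G. clique_free G r A \<and> clique_free G r (pverts G - A))"
    (is "?L \<longleftrightarrow> ?R")
proof
  interpret pair_graph G by fact
  assume ?L
  then obtain A B where AB: "A \<noteq> {}" "B \<noteq> {}" "A \<union> B = pverts G" "A \<inter> B = {}"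
    "clique_free G r A" "clique_free G r B"
    by (auto simp: has_bipartition_without_complete_def contains_complete_iff[OF assms(1)])
  have fin: "finite A" "finite B" using AB(3) pair_finite_verts by (metis finite_Un)+
  then have "card A \<noteq> 0" "card B \<noteq> 0" using AB by auto
  then have "2 \<le> card A + card B" by linarith
  then have "2 \<le> card (pverts G)" using card_Un_disjoint[OF fin AB(4)] AB(3) by simp
  moreover have "pverts G - A = B" using AB(3,4) by blast
  ultimately show ?R using AB by blast
next
  interpret pair_graph G by fact
  assume R: ?R
  then obtain A where A: "A \<subseteq> pverts G" "clique_free G r A" "clique_free G r (pverts G - A)"
    by blast
  have single: "clique_free G r {v}" for v
    unfolding clique_free_def
  proof clarify
    fix K assume "K \<subseteq> {v}" "r = card K"
    then have "card K \<le> 1" using card_mono[of "{v}" K] by simp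
    then show False using \<open>r = card K\<close> assms(2) by simp
  qed
  \<comment> \<open>The case in which one part of the given bipartition is empty: the whole vertex
    set is then free of cliques of size \<open>r\<close>, and any single vertex can be split
    off.\<close>
  have two: "\<exists>A'\<subseteq>pverts G. A' \<noteq> {} \<and> pverts G - A' \<noteq> {} \<and>
    clique_free G r A' \<and> clique_free G r (pverts G - A')"
    if "clique_free G r (pverts G)"
  proof -
    obtain v where v: "v \<in> pverts G" using R by fastforce
    then have "pverts G - {v} \<noteq> {}"
      using R by (metis Diff_eq_empty_iff card_mono card.empty card_insert_disjoint empty_iff
          finite.intros not_less_eq_eq numeral_2_eq_2)
    then show ?thesis using single[of v] v that clique_free_subset[of G r "pverts G" "pverts G - {v}"]
      by (intro exI[of _ "{v}"]) auto
  qed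
  have "\<exists>A'\<subseteq>pverts G. A' \<noteq> {} \<and> pverts G - A' \<noteq> {} \<and>
    clique_free G r A' \<and> clique_free G r (pverts G - A')"
  proof (cases "A = {} \<or> pverts G - A = {}")
    case True
    then have "clique_free G r (pverts G)" using A
      by (metis Diff_empty Diff_eq_empty_iff subset_antisym)
    then show ?thesis by (rule two)
  next
    case False
    then show ?thesis using A by blast
  qed
  then obtain A' where "A' \<subseteq> pverts G" "A' \<noteq> {}" "pverts G - A' \<noteq> {}"
    "clique_free G r A'" "clique_free G r (pverts G - A')" by blast
  then show ?L
    unfolding has_bipartition_without_complete_def contains_complete_iff[OF assms(1)]
    by (intro exI[of _ A'] exI[of _ "pverts G - A'"]) auto
qed

section \<open>Separation by bags and the recursion for traces\<close>

locale rooted_decomposition =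
  fixes G :: "'a pair_pre_digraph" and T :: "'i pair_pre_digraph" and \<rho> :: 'i
    and X :: "'i \<Rightarrow> 'a set" and r :: nat
  assumes graph: "pair_graph G" and decomposition: "tree_decomposition G T X"
    and root_node: "\<rho> \<in> pverts T"
begin

sublocale T: rooted_tree T \<rho>
  using decomposition root_node by (simp add: rooted_tree_def tree_decomposition_def)

sublocale G: pair_graph G by (rule graph)

abbreviation "ch \<equiv> children T \<rho>"

definition below :: "'i \<Rightarrow> 'a set" where
  "below i = \<Union> (X ` T.desc i)"

lemma bag_below: "X i \<subseteq> below i"
  unfolding below_def using T.desc.self by blast

lemma below_unfold: "below i = X i \<union> (\<Union>j\<in>ch i. below j)"
  unfolding below_def by (subst T.desc_unfold) auto

lemma child_below: "j \<in> ch i \<Longrightarrow> below j \<subseteq> below i"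
  using below_unfold by blast

lemma bag_verts: "i \<in> pverts T \<Longrightarrow> X i \<subseteq> pverts G"
  using decomposition by (auto simp: tree_decomposition_def)

lemma finite_bag: "i \<in> pverts T \<Longrightarrow> finite (X i)"
  using bag_verts G.pair_finite_verts finite_subset by blast

lemma below_verts: "i \<in> pverts T \<Longrightarrow> below i \<subseteq> pverts G"
  unfolding below_def using bag_verts T.desc_verts by blast

lemma below_root: "below \<rho> = pverts G"
proof
  show "below \<rho> \<subseteq> pverts G" using root_node by (rule below_verts)
  show "pverts G \<subseteq> below \<rho>"
    using decomposition unfolding below_def T.desc_root tree_decomposition_def by blast
qed

text \<open>The nodes whose bags contain \<open>v\<close> are connected, so a walk among them leads
  from \<open>a\<close> inside the subtree of \<open>j\<close> to \<open>b\<close> outside. It must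
  use the only arc between the two sides, the one joining \<open>j\<close> and
  \<open>i\<close>.\<close>

lemma separation:
  assumes j: "j \<in> ch i" and a: "a \<in> T.desc j" "v \<in> X a"
    and b: "b \<in> pverts T" "b \<notin> T.desc j" "v \<in> X b"
  shows "v \<in> X i \<and> v \<in> X j"
proof -
  define I where "I = {i \<in> pverts T. v \<in> X i}"
  \<comment> \<open>The induced subtree, written as a pair graph so that walks in it are
    available.\<close>
  define H where "H = \<lparr>pverts = I, parcs = {e \<in> parcs T. fst e \<in> I \<and> snd e \<in> I}\<rparr>"
  have at: "a \<in> pverts T" using a T.desc_verts T.child_verts[OF j] by blast
  have "v \<in> pverts G" using bag_verts b by blast
  then have "Digraph_Component.connected (with_proj T \<restriction> I)"
    using decomposition unfolding tree_decomposition_def I_def by blast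
  moreover have "with_proj T \<restriction> I = with_proj H"
    by (simp add: H_def with_proj_def induce_subgraph_def)
  ultimately have con: "Digraph_Component.connected (with_proj H)" by simp
  have sym: "pair_sym_digraph H"
    using T.arcs_symmetric
    by unfold_locales (auto simp: H_def symmetric_def intro!: symI)
  interpret H: pair_sym_digraph H by (rule sym)
  obtain p where p: "H.awalk a p b"
    using T.symmetric_reach[OF con sym, of a b] a b at by (auto simp: H_def I_def)
  have "\<exists>(x, y)\<in>parcs H. x \<in> T.desc j \<and> y \<notin> T.desc j"
    using p a(1) b(2)
  proof (induction p arbitrary: a)
    case Nil
    then show ?case by (simp add: H.awalk_Nil_iff)
  next
    case (Cons e p)
    then have e: "e \<in> parcs H" "fst e = a" "H.awalk (snd e) p b"
      by (auto simp: H.awalk_Cons_iff)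
    show ?case
    proof (cases "snd e \<in> T.desc j")
      case True
      then show ?thesis using Cons.IH e(3) Cons.prems(3) by blast
    next
      case False
      then show ?thesis using e Cons.prems(2) by (intro bexI[of _ e]) auto
    qed
  qed
  then obtain x y where xy: "(x, y) \<in> parcs H" "x \<in> T.desc j" "y \<notin> T.desc j" by blast
  then have "(x, y) \<in> parcs T" by (simp add: H_def)
  then have "x = j \<and> y = i" using T.desc_crossing[OF j] xy by blast
  then show ?thesis using xy(1) by (simp add: H_def I_def)
qed

text \<open>This is \<open>separation\<close> with \<open>i\<close> as the node outside. It makes
  \<open>X i \<inter> X j\<close> the whole interface between the bag of \<open>i\<close> and the
  vertices below \<open>j\<close>, which is why comparing traces on the two bags suffices.\<close>

lemma below_bag: 
  assumes "j \<in> ch i" "v \<in> below j" "v \<in> X i"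
  shows "v \<in> X j"
proof -
  obtain a where "a \<in> T.desc j" "v \<in> X a" using assms(2) by (auto simp: below_def)
  then show ?thesis
    using separation[OF assms(1), of a v i] T.parent_not_desc[OF assms(1)] T.child_verts[OF assms(1)]
      assms(3) by blast
qed

lemma below_siblings:
  assumes "j \<in> ch i" "k \<in> ch i" "j \<noteq> k" "v \<in> below j" "v \<in> below k"
  shows "v \<in> X i"
proof -
  obtain a where a: "a \<in> T.desc j" "v \<in> X a" using assms(4) by (auto simp: below_def)
  obtain b where b: "b \<in> T.desc k" "v \<in> X b" using assms(5) by (auto simp: below_def)
  have "b \<notin> T.desc j" using T.desc_disjoint[OF assms(1-3)] b(1) by blast
  moreover have "b \<in> pverts T" using b(1) T.desc_verts T.child_verts[OF assms(2)] by blast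
  ultimately show ?thesis using separation[OF assms(1)] a b by blast
qed

text \<open>A vertex \<open>x\<close> of the clique outside the bag of \<open>i\<close> lies below
  some child \<open>j\<close>. Any other vertex of the clique shares a bag with \<open>x\<close>,
  and by \<open>separation\<close> this bag belongs to the subtree of \<open>j\<close>, since
  otherwise \<open>x\<close> would be in the bag of \<open>i\<close>.\<close>

lemma clique_below:
  assumes "i \<in> pverts T" "clique G K" "K \<subseteq> below i"
  shows "K \<subseteq> X i \<or> (\<exists>j\<in>ch i. K \<subseteq> below j)"
proof (cases "K \<subseteq> X i")
  case False
  then obtain x where x: "x \<in> K" "x \<notin> X i" by blast
  then obtain j where j: "j \<in> ch i" "x \<in> below j" using assms(3) below_unfold by blast
  then obtain a where a: "a \<in> T.desc j" "x \<in> X a" by (auto simp: below_def)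
  have "y \<in> below j" if "y \<in> K" for y
  proof (cases "y = x")
    case True
    then show ?thesis using j by simp
  next
    case False
    then have "(x, y) \<in> parcs G" using x that assms(2) by (auto simp: clique_def)
    then obtain b where b: "b \<in> pverts T" "x \<in> X b" "y \<in> X b"
      using decomposition by (auto simp: tree_decomposition_def)
    have "b \<in> T.desc j" using separation[OF j(1) a b(1) _ b(2)] x(2) by blast
    then show ?thesis using b(3) by (auto simp: below_def)
  qed
  then show ?thesis using j by blast
qed simp

definition extendable :: "'i \<Rightarrow> 'a set \<Rightarrow> bool" where
  "extendable i S \<longleftrightarrow>
    (\<exists>A\<subseteq>below i. A \<inter> X i = S \<and> clique_free G r A \<and> clique_free G r (below i - A))"

lemma clique_free_below:
  assumes "i \<in> pverts T" "B \<subseteq> below i" "clique_free G r (B \<inter> X i)"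
    "\<And>j. j \<in> ch i \<Longrightarrow> clique_free G r (B \<inter> below j)"
  shows "clique_free G r B"
  unfolding clique_free_def
proof clarify
  fix K assume K: "K \<subseteq> B" "finite K" "clique G K" "r = card K"
  then have "K \<subseteq> X i \<or> (\<exists>j\<in>ch i. K \<subseteq> below j)"
    using clique_below[OF assms(1)] assms(2) by blast
  then show False
    using assms(3,4) K unfolding clique_free_def by (metis le_inf_iff)
qed

text \<open>From left to right a solution is restricted to the vertices below each child. From right
  to left solutions below the children are glued; they agree where they meet, because that happens
  only in the bag of \<open>i\<close>, where all of them are given by \<open>S\<close>. No clique is
  split between two children.\<close>

lemma extendable_iff:
  assumes "i \<in> pverts T"
  shows "extendable i S \<longleftrightarrow> S \<subseteq> X i \<and> clique_free G r S \<and> clique_free G r (X i - S) \<and>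
    (\<forall>j\<in>ch i. \<exists>S'\<subseteq>X j. extendable j S' \<and> S' \<inter> X i = S \<inter> X j)"
    (is "?L \<longleftrightarrow> ?R")
proof
  assume ?L
  then obtain A where A: "A \<subseteq> below i" "A \<inter> X i = S" "clique_free G r A"
    "clique_free G r (below i - A)" by (auto simp: extendable_def)
  have "clique_free G r S" using clique_free_subset[OF A(3), of S] A(2) by blast
  moreover have "clique_free G r (X i - S)"
    by (rule clique_free_subset[OF A(4)]) (use A(2) bag_below[of i] in blast)
  moreover have "\<exists>S'\<subseteq>X j. extendable j S' \<and> S' \<inter> X i = S \<inter> X j" if j: "j \<in> ch i" for j
  proof (intro exI conjI)
    show "A \<inter> X j \<subseteq> X j" by blast
    show "A \<inter> X j \<inter> X i = S \<inter> X j" using A(2) by blast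
    have "A \<inter> below j \<inter> X j = A \<inter> X j" using bag_below[of j] by blast
    moreover have "clique_free G r (below j - A \<inter> below j)"
      by (rule clique_free_subset[OF A(4)]) (use child_below[OF j] in blast)
    ultimately show "extendable j (A \<inter> X j)"
      unfolding extendable_def using clique_free_subset[OF A(3), of "A \<inter> below j"]
      by (intro exI[of _ "A \<inter> below j"]) simp
  qed
  ultimately show ?R using A by blast
next
  assume R: ?R
  have "\<exists>A. A \<subseteq> below j \<and> A \<inter> X j \<inter> X i = S \<inter> X j \<and> clique_free G r A \<and>
      clique_free G r (below j - A)" if "j \<in> ch i" for j
    using R that unfolding extendable_def by blast
  then obtain \<A> where \<A>: "\<And>j. j \<in> ch i \<Longrightarrow> \<A> j \<subseteq> below j \<and> \<A> j \<inter> X j \<inter> X i = S \<inter> X j \<and>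
      clique_free G r (\<A> j) \<and> clique_free G r (below j - \<A> j)"
    by metis
  \<comment> \<open>The glued solution. The facts \<open>AX\<close> and \<open>Aj\<close> say that
    gluing adds nothing to the trace \<open>S\<close> and nothing to any of the pieces.\<close>
  define A where "A = S \<union> (\<Union>j\<in>ch i. \<A> j)"
  have mem: "x \<in> S" if "j \<in> ch i" "x \<in> \<A> j" "x \<in> X i" for x j
    using \<A>[OF that(1)] below_bag[OF that(1) _ that(3)] that by blast
  have AX: "A \<inter> X i = S" using R mem unfolding A_def by blast
  have Aj: "A \<inter> below j = \<A> j" if j: "j \<in> ch i" for j
  proof
    show "\<A> j \<subseteq> A \<inter> below j" using \<A>[OF j] j unfolding A_def by blast
    show "A \<inter> below j \<subseteq> \<A> j"
    proof
      fix x assume x: "x \<in> A \<inter> below j"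
      have "x \<in> \<A> j" if "x \<in> S"
        using that R below_bag[OF j, of x] x \<A>[OF j] by blast
      moreover have "x \<in> S" if "k \<in> ch i" "k \<noteq> j" "x \<in> \<A> k" for k
        using mem[OF that(1,3)] below_siblings[OF that(1) j that(2), of x] \<A>[OF that(1)] x that
        by blast
      ultimately show "x \<in> \<A> j" using x unfolding A_def by blast
    qed
  qed
  have "\<A> j \<subseteq> below i" if "j \<in> ch i" for j using \<A>[OF that] child_below[OF that] by blast
  then have sub: "A \<subseteq> below i" using R bag_below[of i] unfolding A_def by blast
  have "clique_free G r A"
    by (rule clique_free_below[OF assms sub]) (use AX Aj R \<A> in auto)
  moreover have "clique_free G r (below i - A)"
  proof (rule clique_free_below[OF assms])
    have "(below i - A) \<inter> X i = X i - S" using AX bag_below[of i] by blast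
    then show "clique_free G r ((below i - A) \<inter> X i)" using R by simp
    fix j assume j: "j \<in> ch i"
    have "(below i - A) \<inter> below j = below j - \<A> j" using Aj[OF j] child_below[OF j] by blast
    then show "clique_free G r ((below i - A) \<inter> below j)" using \<A>[OF j] by simp
  qed blast
  ultimately show ?L unfolding extendable_def using sub AX by blast
qed

lemma has_bipartition_iff_extendable:
  assumes "2 \<le> r"
  shows "has_bipartition_without_complete r G \<longleftrightarrow>
    2 \<le> card (pverts G) \<and> (\<exists>S\<subseteq>X \<rho>. extendable \<rho> S)"
  unfolding has_bipartition_iff[OF graph assms] extendable_def below_root by blast

end

section \<open>Running time of structured programs\<close>

text \<open>Total correctness, with the running time passed to the postcondition. As execution is
  deterministic, one terminating run decides the matter, and the rules for loop-free code become
  equations usable by the simplifier.\<close>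

definition wp :: "com \<Rightarrow> (nat \<Rightarrow> state \<Rightarrow> bool) \<Rightarrow> state \<Rightarrow> bool" where
  "wp c Q s \<longleftrightarrow> (\<exists>k s'. exec c s k s' \<and> Q k s')"

lemma wp_exec: "exec c s k s' \<Longrightarrow> wp c Q s \<longleftrightarrow> Q k s'"
  unfolding wp_def using exec_deterministic by blast

lemma wp_Skip [simp]: "wp Skip Q s \<longleftrightarrow> Q 1 s"
  by (rule wp_exec[OF exec.Skip])

lemma wp_Assign [simp]:
  "wp (Assign x a) Q s \<longleftrightarrow> Q (acost a + 1) ((fst s)(x := aval a s), snd s)"
  by (rule wp_exec[OF exec.Assign])

lemma wp_Store [simp]:
  "wp (Store a b) Q s \<longleftrightarrow> Q (acost a + acost b + 1) (fst s, (snd s)(aval a s := aval b s))"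
  by (rule wp_exec[OF exec.Store])

lemma wp_Seq [simp]: "wp (Seq c d) Q s \<longleftrightarrow> wp c (\<lambda>k. wp d (\<lambda>l. Q (k + l))) s"
  unfolding wp_def by (blast intro: exec.Seq elim: exec_SeqE)

lemma wp_Cond [simp]:
  "wp (Cond b c d) Q s \<longleftrightarrow>
    (if bval b s then wp c (\<lambda>k. Q (bcost b + 1 + k)) s else wp d (\<lambda>k. Q (bcost b + 1 + k)) s)"
proof (cases "bval b s")
  case True
  then have "exec (Cond b c d) s k s' \<longleftrightarrow> (\<exists>l. k = bcost b + 1 + l \<and> exec c s l s')" for k s'
    using exec.CondTrue[of b s c _ s' d] by (auto elim!: exec_CondE)
  with True show ?thesis unfolding wp_def by metis
next
  case False
  then have "exec (Cond b c d) s k s' \<longleftrightarrow> (\<exists>l. k = bcost b + 1 + l \<and> exec d s l s')" for k s'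
    using exec.CondFalse[of b s d _ s' c] by (auto elim!: exec_CondE)
  with False show ?thesis unfolding wp_def by metis
qed

lemma wp_mono: "wp c P s \<Longrightarrow> (\<And>k s'. P k s' \<Longrightarrow> Q k s') \<Longrightarrow> wp c Q s"
  unfolding wp_def by blast

lemma wp_WhileFalse: "\<not> bval b s \<Longrightarrow> Q (bcost b + 1) s \<Longrightarrow> wp (While b c) Q s"
  unfolding wp_def by (blast intro: exec.WhileFalse)

lemma wp_WhileTrue:
  "bval b s \<Longrightarrow> wp c (\<lambda>k. wp (While b c) (\<lambda>l. Q (bcost b + 1 + k + l))) s \<Longrightarrow> wp (While b c) Q s"
  unfolding wp_def by (blast intro: exec.WhileTrue)

fun assigned :: "com \<Rightarrow> string set" where
  "assigned Skip = {}"
| "assigned (Assign x a) = {x}"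
| "assigned (Store a b) = {}"
| "assigned (Seq c d) = assigned c \<union> assigned d"
| "assigned (Cond b c d) = assigned c \<union> assigned d"
| "assigned (While b c) = assigned c"

lemma exec_not_assigned: "exec c s k s' \<Longrightarrow> x \<notin> assigned c \<Longrightarrow> fst s' x = fst s x"
  by (induction rule: exec.induct) auto

text \<open>The frame rule for registers: a syntactic check tells which registers survive, so that
  specifications of subroutines need not list them.\<close>

lemma wp_call:
  assumes "wp c P s"
    and "\<And>k s'. P k s' \<Longrightarrow> (\<And>x. x \<notin> assigned c \<Longrightarrow> fst s' x = fst s x) \<Longrightarrow> Q k s'"
  shows "wp c Q s"
  using assms exec_not_assigned unfolding wp_def by metis

text \<open>Time is only bounded from above, so the bounds of the two parts may be rounded up
  freely; \<open>b'\<close> is the budget left for the second part.\<close>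

lemma wp_seq_le:
  assumes "wp c (\<lambda>k s'. k \<le> b \<and> P s') s"
    and "\<And>s'. P s' \<Longrightarrow> (\<And>x. x \<notin> assigned c \<Longrightarrow> fst s' x = fst s x) \<Longrightarrow>
      wp d (\<lambda>k s''. k \<le> b' \<and> Q s'') s'"
    and "b + b' \<le> B"
  shows "wp (Seq c d) (\<lambda>k s''. k \<le> B \<and> Q s'') s"
  unfolding wp_Seq
proof (rule wp_call[OF assms(1)])
  fix k s' assume k: "k \<le> b \<and> P s'" and frame: "\<And>x. x \<notin> assigned c \<Longrightarrow> fst s' x = fst s x"
  have w: "wp d (\<lambda>k s''. k \<le> b' \<and> Q s'') s'" using k frame by (intro assms(2)) auto
  show "wp d (\<lambda>l s''. k + l \<le> B \<and> Q s'') s'"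
    by (rule wp_mono[OF w]) (use k assms(3) in auto)
qed

lemma wp_assign_seq_le:
  assumes "aval a s = v" "wp d (\<lambda>k s'. k \<le> b \<and> Q s') ((fst s)(x := v), snd s)" "acost a + 1 + b \<le> B"
  shows "wp (Seq (Assign x a) d) (\<lambda>k s'. k \<le> B \<and> Q s') s"
  unfolding wp_Seq wp_Assign assms(1) by (rule wp_mono[OF assms(2)]) (use assms(3) in auto)

lemma wp_store_seq_le:
  assumes "aval a s = p" "aval e s = v" "wp d (\<lambda>k s'. k \<le> b \<and> Q s') (fst s, (snd s)(p := v))"
    "acost a + acost e + 1 + b \<le> B"
  shows "wp (Seq (Store a e) d) (\<lambda>k s'. k \<le> B \<and> Q s') s"
  unfolding wp_Seq wp_Store assms(1,2) by (rule wp_mono[OF assms(3)]) (use assms(4) in auto)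

lemma wp_le_mono:
  assumes "wp c (\<lambda>k s'. k \<le> b \<and> P s') s" "b \<le> B"
    "\<And>s'. P s' \<Longrightarrow> (\<And>x. x \<notin> assigned c \<Longrightarrow> fst s' x = fst s x) \<Longrightarrow> Q s'"
  shows "wp c (\<lambda>k s'. k \<le> B \<and> Q s') s"
  by (rule wp_call[OF assms(1)]) (use assms(2,3) in auto)

definition For :: "string \<Rightarrow> string \<Rightarrow> com \<Rightarrow> com" where
  "For x z c = Seq (Assign x (Const 0))
    (While (Less (Reg x) (Reg z)) (Seq c (Assign x (Plus (Reg x) (Const 1)))))"

lemma assigned_For [simp]: "assigned (For x z c) = insert x (assigned c)"
  by (auto simp: For_def)

text \<open>The body establishes the invariant for the state in which the counter has already been
  increased. The summand 8 is the cost of a test (4) and of the increment (4); the final 6 is the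
  initial assignment (2) and the failing test (4). The bound \<open>B j\<close> may depend on the
  round, which geometric sums require.\<close>

lemma wp_For:
  fixes I :: "nat \<Rightarrow> state \<Rightarrow> bool"
  assumes init: "I 0 ((fst s0)(x := 0), snd s0)"
    and N: "fst s0 z = N" "x \<notin> assigned c" "z \<notin> assigned c" "x \<noteq> z"
    and body: "\<And>j s. j < N \<Longrightarrow> I j s \<Longrightarrow> fst s x = j \<Longrightarrow>
      (\<And>y. y \<notin> insert x (assigned c) \<Longrightarrow> fst s y = fst s0 y) \<Longrightarrow>
      wp c (\<lambda>k s'. k \<le> B j \<and> I (Suc j) ((fst s')(x := Suc j), snd s')) s"
  shows "wp (For x z c) (\<lambda>k s'. k \<le> (\<Sum>j<N. B j + 8) + 6 \<and> (I N s' \<and> fst s' x = N)) s0"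
proof -
  let ?w = "While (Less (Reg x) (Reg z)) (Seq c (Assign x (Plus (Reg x) (Const 1))))"
  have loop: "wp ?w (\<lambda>k s'. k \<le> (\<Sum>j\<in>{i..<N}. B j + 8) + 4 \<and> I N s' \<and> fst s' x = N) s"
    if "i \<le> N" "I i s" "fst s x = i" "\<And>y. y \<notin> insert x (assigned c) \<Longrightarrow> fst s y = fst s0 y"
    for i s
    using that
  proof (induction "N - i" arbitrary: i s)
    case 0
    then have "i = N" by simp
    moreover have "fst s z = N" using 0 N by simp
    ultimately show ?case using 0 by (intro wp_WhileFalse) auto
  next
    case (Suc d)
    then have "i < N" by simp
    have z: "fst s z = N" using Suc.prems N by simp
    have sum: "(\<Sum>j\<in>{i..<N}. B j + 8) = B i + 8 + (\<Sum>j\<in>{Suc i..<N}. B j + 8)"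
      using \<open>i < N\<close> by (simp add: sum.atLeast_Suc_lessThan)
    show ?case
    proof (rule wp_WhileTrue)
      show "bval (Less (Reg x) (Reg z)) s" using z Suc.prems \<open>i < N\<close> by simp
      show "wp (Seq c (Assign x (Plus (Reg x) (Const 1)))) (\<lambda>k. wp ?w (\<lambda>l s'.
          bcost (Less (Reg x) (Reg z)) + 1 + k + l \<le> (\<Sum>j\<in>{i..<N}. B j + 8) + 4 \<and>
          I N s' \<and> fst s' x = N)) s"
        unfolding wp_Seq
      proof (rule wp_call[OF body[OF \<open>i < N\<close> Suc.prems(2,3,4)]])
        fix k s'
        assume k: "k \<le> B i \<and> I (Suc i) ((fst s')(x := Suc i), snd s')"
          and frame: "\<And>x. x \<notin> assigned c \<Longrightarrow> fst s' x = fst s x"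
        have x: "fst s' x = i" using frame[OF N(2)] Suc.prems(3) by simp
        have "wp ?w (\<lambda>l s''. l \<le> (\<Sum>j\<in>{Suc i..<N}. B j + 8) + 4 \<and> I N s'' \<and> fst s'' x = N)
            ((fst s')(x := Suc i), snd s')"
          by (rule Suc.hyps(1)) (use Suc.hyps(2) Suc.prems k frame \<open>i < N\<close> in auto)
        note w = this
        have eq: "((fst s')(x := aval (Plus (Reg x) (Const 1)) s'), snd s')
            = ((fst s')(x := Suc i), snd s')" using x by simp
        show "wp (Assign x (Plus (Reg x) (Const 1))) (\<lambda>l. wp ?w (\<lambda>l' s'.
          bcost (Less (Reg x) (Reg z)) + 1 + (k + l) + l' \<le> (\<Sum>j\<in>{i..<N}. B j + 8) + 4 \<and>
          I N s' \<and> fst s' x = N)) s'"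
          unfolding wp_Assign eq by (rule wp_mono[OF w]) (use k sum in auto)
      qed (fact | simp)+
    qed
  qed
  have "wp ?w (\<lambda>k s'. k \<le> (\<Sum>j\<in>{0..<N}. B j + 8) + 4 \<and> I N s' \<and> fst s' x = N)
      ((fst s0)(x := 0), snd s0)"
    by (rule loop) (use init N in auto)
  note w = this
  show ?thesis
    unfolding For_def wp_Seq wp_Assign aval.simps
    by (rule wp_mono[OF w]) (auto simp: atLeast0LessThan)
qed

text \<open>
  The memory is used as a matrix whose rows have length \<open>W\<close>; the input lies in row 0. Below,
  \<open>W = 2 ^ length xs\<close>, which can be computed by additions and exceeds all column indices.
\<close>

definition addr :: "nat \<Rightarrow> nat \<Rightarrow> nat \<Rightarrow> nat" where
  "addr W a b = a * W + b"

lemma addr_add [simp]: "addr W a b + c = addr W a (b + c)"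
  by (simp add: addr_def)

lemma addr_row_zero: "addr W 0 b = b"
  by (simp add: addr_def)

lemma addr_eq_iff [simp]:
  assumes "b < W" "b' < W"
  shows "addr W a b = addr W a' b' \<longleftrightarrow> a = a' \<and> b = b'"
proof
  assume eq: "addr W a b = addr W a' b'"
  have "addr W a b div W = a" "addr W a' b' div W = a'" "addr W a b mod W = b" "addr W a' b' mod W = b'"
    using assms by (simp_all add: addr_def)
  then show "a = a' \<and> b = b'" using eq by metis
qed simp

lemma addr_eq_input_iff [simp]:
  assumes "b < W" "p < W"
  shows "addr W a b = p \<longleftrightarrow> a = 0 \<and> b = p" "p = addr W a b \<longleftrightarrow> a = 0 \<and> b = p"
  using addr_eq_iff[OF assms, of a 0] unfolding addr_row_zero by auto

text \<open>The frame condition for the memory: \<open>R\<close> is the set of rows that may have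
  changed.\<close>

definition same_outside :: "nat \<Rightarrow> nat set \<Rightarrow> (nat \<Rightarrow> nat) \<Rightarrow> (nat \<Rightarrow> nat) \<Rightarrow> bool" where
  "same_outside W R m m' \<longleftrightarrow> (\<forall>a b. b < W \<longrightarrow> a \<notin> R \<longrightarrow> m' (addr W a b) = m (addr W a b))"

lemma same_outsideD:
  "same_outside W R m m' \<Longrightarrow> b < W \<Longrightarrow> a \<notin> R \<Longrightarrow> m' (addr W a b) = m (addr W a b)"
  unfolding same_outside_def by blast

lemma same_outside_input:
  "same_outside W R m m' \<Longrightarrow> p < W \<Longrightarrow> 0 \<notin> R \<Longrightarrow> m' p = m p"
  using same_outsideD[of W R m m' p 0] by (simp add: addr_row_zero)

lemma same_outside_refl [simp]: "same_outside W R m m"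
  by (simp add: same_outside_def)

lemma same_outside_trans:
  "same_outside W R m m' \<Longrightarrow> same_outside W R' m' m'' \<Longrightarrow> R \<subseteq> S \<Longrightarrow> R' \<subseteq> S \<Longrightarrow> same_outside W S m m''"
  unfolding same_outside_def by (metis subsetD)

lemma same_outside_update:
  "same_outside W R m m' \<Longrightarrow> a \<in> R \<Longrightarrow> b < W \<Longrightarrow> same_outside W R m (m'(addr W a b := v))"
  unfolding same_outside_def by auto

section \<open>Enumeration of subsets by doubling\<close>

fun sublists_sets :: "'a list \<Rightarrow> 'a set list" where
  "sublists_sets [] = [{}]"
| "sublists_sets (x # xs) = sublists_sets xs @ map (insert x) (sublists_sets xs)"

text \<open>The reversal makes binary digit \<open>e\<close> of an index decide whether
  \<open>xs ! e\<close> belongs to the subset. Appending an element then appends a second half to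
  the list and leaves the first half in place.\<close>

definition psets :: "'a list \<Rightarrow> 'a set list" where
  "psets xs = sublists_sets (rev xs)"

lemma psets_Nil [simp]: "psets [] = [{}]"
  by (simp add: psets_def)

lemma psets_snoc: "psets (xs @ [x]) = psets xs @ map (insert x) (psets xs)"
  by (simp add: psets_def)

lemma length_psets [simp]: "length (psets xs) = 2 ^ length xs"
  by (induction xs rule: rev_induct) (auto simp: psets_snoc)

lemma set_psets: "set (psets xs) = Pow (set xs)"
  by (induction xs rule: rev_induct) (auto simp: psets_snoc Pow_insert)

lemma psets_subset: "i < 2 ^ length xs \<Longrightarrow> psets xs ! i \<subseteq> set xs"
  using set_psets[of xs] nth_mem[of i "psets xs"] by auto

lemma psets_surj:
  assumes "S \<subseteq> set xs"
  obtains i where "i < 2 ^ length xs" "psets xs ! i = S"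
  using assms set_psets[of xs] by (metis PowI in_set_conv_nth length_psets)

lemma psets_last: "psets xs ! (2 ^ length xs - 1) = set xs"
proof (induction xs rule: rev_induct)
  case (snoc x xs)
  have pos: "(1::nat) \<le> 2 ^ length xs" by simp
  then have "(2::nat) ^ length (xs @ [x]) - 1 = 2 ^ length xs + (2 ^ length xs - 1)" by simp
  moreover have less: "(2::nat) ^ length xs - 1 < 2 ^ length xs" using pos by simp
  ultimately have "psets (xs @ [x]) ! (2 ^ length (xs @ [x]) - 1)
      = map (insert x) (psets xs) ! (2 ^ length xs - 1)"
    using nth_append_length_plus[of "psets xs" "map (insert x) (psets xs)"]
    by (simp only: psets_snoc length_psets)
  then show ?case using snoc less by simp
qed simp

lemma psets_take_low:
  assumes "e < length xs" "i < 2 ^ e"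
  shows "psets (take (Suc e) xs) ! i = psets (take e xs) ! i"
  using assms by (simp add: take_Suc_conv_app_nth psets_snoc nth_append)

lemma psets_take_high:
  assumes "e < length xs" "i < 2 ^ e"
  shows "psets (take (Suc e) xs) ! (2 ^ e + i) = insert (xs ! e) (psets (take e xs) ! i)"
  using assms by (simp add: take_Suc_conv_app_nth psets_snoc nth_append)

text \<open>Input: \<open>''D''\<close> is the row to be filled, \<open>''R''\<close> the row of
  summands, and the list starts at address \<open>''a''\<close> and has length \<open>''k''\<close>.
  Register \<open>''z''\<close> holds the number of subsets enumerated so far and ends as their
  total number, which bounds the loops of the callers.\<close>

definition subset_sums :: com where
  "subset_sums = Seq (Store (Reg ''D'') (Const 0)) (Seq (Assign ''z'' (Const 1))
    (For ''e'' ''k'' (Seq (Assign ''w'' (Mem (Plus (Reg ''R'') (Mem (Plus (Reg ''a'') (Reg ''e''))))))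
      (Seq (For ''f'' ''z''
        (Store (Plus (Reg ''D'') (Plus (Reg ''z'') (Reg ''f'')))
          (Plus (Mem (Plus (Reg ''D'') (Reg ''f''))) (Reg ''w''))))
      (Assign ''z'' (Plus (Reg ''z'') (Reg ''z'')))))))"

lemma assigned_subset_sums [simp]: "assigned subset_sums = {''z'', ''e'', ''w'', ''f''}"
  by (auto simp: subset_sums_def)

lemma sum_pow2_less: "(\<Sum>j<n. 2 ^ j) + 1 = (2 :: nat) ^ n"
  by (induction n) auto

text \<open>Round \<open>e\<close> copies \<open>2 ^ e\<close> sums, so the cost is a geometric
  series, of the order of the number of subsets. The rows \<open>d\<close> and \<open>u\<close>
  differ, and \<open>d\<close> is not the input row, so writing disturbs neither the summands nor
  the list.\<close>

lemma wp_subset_sums: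
  assumes D: "fst s ''D'' = addr W d 0" and R: "fst s ''R'' = addr W u 0"
    and rows: "d \<noteq> 0" "d \<noteq> u"
    and k: "fst s ''k'' = length xs" and a: "fst s ''a'' + length xs \<le> W"
    and xs: "\<And>e. e < length xs \<Longrightarrow> snd s (fst s ''a'' + e) = xs ! e" "distinct xs"
      "\<And>x. x \<in> set xs \<Longrightarrow> x < W"
    and W: "2 ^ length xs \<le> W"
  shows "wp subset_sums (\<lambda>c s'. c \<le> 70 * 2 ^ length xs \<and> fst s' ''z'' = 2 ^ length xs \<and>
    (\<forall>i<2 ^ length xs. snd s' (addr W d i) = (\<Sum>x\<in>psets xs ! i. snd s (addr W u x))) \<and>
    same_outside W {d} (snd s) (snd s')) s"
proof -
  define g where "g x = snd s (addr W u x)" for x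
  define s0 where "s0 = ((fst s)(''z'' := 1), (snd s)(addr W d 0 := 0))"
  have "0 < W" using W by (metis gr0I not_one_le_zero numeral_2_eq_2 one_le_power le_trans less_numeral_extra(3) one_le_numeral le_zero_eq)
  have W': "2 ^ e \<le> W" if "e \<le> length xs" for e
    using that W by (meson le_trans one_le_numeral power_increasing)
  define Inv where "Inv e s' \<longleftrightarrow> fst s' ''z'' = 2 ^ e \<and>
    (\<forall>i<2 ^ e. snd s' (addr W d i) = (\<Sum>x\<in>psets (take e xs) ! i. g x)) \<and>
    same_outside W {d} (snd s) (snd s')" for e and s' :: state
  let ?inner = "Store (Plus (Reg ''D'') (Plus (Reg ''z'') (Reg ''f'')))
          (Plus (Mem (Plus (Reg ''D'') (Reg ''f''))) (Reg ''w''))"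
  let ?body = "Seq (Assign ''w'' (Mem (Plus (Reg ''R'') (Mem (Plus (Reg ''a'') (Reg ''e''))))))
      (Seq (For ''f'' ''z'' ?inner) (Assign ''z'' (Plus (Reg ''z'') (Reg ''z''))))"
  have "wp (For ''e'' ''k'' ?body) (\<lambda>c s'. c \<le> (\<Sum>e<length xs. (20 * 2 ^ e + 30) + 8) + 6 \<and>
      Inv (length xs) s' \<and> fst s' ''e'' = length xs) s0"
  proof (rule wp_For)
    show "Inv 0 ((fst s0)(''e'' := 0), snd s0)"
      using \<open>0 < W\<close> by (auto simp: Inv_def s0_def intro: same_outside_update)
    show "fst s0 ''k'' = length xs" using k by (simp add: s0_def)
    fix e s1 
    assume e: "e < length xs" and inv: "Inv e s1" and e': "fst s1 ''e'' = e"
      and frame: "\<And>y. y \<notin> insert ''e'' (assigned ?body) \<Longrightarrow> fst s1 y = fst s0 y"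
    have regs: "fst s1 ''D'' = addr W d 0" "fst s1 ''R'' = addr W u 0" "fst s1 ''a'' = fst s ''a''"
      using frame D R by (simp_all add: s0_def)
    have z: "fst s1 ''z'' = 2 ^ e" and sm: "same_outside W {d} (snd s) (snd s1)"
      and low: "\<And>i. i < 2 ^ e \<Longrightarrow> snd s1 (addr W d i) = (\<Sum>x\<in>psets (take e xs) ! i. g x)"
      using inv by (auto simp: Inv_def)
    have dbl: "2 ^ e + 2 ^ e \<le> W" using W'[of "Suc e"] e by simp
    have "snd s1 (fst s ''a'' + e) = xs ! e"
      using same_outside_input[OF sm] rows a e xs(1)[OF e] by simp
    moreover have "snd s1 (addr W u (xs ! e)) = g (xs ! e)"
      unfolding g_def using same_outsideD[OF sm xs(3)] rows e by simp
    ultimately have w: "aval (Mem (Plus (Reg ''R'') (Mem (Plus (Reg ''a'') (Reg ''e''))))) s1 = g (xs ! e)"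
      using regs e' by simp
    define s2 where "s2 = ((fst s1)(''w'' := g (xs ! e)), snd s1)"
    define J where "J f s' \<longleftrightarrow> 
      (\<forall>i<2 ^ e. snd s' (addr W d i) = (\<Sum>x\<in>psets (take e xs) ! i. g x)) \<and>
      (\<forall>i<f. snd s' (addr W d (2 ^ e + i)) = (\<Sum>x\<in>psets (take e xs) ! i. g x) + g (xs ! e)) \<and>
      same_outside W {d} (snd s) (snd s')" for f and s' :: state
    have inner: "wp (For ''f'' ''z'' ?inner) (\<lambda>c s'. c \<le> (\<Sum>f<(2::nat) ^ e. 12 + 8) + 6 \<and> J (2 ^ e) s' \<and>
        fst s' ''f'' = 2 ^ e) s2"
    proof (rule wp_For)
      show "J 0 ((fst s2)(''f'' := 0), snd s2)"
        using low sm by (auto simp: J_def s2_def)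
      show "fst s2 ''z'' = 2 ^ e" using z by (simp add: s2_def)
      fix f s3
      assume f: "f < 2 ^ e" and J: "J f s3" and f': "fst s3 ''f'' = f"
        and frame: "\<And>y. y \<notin> insert ''f'' (assigned ?inner) \<Longrightarrow> fst s3 y = fst s2 y"
      have regs3: "fst s3 ''D'' = addr W d 0" "fst s3 ''z'' = 2 ^ e" "fst s3 ''w'' = g (xs ! e)"
        using frame regs z by (simp_all add: s2_def)
      have "2 ^ e + f < W" "f < W" using f dbl by auto
      then show "wp ?inner (\<lambda>c s'. c \<le> 12 \<and> J (Suc f) ((fst s')(''f'' := Suc f), snd s')) s3"
        using J f dbl regs3 f'
        by (auto simp: J_def less_Suc_eq intro: same_outside_update)
    qed simp_all
    have "wp (Seq (For ''f'' ''z'' ?inner) (Assign ''z'' (Plus (Reg ''z'') (Reg ''z''))))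
       (\<lambda>c s'. c \<le> 20 * 2 ^ e + 10 \<and> Inv (Suc e) ((fst s')(''e'' := Suc e), snd s')) s2"
      unfolding wp_Seq
    proof (rule wp_call[OF inner])
      fix c :: nat and s'
      assume c: "c \<le> (\<Sum>f<(2::nat) ^ e. 12 + 8) + 6 \<and> J (2 ^ e) s' \<and> fst s' ''f'' = 2 ^ e"
        and frame: "\<And>x. x \<notin> assigned (For ''f'' ''z'' ?inner) \<Longrightarrow> fst s' x = fst s2 x"
      have z': "fst s' ''z'' = 2 ^ e" using frame z by (simp add: s2_def)
      have val: "snd s' (addr W d i) = (\<Sum>x\<in>psets (take (Suc e) xs) ! i. g x)" if "i < 2 ^ Suc e" for i
      proof (cases "i < 2 ^ e")
        case True
        then show ?thesis using c e by (simp add: J_def psets_take_low)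
      next
        case False
        define i' where "i' = i - 2 ^ e"
        have i': "i = 2 ^ e + i'" "i' < 2 ^ e" using False that by (auto simp: i'_def)
        have sub: "psets (take e xs) ! i' \<subseteq> set (take e xs)"
          using psets_subset[of i' "take e xs"] i' e by simp
        \<comment> \<open>Distinctness enters here: the new element is in none of the old subsets,
          so inserting it raises each sum by exactly its entry.\<close>
        have "xs ! e \<notin> set (take e xs)"
          using e xs(2) by (auto simp: in_set_conv_nth nth_eq_iff_index_eq)
        then have "xs ! e \<notin> psets (take e xs) ! i'" using sub by blast
        moreover have "finite (psets (take e xs) ! i')" using sub finite_subset by blast
        ultimately have "(\<Sum>x\<in>psets (take (Suc e) xs) ! i. g x) = g (xs ! e) + (\<Sum>x\<in>psets (take e xs) ! i'. g x)"
          using i' e by (simp add: psets_take_high)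
        then show ?thesis using c i' by (simp add: J_def)
      qed
      then show "wp (Assign ''z'' (Plus (Reg ''z'') (Reg ''z'')))
         (\<lambda>l s'. c + l \<le> 20 * 2 ^ e + 10 \<and> Inv (Suc e) ((fst s')(''e'' := Suc e), snd s')) s'"
        using c z' by (auto simp: Inv_def J_def)
    qed
    then have w2: "wp (Seq (For ''f'' ''z'' ?inner) (Assign ''z'' (Plus (Reg ''z'') (Reg ''z''))))
       (\<lambda>c s'. c + 9 \<le> 20 * 2 ^ e + 30 \<and> Inv (Suc e) ((fst s')(''e'' := Suc e), snd s')) s2"
      by (rule wp_mono) auto
    show "wp ?body (\<lambda>c s'. c \<le> 20 * 2 ^ e + 30 \<and> Inv (Suc e) ((fst s')(''e'' := Suc e), snd s')) s1"
      unfolding wp_Seq[of "Assign ''w'' _"] wp_Assign w s2_def[symmetric]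
      by (rule wp_mono[OF w2]) auto
  qed simp_all
  moreover have "(\<Sum>e<length xs. (20 * 2 ^ e + 30) + 8) + 16 \<le> 70 * (2 ^ length xs :: nat)"
  proof -
    have "(\<Sum>e<length xs. (20 * 2 ^ e + 30) + 8) = 20 * (\<Sum>e<length xs. 2 ^ e) + 38 * length xs"
      by (simp add: sum.distrib sum_distrib_left)
    moreover have "(\<Sum>e<length xs. 2 ^ e) + 1 = (2::nat) ^ length xs" by (rule sum_pow2_less)
    moreover have "length xs < 2 ^ length xs" by (rule less_exp)
    ultimately show ?thesis by linarith
  qed
  ultimately have w: "wp (For ''e'' ''k'' ?body) (\<lambda>c s'. c + 5 \<le> 70 * 2 ^ length xs \<and> Inv (length xs) s') s0"
    by (elim wp_mono) auto
  have s0: "((fst (fst s, (snd s)(aval (Reg ''D'') s := aval (Const 0) s)))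
      (''z'' := aval (Const 1) (fst s, (snd s)(aval (Reg ''D'') s := aval (Const 0) s))),
      snd (fst s, (snd s)(aval (Reg ''D'') s := aval (Const 0) s))) = s0"
    using D by (simp add: s0_def)
  show ?thesis
    unfolding subset_sums_def wp_Seq[of "Store _ _"] wp_Store wp_Seq[of "Assign ''z'' (Const 1)"]
      wp_Assign s0
    by (rule wp_mono[OF w]) (auto simp: Inv_def g_def)
qed

section \<open>Processing a node\<close>

lemma set_encode_less: "S \<subseteq> {..<n} \<Longrightarrow> set_encode S < 2 ^ n"
proof -
  assume "S \<subseteq> {..<n}"
  then have "set_encode S \<le> (\<Sum>i<n. 2 ^ i)"
    unfolding set_encode_def by (intro sum_mono2) auto
  then show ?thesis using sum_pow2_less[of n] by linarith
qed

lemma set_encode_eq_iff: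
  "S \<subseteq> {..<n} \<Longrightarrow> S' \<subseteq> {..<n} \<Longrightarrow> set_encode S = set_encode S' \<longleftrightarrow> S = S'"
  using set_encode_eq finite_subset[of _ "{..<n}"] by auto

text \<open>Stands in for a bitwise conjunction: each member contributes its digit if it is marked
  and 0 otherwise.\<close>

lemma sum_marks:
  assumes "finite S" "\<And>x. x \<in> S \<Longrightarrow> f x = (if x \<in> Y then 2 ^ x else (0::nat))"
  shows "(\<Sum>x\<in>S. f x) = set_encode (S \<inter> Y)"
  using assms by (simp add: set_encode_def sum.inter_restrict)

abbreviation Mem_at :: "string \<Rightarrow> aexp \<Rightarrow> aexp" where
  "Mem_at x a \<equiv> Mem (Plus (Reg x) a)"

definition subset_sums_into :: "string \<Rightarrow> aexp \<Rightarrow> com" where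
  "subset_sums_into d w = Seq (Assign ''D'' (Reg d)) (Seq (Assign ''R'' w) subset_sums)"

definition clique_number_update :: com where
  "clique_number_update =
    Seq (Assign ''t'' (Mem_at ''G'' (Mem_at ''L'' (Reg ''g''))))
    (Seq (Assign ''x'' (Plus (Mem_at ''G'' (Mem_at ''M'' (Reg ''g''))) (Const 1)))
    (Seq (Cond (Less (Reg ''t'') (Reg ''x'')) (Assign ''t'' (Reg ''x'')) Skip)
      (Store (Plus (Reg ''G'') (Plus (Mem_at ''L'' (Reg ''g'')) (Reg ''u''))) (Reg ''t''))))"

text \<open>Adds the vertex \<open>v\<close> at position \<open>''k''\<close> of the bag. Row
  \<open>''L''\<close> receives the codes of the subsets of the preceding vertices, row
  \<open>''M''\<close> those of their intersections with the neighbours of \<open>v\<close>;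
  inserting \<open>v\<close> means adding \<open>''u''\<close>, the power of 2 that belongs to
  \<open>v\<close>.\<close>

definition clique_number_step :: com where
  "clique_number_step =
    Seq (Assign ''v'' (Mem_at ''a'' (Reg ''k'')))
    (Seq (subset_sums_into ''L'' (Reg ''P''))
    (Seq (subset_sums_into ''M'' (Mem_at ''B'' (Reg ''v'')))
    (Seq (Assign ''u'' (Mem_at ''P'' (Reg ''v'')))
      (For ''g'' ''z'' clique_number_update))))"

text \<open>With \<open>''x''\<close> the code of the whole bag, the code of a complement is a
  difference.\<close>

definition init_flag :: "nat \<Rightarrow> com" where
  "init_flag r = Cond (Conj (Less (Mem_at ''G'' (Mem_at ''L'' (Reg ''g''))) (Const r))
      (Less (Mem_at ''G'' (Minus (Reg ''x'') (Mem_at ''L'' (Reg ''g'')))) (Const r)))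
    (Store (Plus (Reg ''O'') (Reg ''g'')) (Const 1)) (Store (Plus (Reg ''O'') (Reg ''g'')) (Const 0))"

definition init_flags :: "nat \<Rightarrow> com" where
  "init_flags r = Seq (subset_sums_into ''L'' (Reg ''P''))
    (Seq (Assign ''x'' (Mem_at ''L'' (Minus (Reg ''z'') (Const 1))))
      (For ''g'' ''z'' (init_flag r)))"

text \<open>One entry of row 9 gives access to three consecutive rows: the address for
  \<open>j\<close> plus one stride is the row of the bag of \<open>j\<close>, plus two strides the
  row of its table.\<close>

definition filter_child :: com where
  "filter_child =
    Seq (Assign ''j'' (Mem_at ''y'' (Reg ''q'')))
    (Seq (subset_sums_into ''M'' (Plus (Mem_at ''B'' (Reg ''j'')) (Reg ''W'')))
    (Seq (Assign ''t'' (Plus (Plus (Mem_at ''B'' (Reg ''j'')) (Reg ''W'')) (Reg ''W'')))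
      (For ''g'' ''z''
        (Cond (Eq (Mem_at ''t'' (Mem_at ''M'' (Reg ''g''))) (Const 0))
          (Store (Plus (Reg ''O'') (Reg ''g'')) (Const 0)) Skip))))"

text \<open>The existential quantifier over the extendable sets is evaluated by marking: several
  sets with the same trace on the bag of the parent mark the same cell.\<close>

definition mark_table :: com where
  "mark_table =
    Seq (subset_sums_into ''M'' (Mem_at ''U'' (Reg ''i'')))
    (Seq (Assign ''t'' (Plus (Plus (Mem_at ''B'' (Reg ''i'')) (Reg ''W'')) (Reg ''W'')))
      (For ''g'' ''z''
        (Cond (Eq (Mem_at ''O'' (Reg ''g'')) (Const 1))
          (Store (Plus (Reg ''t'') (Mem_at ''M'' (Reg ''g''))) (Const 1)) Skip)))"

text \<open>The loop counter \<open>''k''\<close> doubles as the list length read by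
  \<open>subset_sums\<close>: inside the first loop it selects a prefix of the bag, and after the
  loop it equals the length of the whole bag, as the later parts require.\<close>

definition process_node :: "nat \<Rightarrow> com" where
  "process_node r =
    Seq (Assign ''p'' (Mem_at ''S'' (Reg ''i'')))
    (Seq (Assign ''c'' (Mem (Reg ''p'')))
    (Seq (Assign ''y'' (Plus (Reg ''p'') (Const 1)))
    (Seq (Assign ''a'' (Plus (Plus (Reg ''p'') (Reg ''c'')) (Const 2)))
    (Seq (Assign ''K'' (Mem_at ''p'' (Plus (Reg ''c'') (Const 1))))
    (Seq (Store (Reg ''G'') (Const 0))
    (Seq (For ''k'' ''K'' clique_number_step)
    (Seq (init_flags r)
    (Seq (For ''q'' ''c'' filter_child) mark_table))))))))"

lemma assigned_subset_sums_into [simp]: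
  "assigned (subset_sums_into d w) = {''D'', ''R'', ''z'', ''e'', ''w'', ''f''}"
  by (auto simp: subset_sums_into_def)

lemma assigned_clique_number_update [simp]: "assigned clique_number_update = {''t'', ''x''}"
  by (auto simp: clique_number_update_def)

lemma assigned_clique_number_step [simp]: "assigned clique_number_step =
    {''v'', ''u'', ''t'', ''x'', ''g'', ''D'', ''R'', ''z'', ''e'', ''w'', ''f''}"
  by (auto simp: clique_number_step_def)

lemma assigned_init_flag [simp]: "assigned (init_flag r) = {}"
  by (simp add: init_flag_def)

lemma assigned_init_flags [simp]:
  "assigned (init_flags r) = {''x'', ''g'', ''D'', ''R'', ''z'', ''e'', ''w'', ''f''}"
  by (auto simp: init_flags_def)

lemma assigned_filter_child [simp]:
  "assigned filter_child = {''j'', ''t'', ''g'', ''D'', ''R'', ''z'', ''e'', ''w'', ''f''}"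
  by (auto simp: filter_child_def)

lemma assigned_mark_table [simp]:
  "assigned mark_table = {''t'', ''g'', ''D'', ''R'', ''z'', ''e'', ''w'', ''f''}"
  by (auto simp: mark_table_def)

text \<open>The argument \<open>w\<close> is evaluated after \<open>''D''\<close> has been assigned,
  hence the updated state in the hypothesis on it.\<close>

lemma wp_subset_sums_into:
  assumes D: "fst s d = addr W d' 0" and R: "aval w ((fst s)(''D'' := fst s d), snd s) = addr W u 0"
    and rows: "d' \<noteq> 0" "d' \<noteq> u"
    and k: "fst s ''k'' = length xs" and a: "fst s ''a'' + length xs \<le> W"
    and xs: "\<And>e. e < length xs \<Longrightarrow> snd s (fst s ''a'' + e) = xs ! e" "distinct xs"
    and marks: "\<And>x. x \<in> set xs \<Longrightarrow> x < W \<and> snd s (addr W u x) = (if x \<in> Y then 2 ^ x else 0)"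
    and W: "2 ^ length xs \<le> W"
  shows "wp (subset_sums_into d w) (\<lambda>c s'. c \<le> 70 * 2 ^ length xs + acost w + 3 \<and> fst s' ''z'' = 2 ^ length xs \<and>
    (\<forall>i<2 ^ length xs. snd s' (addr W d' i) = set_encode (psets xs ! i \<inter> Y)) \<and>
    same_outside W {d'} (snd s) (snd s')) s"
proof -
  define s1 where "s1 = (((fst s)(''D'' := fst s d))(''R'' := addr W u 0), snd s)"
  have w: "wp subset_sums (\<lambda>c s'. c \<le> 70 * 2 ^ length xs \<and> fst s' ''z'' = 2 ^ length xs \<and>
    (\<forall>i<2 ^ length xs. snd s' (addr W d' i) = (\<Sum>x\<in>psets xs ! i. snd s1 (addr W u x))) \<and>
    same_outside W {d'} (snd s1) (snd s')) s1"
    by (rule wp_subset_sums) (use assms in \<open>auto simp: s1_def\<close>)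
  have sum: "(\<Sum>x\<in>psets xs ! i. snd s1 (addr W u x)) = set_encode (psets xs ! i \<inter> Y)"
    if "i < 2 ^ length xs" for i
    using psets_subset[OF that] marks finite_subset[of _ "set xs"]
    by (intro sum_marks) (auto simp: s1_def)
  have s1: "((fst ((fst s)(''D'' := aval (Reg d) s), snd s))(''R'' := aval w ((fst s)(''D'' := aval (Reg d) s), snd s)),
     snd ((fst s)(''D'' := aval (Reg d) s), snd s)) = s1"
    using R by (simp add: s1_def)
  show ?thesis
    unfolding subset_sums_into_def wp_Seq wp_Assign s1
    by (rule wp_mono[OF w]) (use sum in \<open>auto simp: s1_def\<close>)
qed

section \<open>Memory layout and correctness of the program for one node\<close>

locale encoded_decomposition = rooted_decomposition G T \<rho> X r
  for G T :: "nat pair_pre_digraph" and \<rho> :: nat and X r +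
  fixes n m W :: nat and children_list bag :: "nat \<Rightarrow> nat list" and start :: "nat \<Rightarrow> nat"
  assumes vertices: "pverts G = {..<n}" and nodes: "pverts T = {..<m}"
    and bag: "\<And>i. i < m \<Longrightarrow> distinct (bag i) \<and> set (bag i) = X i"
    and children_list: "\<And>i. i < m \<Longrightarrow> distinct (children_list i) \<and> set (children_list i) = ch i"
    and few_children: "\<And>i. i < m \<Longrightarrow> length (children_list i) \<le> 2"
    and stride: "2 ^ n \<le> W" "m \<le> W"
    and record_end: "\<And>i. i < m \<Longrightarrow> start i + length (children_list i) + length (bag i) + 2 \<le> W"
begin

text \<open>The union has at most one member; it is empty for the root.\<close>

definition parent_bag :: "nat \<Rightarrow> nat set" where
  "parent_bag j = \<Union> {X i | i. j \<in> ch i}"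

lemma parent_bag_child: "j \<in> ch i \<Longrightarrow> parent_bag j = X i"
  unfolding parent_bag_def using T.parent_unique by blast

lemma parent_bag_root: "parent_bag \<rho> = {}"
  unfolding parent_bag_def using T.root_not_child by blast

text \<open>
  Rows written once before the tables are computed: 1 (powers of 2), 2 (beginning of the record of
  each node in the input), 3 (address of the row marking the bag of the parent), 9 (address of row
  \<open>11 + 3 q\<close>), 10 (zero: the bag of the missing parent of the root), \<open>11 + 3 v\<close> (neighbours of
  \<open>v\<close>), \<open>12 + 3 i\<close> (bag of \<open>i\<close>). In the rows that mark a set the entry of a member \<open>v\<close> is \<open>2 ^ v\<close>,
  so that summing entries over \<open>S\<close> yields the code of the intersection with \<open>S\<close>.

  Work rows: 4 (queue), 5 (codes of the subsets of a bag), 6 (codes of their intersections with a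
  marked set), 7 (flags of the subsets), 8 (clique numbers, by code), \<open>13 + 3 i\<close> (result for \<open>i\<close>, by
  code).
\<close>

definition work_rows :: "nat set" where
  "work_rows = {4, 5, 6, 7, 8} \<union> range (\<lambda>i. 13 + 3 * i)"

lemma work_rows_simps [simp]: "0 \<notin> work_rows" "1 \<notin> work_rows" "Suc 0 \<notin> work_rows" "2 \<notin> work_rows"
    "3 \<notin> work_rows" "4 \<in> work_rows" "9 \<notin> work_rows" "10 \<notin> work_rows"
    "11 + 3 * i \<notin> work_rows" "12 + 3 * i \<notin> work_rows" "13 + 3 * i \<in> work_rows"
    "5 \<in> work_rows" "6 \<in> work_rows" "7 \<in> work_rows" "8 \<in> work_rows"
  unfolding work_rows_def by (auto | presburger)+

definition prepared :: "(nat \<Rightarrow> nat) \<Rightarrow> bool" where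
  "prepared M \<longleftrightarrow>
    (\<forall>v<n. M (addr W 1 v) = 2 ^ v) \<and>
    (\<forall>i<m. M (addr W 2 i) = start i) \<and>
    (\<forall>i<m. \<exists>u. u \<notin> work_rows \<and> M (addr W 3 i) = addr W u 0 \<and>
      (\<forall>v<n. M (addr W u v) = (if v \<in> parent_bag i then 2 ^ v else 0))) \<and>
    (\<forall>q<max n m. M (addr W 9 q) = addr W (11 + 3 * q) 0) \<and>
    (\<forall>v<n. \<forall>w<n. M (addr W (11 + 3 * v) w) = (if w \<in> nbrs G v then 2 ^ w else 0)) \<and>
    (\<forall>i<m. \<forall>v<n. M (addr W (12 + 3 * i) v) = (if v \<in> X i then 2 ^ v else 0)) \<and>
    (\<forall>i<m. M (start i) = length (children_list i) \<and>
      (\<forall>e<length (children_list i). M (start i + 1 + e) = children_list i ! e) \<and>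
      M (start i + 1 + length (children_list i)) = length (bag i) \<and>
      (\<forall>e<length (bag i). M (start i + 2 + length (children_list i) + e) = bag i ! e))"

lemma n_less_W: "n < W"
  using stride less_exp[of n] by linarith

text \<open>All cells that \<open>prepared\<close> speaks of lie outside the work rows, including
  the input in row 0 and the row \<open>u\<close> of the parent's bag. Hence the tables can be
  computed without endangering the data they rely on.\<close>

lemma prepared_same:
  assumes "prepared M" "same_outside W R M M'" "R \<subseteq> work_rows"
  shows "prepared M'"
proof -
  have eq: "M' (addr W a b) = M (addr W a b)" if "b < W" "a \<notin> work_rows" for a b
    using same_outsideD[OF assms(2) that(1)] that(2) assms(3) by blast
  have inp: "M' p = M p" if "p < W" for p using eq[OF that, of 0] by (simp add: addr_row_zero)
  have small: "v < W" if "v < max n m" for v using that n_less_W stride by auto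
  have v: "v < W" if "v < n" for v using that n_less_W by simp
  have i: "v < W" if "v < m" for v using that stride by simp
  have rec: "start i + e < W" if "i < m" "e < length (children_list i) + length (bag i) + 2" for i e
    using record_end[OF that(1)] that(2) by linarith
  show ?thesis
    unfolding prepared_def
  proof (intro conjI allI impI)
    fix i assume im: "i < m"
    then obtain u where "u \<notin> work_rows" "M (addr W 3 i) = addr W u 0"
      "\<forall>v<n. M (addr W u v) = (if v \<in> parent_bag i then 2 ^ v else 0)"
      using assms(1) unfolding prepared_def by blast
    then show "\<exists>u. u \<notin> work_rows \<and> M' (addr W 3 i) = addr W u 0 \<and>
      (\<forall>v<n. M' (addr W u v) = (if v \<in> parent_bag i then 2 ^ v else 0))"
      using eq v i[OF im] by (intro exI[of _ u]) auto
  next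
    fix i e assume "i < m" "e < length (children_list i)"
    then show "M' (start i + 1 + e) = children_list i ! e"
      using assms(1) inp[OF rec[of i "1 + e"]] unfolding prepared_def by (simp add: add.assoc)
  next
    fix i e assume "i < m" "e < length (bag i)"
    then show "M' (start i + 2 + length (children_list i) + e) = bag i ! e"
      using assms(1) inp[OF rec[of i "2 + length (children_list i) + e"]]
      unfolding prepared_def by (simp add: add.assoc)
  next
    fix i assume "i < m"
    then show "M' (start i) = length (children_list i)"
      "M' (start i + 1 + length (children_list i)) = length (bag i)"
      using assms(1) inp[OF rec[of i 0]] inp[OF rec[of i "1 + length (children_list i)"]]
      unfolding prepared_def by (simp_all add: add.assoc)
  qed (use assms(1) eq v i small in \<open>auto simp: prepared_def\<close>)
qed

definition bases :: "(string \<Rightarrow> nat) \<Rightarrow> bool" where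
  "bases R \<longleftrightarrow> R ''W'' = W \<and> R ''P'' = addr W 1 0 \<and> R ''S'' = addr W 2 0 \<and> R ''U'' = addr W 3 0 \<and>
    R ''Q'' = addr W 4 0 \<and> R ''L'' = addr W 5 0 \<and> R ''M'' = addr W 6 0 \<and> R ''O'' = addr W 7 0 \<and>
    R ''G'' = addr W 8 0 \<and> R ''B'' = addr W 9 0"

lemma bag_less: "i < m \<Longrightarrow> v \<in> X i \<Longrightarrow> v < n"
  using bag_verts[of i] vertices nodes by auto

lemma bag_subset: "i < m \<Longrightarrow> X i \<subseteq> {..<n}"
  using bag_verts[of i] vertices nodes by auto

lemma bag_length: "i < m \<Longrightarrow> length (bag i) \<le> n"
  using card_mono[OF _ bag_subset[of i]] bag[of i] distinct_card[of "bag i"] by simp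

lemma pow_bag: "i < m \<Longrightarrow> k \<le> length (bag i) \<Longrightarrow> 2 ^ k \<le> W"
  using bag_length[of i] stride(1) power_increasing[of k n "2::nat"] by linarith

definition clique_numbers :: "(nat \<Rightarrow> nat) \<Rightarrow> nat set set \<Rightarrow> bool" where
  "clique_numbers M F \<longleftrightarrow> (\<forall>S\<in>F. M (addr W 8 (set_encode S)) = clique_number G S)"

lemma encode_less: "S \<subseteq> {..<n} \<Longrightarrow> set_encode S < W"
  using set_encode_less stride(1) by (meson less_le_trans)

lemma clique_numbers_update:
  assumes "clique_numbers M F" "F \<subseteq> Pow {..<n}" "S \<subseteq> {..<n}"
  shows "clique_numbers (M(addr W 8 (set_encode S) := clique_number G S)) (insert S F)"
  unfolding clique_numbers_def
proof
  fix R assume R: "R \<in> insert S F"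
  then have "R \<subseteq> {..<n}" using assms by auto
  then show "(M(addr W 8 (set_encode S) := clique_number G S)) (addr W 8 (set_encode R)) = clique_number G R"
    using R assms encode_less set_encode_eq_iff[of R n S] by (auto simp: clique_numbers_def)
qed

text \<open>For a subset \<open>S\<close> of the first \<open>k\<close> vertices, the part of
  \<open>S\<close> adjacent to the new vertex is again such a subset, so both numbers in the
  recursion are already in row 8.\<close>

lemma wp_clique_number_step:
  assumes i: "i < m" and k: "k < length (bag i)" "fst s ''k'' = k"
    and a: "fst s ''a'' = start i + 2 + length (children_list i)"
    and b: "bases (fst s)" and M: "prepared (snd s)"
    and cn: "clique_numbers (snd s) (Pow (set (take k (bag i))))"
  shows "wp clique_number_step (\<lambda>c s'. c \<le> 250 * 2 ^ k \<and>
    clique_numbers (snd s') (Pow (set (take (Suc k) (bag i)))) \<and>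
    same_outside W {5, 6, 8} (snd s) (snd s')) s"
proof -
  let ?xs = "take k (bag i)" and ?v = "bag i ! k"
  have len: "length ?xs = k" using k by simp
  have W: "2 ^ k \<le> W" using pow_bag i k by simp
  have vX: "?v \<in> X i" using bag[OF i] k nth_mem by blast
  then have v: "?v < n" using bag_less i by blast
  have xsX: "set ?xs \<subseteq> X i" using bag[OF i] set_take_subset by metis
  have xsn: "set ?xs \<subseteq> {..<n}" using xsX bag_subset[OF i] by blast
  have aW: "fst s ''a'' + length ?xs \<le> W" using record_end[OF i] k a len by simp
  have dist: "distinct ?xs" using bag[OF i] by simp
  have vxs: "?v \<notin> set ?xs" 
    using k(1) bag[OF i] by (auto simp: in_set_conv_nth nth_eq_iff_index_eq)
  have rd: "snd s (fst s ''a'' + e) = bag i ! e" if "e < length (bag i)" for e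
    using M i that unfolding prepared_def a by blast
  define s1 where "s1 = ((fst s)(''v'' := ?v), snd s)"
  have w1: "wp (subset_sums_into ''L'' (Reg ''P'')) (\<lambda>c s'. c \<le> 70 * 2 ^ length ?xs + acost (Reg ''P'') + 3 \<and>
     fst s' ''z'' = 2 ^ length ?xs \<and>
    (\<forall>i<2 ^ length ?xs. snd s' (addr W 5 i) = set_encode (psets ?xs ! i \<inter> UNIV)) \<and>
    same_outside W {5} (snd s1) (snd s')) s1"
  proof (rule wp_subset_sums_into[where u = 1])
    fix x assume "x \<in> set ?xs"
    then have "x < n" using xsn by auto
    then show "x < W \<and> snd s1 (addr W 1 x) = (if x \<in> UNIV then 2 ^ x else 0)"
      using M n_less_W by (simp add: s1_def prepared_def)
  qed (use b k rd aW dist W in \<open>simp_all add: s1_def bases_def\<close>)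
  have clique_step: "wp (For ''g'' ''z'' clique_number_update) (\<lambda>c s'. c \<le> 60 * 2 ^ k + 6 \<and>
    (clique_numbers (snd s') (Pow (set (take (Suc k) (bag i)))) \<and>
    same_outside W {8} (snd s3) (snd s'))) s3"
    if z: "fst s3 ''z'' = 2 ^ k" and u: "fst s3 ''u'' = 2 ^ ?v" and b: "bases (fst s3)"
      and L: "\<And>g. g < 2 ^ k \<Longrightarrow> snd s3 (addr W 5 g) = set_encode (psets ?xs ! g)"
      and N: "\<And>g. g < 2 ^ k \<Longrightarrow> snd s3 (addr W 6 g) = set_encode (psets ?xs ! g \<inter> nbrs G ?v)"
      and cn: "clique_numbers (snd s3) (Pow (set ?xs))" for s3
  proof -
    \<comment> \<open>The family whose clique numbers are known after \<open>g\<close> rounds: all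
      subsets of the prefix, and the first \<open>g\<close> of them enlarged by the new
      vertex.\<close>
    define F where "F g = Pow (set ?xs) \<union> {insert ?v (psets ?xs ! g') | g'. g' < g}" for g
    have ps: "psets ?xs ! g \<subseteq> set ?xs" if "g < 2 ^ k" for g
      using psets_subset[of g ?xs] that len by simp
    have Fn: "F g \<subseteq> Pow {..<n}" if "g \<le> 2 ^ k" for g
    proof
      fix S assume "S \<in> F g"
      then consider "S \<subseteq> set ?xs" | g' where "g' < g" "S = insert ?v (psets ?xs ! g')"
        unfolding F_def by blast
      then show "S \<in> Pow {..<n}"
      proof cases
        case 2
        then show ?thesis using ps[of g'] that v xsn by auto
      qed (use xsn in auto)
    qed
    have FSuc: "F (Suc g) = insert (insert ?v (psets ?xs ! g)) (F g)" for g
      unfolding F_def by (auto simp: less_Suc_eq)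
    have Fend: "Pow (set (take (Suc k) (bag i))) \<subseteq> F (2 ^ k)"
    proof
      fix S assume S: "S \<in> Pow (set (take (Suc k) (bag i)))"
      show "S \<in> F (2 ^ k)"
      proof (cases "?v \<in> S")
        case True
        have "S - {?v} \<subseteq> set ?xs" using S k(1) by (auto simp: take_Suc_conv_app_nth)
        then obtain g where "g < 2 ^ length ?xs" "psets ?xs ! g = S - {?v}" by (rule psets_surj)
        then show ?thesis using True len unfolding F_def by (auto intro!: exI[of _ g])
      next
        case False
        then show ?thesis using S k(1) unfolding F_def by (auto simp: take_Suc_conv_app_nth)
      qed
    qed
    have "wp (For ''g'' ''z'' clique_number_update) (\<lambda>c s'. c \<le> (\<Sum>g<(2::nat)^k. 50 + 8) + 6 \<and>
      ((clique_numbers (snd s') (F (2 ^ k)) \<and> same_outside W {8} (snd s3) (snd s')) \<and>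
      fst s' ''g'' = 2 ^ k)) s3"
    proof (rule wp_For)
      show "clique_numbers (snd ((fst s3)(''g'' := 0), snd s3)) (F 0) \<and>
        same_outside W {8} (snd s3) (snd ((fst s3)(''g'' := 0), snd s3))"
        using cn by (simp add: F_def)
      show "fst s3 ''z'' = 2 ^ k" by (rule z)
      fix g s4
      assume g: "g < 2 ^ k" and inv: "clique_numbers (snd s4) (F g) \<and> same_outside W {8} (snd s3) (snd s4)"
        and g': "fst s4 ''g'' = g"
        and frame: "\<And>y. y \<notin> insert ''g'' (assigned clique_number_update) \<Longrightarrow> fst s4 y = fst s3 y"
      let ?S = "psets ?xs ! g"
      have gW: "g < W" using g W by simp
      have regs: "fst s4 ''G'' = addr W 8 0" "fst s4 ''L'' = addr W 5 0" "fst s4 ''M'' = addr W 6 0"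
        "fst s4 ''u'' = 2 ^ ?v"
        using frame b u by (simp_all add: bases_def)
      have L4: "snd s4 (addr W 5 g) = set_encode ?S"
        using same_outsideD[OF conjunct2[OF inv] gW] L[OF g] by simp
      have M4: "snd s4 (addr W 6 g) = set_encode (?S \<inter> nbrs G ?v)"
        using same_outsideD[OF conjunct2[OF inv] gW] N[OF g] by simp
      have S: "?S \<subseteq> set ?xs" using ps[OF g] .
      have c1: "snd s4 (addr W 8 (set_encode ?S)) = clique_number G ?S"
        and c2: "snd s4 (addr W 8 (set_encode (?S \<inter> nbrs G ?v))) = clique_number G (?S \<inter> nbrs G ?v)"
        using inv S unfolding clique_numbers_def F_def by blast+
      have fin: "finite ?S" using S finite_subset by blast
      have vS: "?v \<notin> ?S" using S vxs by blast
      have enc: "set_encode (insert ?v ?S) = set_encode ?S + 2 ^ ?v"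
        using fin vS by (simp add: set_encode_insert add.commute)
      have sub: "insert ?v ?S \<subseteq> {..<n}" using S xsn v by blast
      have num: "clique_number G (insert ?v ?S) =
          (if clique_number G ?S < Suc (clique_number G (?S \<inter> nbrs G ?v))
           then Suc (clique_number G (?S \<inter> nbrs G ?v)) else clique_number G ?S)"
        unfolding G.clique_number_insert[OF fin vS] by simp
      let ?M = "(snd s4)(addr W 8 (set_encode (insert ?v ?S)) := clique_number G (insert ?v ?S))"
      have upd: "clique_numbers ?M (F (Suc g))"
        unfolding FSuc using inv Fn g sub by (intro clique_numbers_update) auto
      have same: "same_outside W {8} (snd s3) ?M"
        using inv encode_less[OF sub] by (intro same_outside_update) auto
      show "wp clique_number_update (\<lambda>c s'. c \<le> 50 \<and>
        (clique_numbers (snd ((fst s')(''g'' := Suc g), snd s')) (F (Suc g)) \<and>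
        same_outside W {8} (snd s3) (snd ((fst s')(''g'' := Suc g), snd s')))) s4"
        using upd same
        by (cases "clique_number G ?S < Suc (clique_number G (?S \<inter> nbrs G ?v))")
          (simp_all add: clique_number_update_def regs g' L4 M4 c1 c2 enc num)
    qed simp_all
    then show ?thesis
    proof (rule wp_le_mono)
      show "(\<Sum>g<(2::nat)^k. 50 + 8) + 6 \<le> 60 * (2::nat) ^ k + 6" by simp
    qed (use Fend in \<open>auto simp: clique_numbers_def\<close>)
  qed
  show ?thesis
    unfolding clique_number_step_def
  proof (rule wp_assign_seq_le[where v = ?v and b = "205 * 2 ^ k + 25"], goal_cases)
    case 1
    then show ?case using rd[OF k(1)] k by simp
  next
    case 2
    show ?case
      unfolding s1_def[symmetric]
    proof (rule wp_seq_le[OF w1, where b' = "130 * 2 ^ k + 21"], goal_cases)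
      case (1 s2)
      note post2 = 1(1)
      have b2: "bases (fst s2)" and r2: "fst s2 ''k'' = k" "fst s2 ''a'' = fst s ''a''" "fst s2 ''v'' = ?v"
        using 1(2) b k by (simp_all add: s1_def bases_def)
      have sm2: "same_outside W {5} (snd s) (snd s2)" using 1(1) by (simp add: s1_def)
      have M2: "prepared (snd s2)" by (rule prepared_same[OF M sm2]) simp
      have rd2: "snd s2 (fst s ''a'' + e) = bag i ! e" if "e < length (bag i)" for e
        using M2 i that unfolding prepared_def a by blast
      have w2: "wp (subset_sums_into ''M'' (Mem_at ''B'' (Reg ''v''))) (\<lambda>c s'.
        c \<le> 70 * 2 ^ length ?xs + acost (Mem_at ''B'' (Reg ''v'')) + 3 \<and>
         (fst s' ''z'' = 2 ^ length ?xs \<and>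
        (\<forall>i<2 ^ length ?xs. snd s' (addr W 6 i) = set_encode (psets ?xs ! i \<inter> nbrs G ?v)) \<and>
        same_outside W {6} (snd s2) (snd s'))) s2"
      proof (rule wp_subset_sums_into[where u = "11 + 3 * ?v"])
        fix x assume "x \<in> set ?xs"
        then have "x < n" using xsn by auto
        then show "x < W \<and> snd s2 (addr W (11 + 3 * ?v) x) = (if x \<in> nbrs G ?v then 2 ^ x else 0)"
          using M2 n_less_W v unfolding prepared_def by simp
      next
        have "snd s2 (addr W 9 ?v) = addr W (11 + 3 * ?v) 0"
          using M2 v unfolding prepared_def by simp
        then show "aval (Mem_at ''B'' (Reg ''v'')) ((fst s2)(''D'' := fst s2 ''M''), snd s2)
            = addr W (11 + 3 * ?v) 0"
          using b2 r2 by (simp add: bases_def)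
        show "6 \<noteq> 11 + 3 * ?v" by presburger
      qed (use b2 k r2 rd2 aW dist W in \<open>simp_all add: bases_def\<close>)
      show ?case
      proof (rule wp_seq_le[OF w2, where b' = "60 * 2 ^ k + 13"], goal_cases)
        case (1 s3)
        note post3 = 1(1) and frame3 = 1(2)
        have sm3: "same_outside W {5, 6} (snd s) (snd s3)"
          using same_outside_trans[OF sm2] post3 by blast
        have b3: "bases (fst s3)" and v3: "fst s3 ''v'' = ?v"
          using frame3 b2 r2 by (simp_all add: bases_def)
        have M3: "prepared (snd s3)" by (rule prepared_same[OF M sm3]) simp
        have L3: "snd s3 (addr W 5 g) = set_encode (psets ?xs ! g)" if "g < 2 ^ k" for g
          using post2 same_outsideD[of W "{6}" "snd s2" "snd s3" g 5] post3 that W len by simp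
        have cn3: "clique_numbers (snd s3) (Pow (set ?xs))"
          using cn same_outsideD[OF sm3 encode_less] xsn by (auto simp: clique_numbers_def)
        show ?case
        proof (rule wp_assign_seq_le[where v = "2 ^ ?v" and b = "60 * 2 ^ k + 6"], goal_cases)
          case 1
          show ?case using M3 v b3 v3 by (simp add: bases_def prepared_def)
        next
          case 2
          show ?case
          proof (rule wp_le_mono[OF clique_step], goal_cases)
            case (8 s')
            then have "same_outside W {8} (snd s3) (snd s')" by simp
            with sm3 have "same_outside W {5, 6, 8} (snd s) (snd s')"
              by (rule same_outside_trans) auto
            then show ?case using 8(1) by simp
          next
            case (4 g)
            then show ?case using L3 by simp
          next
            case 6
            then show ?case using cn3 by simp
          qed (use post3 len b3 in \<open>simp_all add: bases_def\<close>)
        qed simp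
      qed (use k in \<open>simp add: min_def\<close>)
    qed (use k in \<open>simp add: min_def\<close>)
  next
    case 3
    have "(1::nat) \<le> 2 ^ k" by simp
    then show ?case unfolding acost.simps by linarith
  qed
qed

end

context encoded_decomposition
begin

text \<open>For a child \<open>j\<close> of \<open>i\<close> and \<open>P = S \<inter> X j\<close>
  this is the condition that the recursion imposes on \<open>S\<close>. For the root the parent bag
  is empty and only \<open>P = {}\<close> can be marked.\<close>

definition marked :: "nat \<Rightarrow> nat set \<Rightarrow> bool" where
  "marked j P \<longleftrightarrow> (\<exists>S\<subseteq>X j. extendable j S \<and> S \<inter> parent_bag j = P)"

text \<open>The table is specified for every set of vertices, whether or not it can be a trace. The
  zeros are those of the untouched memory, so these \<open>2 ^ n\<close> cells need not be
  initialised.\<close>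

definition tabled :: "nat \<Rightarrow> (nat \<Rightarrow> nat) \<Rightarrow> bool" where
  "tabled j M \<longleftrightarrow>
    (\<forall>P\<subseteq>{..<n}. M (addr W (13 + 3 * j) (set_encode P)) = (if marked j P then 1 else 0))"

definition flagged :: "nat \<Rightarrow> (nat set \<Rightarrow> bool) \<Rightarrow> (nat \<Rightarrow> nat) \<Rightarrow> bool" where
  "flagged i \<Phi> M \<longleftrightarrow>
    (\<forall>g<2 ^ length (bag i). M (addr W 7 g) = (if \<Phi> (psets (bag i) ! g) then 1 else 0))"

definition at_node :: "nat \<Rightarrow> state \<Rightarrow> bool" where
  "at_node i s \<longleftrightarrow> i < m \<and> fst s ''i'' = i \<and> fst s ''y'' = start i + 1 \<and>
    fst s ''a'' = start i + 2 + length (children_list i) \<and> fst s ''c'' = length (children_list i) \<and>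
    bases (fst s) \<and> prepared (snd s)"

lemma at_node_step:
  assumes "at_node i s" "same_outside W R (snd s) (snd s')" "R \<subseteq> work_rows"
    "\<And>x. x \<in> {''i'', ''y'', ''a'', ''c'', ''W'', ''P'', ''S'', ''U'', ''Q'', ''L'', ''M'', ''O'', ''G'', ''B''} \<Longrightarrow>
      fst s' x = fst s x"
  shows "at_node i s'"
  using assms(1) prepared_same[OF _ assms(2,3)] assms(4)
  by (simp add: at_node_def bases_def)

lemma psets_bag_subset: "i < m \<Longrightarrow> g < 2 ^ length (bag i) \<Longrightarrow> psets (bag i) ! g \<subseteq> X i"
  using psets_subset[of g "bag i"] bag[of i] by simp

lemma wp_bag_sums:
  assumes at: "at_node i s" and k: "fst s ''k'' = length (bag i)"
    and d: "fst s d = addr W d' 0" "d' \<noteq> 0" "d' \<in> work_rows"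
    and w: "aval w ((fst s)(''D'' := fst s d), snd s) = addr W u 0" "u \<noteq> d'"
    and Y: "\<And>v. v < n \<Longrightarrow> snd s (addr W u v) = (if v \<in> Y then 2 ^ v else 0)"
  shows "wp (subset_sums_into d w) (\<lambda>c s'. c \<le> 70 * 2 ^ length (bag i) + acost w + 3 \<and>
    (fst s' ''z'' = 2 ^ length (bag i) \<and>
    (\<forall>g<2 ^ length (bag i). snd s' (addr W d' g) = set_encode (psets (bag i) ! g \<inter> Y)) \<and>
    same_outside W {d'} (snd s) (snd s'))) s"
proof (rule wp_subset_sums_into[where u = u])
  have i: "i < m" using at by (simp add: at_node_def)
  show "fst s ''a'' + length (bag i) \<le> W"
    using at record_end[OF i] by (simp add: at_node_def)
  show "snd s (fst s ''a'' + e) = bag i ! e" if "e < length (bag i)" for e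
    using at that i unfolding at_node_def prepared_def by simp
  show "distinct (bag i)" using bag[OF i] by simp
  show "2 ^ length (bag i) \<le> W" using pow_bag[OF i] by simp
  fix x assume "x \<in> set (bag i)"
  then have "x < n" using bag[OF i] bag_less[OF i] by simp
  then show "x < W \<and> snd s (addr W u x) = (if x \<in> Y then 2 ^ x else 0)"
    using Y n_less_W by simp
qed (use assms in auto)

lemma flagged_update:
  assumes "g < 2 ^ length (bag i)" "2 ^ length (bag i) \<le> W"
    and "\<And>g'. g' < 2 ^ length (bag i) \<Longrightarrow> M (addr W 7 g') = (if g' < g then A g' else B g')"
    and "g' < 2 ^ length (bag i)"
  shows "(M(addr W 7 g := A g)) (addr W 7 g') = (if g' < Suc g then A g' else B g')"
  using assms by (auto simp: less_Suc_eq)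

lemma wp_init_flags:
  assumes at: "at_node i s" and k: "fst s ''k'' = length (bag i)"
    and cn: "clique_numbers (snd s) (Pow (X i))"
  shows "wp (init_flags r) (\<lambda>c s'. c \<le> 150 * 2 ^ length (bag i) \<and>
    (flagged i (\<lambda>S. clique_free G r S \<and> clique_free G r (X i - S)) (snd s') \<and>
      fst s' ''z'' = 2 ^ length (bag i) \<and>
     same_outside W {5, 7} (snd s) (snd s'))) s"
proof -
  let ?n = "2 ^ length (bag i) :: nat"
  have i: "i < m" and b: "bases (fst s)" and M: "prepared (snd s)" using at by (auto simp: at_node_def)
  have W: "?n \<le> W" using pow_bag[OF i] by simp
  have Xn: "X i \<subseteq> {..<n}" by (rule bag_subset[OF i])
  have sums: "wp (subset_sums_into ''L'' (Reg ''P'')) (\<lambda>c s'. c \<le> 70 * ?n + acost (Reg ''P'') + 3 \<and>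
    (fst s' ''z'' = ?n \<and>
    (\<forall>g<?n. snd s' (addr W 5 g) = set_encode (psets (bag i) ! g \<inter> UNIV)) \<and>
    same_outside W {5} (snd s) (snd s'))) s"
    using at k b M
    by (intro wp_bag_sums[where u = 1]) (simp_all add: bases_def prepared_def)
  show ?thesis
    unfolding init_flags_def
  proof (rule wp_seq_le[OF sums, where b' = "60 * ?n + 15"], goal_cases)
    case (1 s1)
    note post = 1(1) and frame = 1(2)
    have b1: "bases (fst s1)" using b frame by (simp add: bases_def)
    have cn1: "clique_numbers (snd s1) (Pow (X i))"
      unfolding clique_numbers_def
    proof
      fix S assume "S \<in> Pow (X i)"
      then show "snd s1 (addr W 8 (set_encode S)) = clique_number G S"
        using cn same_outsideD[of W "{5}" "snd s" "snd s1" "set_encode S" 8] post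
          encode_less[of S] Xn by (auto simp: clique_numbers_def)
    qed
    \<comment> \<open>The largest index has all digits 1, so its subset is the bag itself and the
      last entry of row 5 is the code of the bag.\<close>
    have "?n - 1 < ?n" by simp
    then have last: "snd s1 (addr W 5 (?n - 1)) = set_encode (X i)"
      using post psets_last[of "bag i"] bag[OF i] by auto
    show ?case
    proof (rule wp_assign_seq_le[where v = "set_encode (X i)" and b = "58 * ?n + 6"], goal_cases)
      case 1
      show ?case using b1 post last by (simp add: bases_def)
    next
      case 2
      let ?s2 = "((fst s1)(''x'' := set_encode (X i)), snd s1)"
      define good where
        "good S \<longleftrightarrow> clique_free G r S \<and> clique_free G r (X i - S)" for S
      define I where "I h s' \<longleftrightarrow> (\<forall>g'<?n. snd s' (addr W 7 g') =
          (if g' < h then if good (psets (bag i) ! g') then 1 else 0 else snd s1 (addr W 7 g'))) \<and>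
        same_outside W {7} (snd s1) (snd s')" for h and s' :: state
      have "wp (For ''g'' ''z'' (init_flag r)) (\<lambda>c s'. c \<le> (\<Sum>g<?n. 40 + 8) + 6 \<and>
          (I ?n s' \<and> fst s' ''g'' = ?n)) ?s2"
      proof (rule wp_For)
        fix g s3
        assume g: "g < ?n" and I: "I g s3"
          and g': "fst s3 ''g'' = g"
          and frame3: "\<And>y. y \<notin> insert ''g'' (assigned (init_flag r)) \<Longrightarrow> fst s3 y = fst ?s2 y"
        have inv: "(\<forall>g'<?n. snd s3 (addr W 7 g') =
            (if g' < g then if good (psets (bag i) ! g') then 1 else 0 else snd s1 (addr W 7 g'))) \<and>
          same_outside W {7} (snd s1) (snd s3)" using I unfolding I_def .
        let ?S = "psets (bag i) ! g"
        have regs: "fst s3 ''L'' = addr W 5 0" "fst s3 ''G'' = addr W 8 0" "fst s3 ''O'' = addr W 7 0"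
          "fst s3 ''x'' = set_encode (X i)"
          using frame3 b1 by (simp_all add: bases_def)
        have gW: "g < W" using g W by simp
        have S: "?S \<subseteq> X i" using psets_bag_subset[OF i g] .
        have fin: "finite (X i)" using Xn finite_subset by blast
        have L: "snd s3 (addr W 5 g) = set_encode ?S"
          using same_outsideD[OF conjunct2[OF inv] gW, of 5] post g by simp
        have cn3: "snd s3 (addr W 8 (set_encode R)) = clique_number G R" if "R \<subseteq> X i" for R
          using same_outsideD[OF conjunct2[OF inv] encode_less, of R 8] cn1 that Xn
          by (auto simp: clique_numbers_def)
        \<comment> \<open>The subset is contained in the bag, so subtracting its powers of 2 leaves
          exactly those of the complement; the subtraction is not truncated.\<close>
        have diff: "set_encode (X i) - set_encode ?S = set_encode (X i - ?S)"
          unfolding set_encode_def using S fin finite_subset by (metis sum_diff_nat)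
        have good: "clique_number G ?S < r \<and> clique_number G (X i - ?S) < r \<longleftrightarrow> good ?S"
          using clique_free_iff[of ?S G r] clique_free_iff[of "X i - ?S" G r] S fin finite_subset[OF S fin]
          by (simp add: good_def)
        have bv: "bval (Conj (Less (Mem_at ''G'' (Mem_at ''L'' (Reg ''g''))) (Const r))
            (Less (Mem_at ''G'' (Minus (Reg ''x'') (Mem_at ''L'' (Reg ''g'')))) (Const r))) s3 = good ?S"
          using regs g' L cn3[of ?S] cn3[of "X i - ?S"] S diff good by simp
        have upd: "(\<forall>g'<?n. ((snd s3)(addr W 7 g := (if good ?S then 1 else 0))) (addr W 7 g') =
            (if g' < Suc g then if good (psets (bag i) ! g') then 1 else 0 else snd s1 (addr W 7 g')))"
          by (intro allI impI flagged_update[OF g W, where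
                A = "\<lambda>g. if good (psets (bag i) ! g) then 1 else 0" and
                B = "\<lambda>g'. snd s1 (addr W 7 g')"]) (use inv in blast)+
        have same: "same_outside W {7} (snd s1) ((snd s3)(addr W 7 g := (if good ?S then 1 else 0)))"
          using inv gW by (intro same_outside_update) auto
        show "wp (init_flag r) (\<lambda>c s'. c \<le> 40 \<and> I (Suc g) ((fst s')(''g'' := Suc g), snd s')) s3"
          unfolding init_flag_def wp_Cond bv I_def
          using upd same regs g' by (cases "good ?S") simp_all
      qed (use post in \<open>simp_all add: I_def\<close>)
      then show ?case
      proof (rule wp_le_mono, goal_cases)
        case (2 s')
        have "same_outside W {5, 7} (snd s) (snd s')"
          using same_outside_trans[of W "{5}" "snd s" "snd s1" "{7}" "snd s'" "{5, 7}"] post 2 by (auto simp: I_def)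
        then show ?case using 2 post by (simp add: flagged_def good_def I_def)
      qed (simp add: algebra_simps)
    qed simp
  next
    case 2
    have "(1::nat) \<le> ?n" by simp
    then show ?case unfolding acost.simps by linarith
  qed
qed

lemma wp_filter_child:
  assumes at: "at_node i s" and k: "fst s ''k'' = length (bag i)"
    and q: "fst s ''q'' < length (children_list i)"
    and j: "j = children_list i ! fst s ''q''"
    and tab: "tabled j (snd s)" and fl: "flagged i \<Phi> (snd s)"
  shows "wp filter_child (\<lambda>c s'. c \<le> 160 * 2 ^ length (bag i) \<and>
    (flagged i (\<lambda>S. \<Phi> S \<and> marked j (S \<inter> X j)) (snd s') \<and>
     same_outside W {6, 7} (snd s) (snd s'))) s"
proof -
  let ?n = "2 ^ length (bag i) :: nat"
  have i: "i < m" and b: "bases (fst s)" and M: "prepared (snd s)" using at by (auto simp: at_node_def)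
  have W: "?n \<le> W" using pow_bag[OF i] by simp
  have Xn: "X i \<subseteq> {..<n}" by (rule bag_subset[OF i])
  have "j \<in> ch i" using children_list[OF i] j q nth_mem by metis
  then have jm: "j < m" using T.child_verts nodes by auto
  have rj: "snd s (fst s ''y'' + fst s ''q'') = j"
    using at q i unfolding at_node_def prepared_def j by simp
  have rb: "snd s (addr W 9 j) = addr W (11 + 3 * j) 0"
    using M jm unfolding prepared_def by simp
  have jW: "j < W" using jm stride by simp
  let ?s1 = "((fst s)(''j'' := j), snd s)"
  have at1: "at_node i ?s1" using at by (rule at_node_step[where R = "{}"]) auto
  have sums: "wp (subset_sums_into ''M'' (Plus (Mem_at ''B'' (Reg ''j'')) (Reg ''W''))) (\<lambda>c s'.
    c \<le> 70 * ?n + acost (Plus (Mem_at ''B'' (Reg ''j'')) (Reg ''W'')) + 3 \<and>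
    (fst s' ''z'' = ?n \<and>
    (\<forall>g<?n. snd s' (addr W 6 g) = set_encode (psets (bag i) ! g \<inter> X j)) \<and>
    same_outside W {6} (snd ?s1) (snd s'))) ?s1"
  proof (rule wp_bag_sums[OF at1, where u = "12 + 3 * j"])
    show "aval (Plus (Mem_at ''B'' (Reg ''j'')) (Reg ''W'')) ((fst ?s1)(''D'' := fst ?s1 ''M''), snd ?s1)
        = addr W (12 + 3 * j) 0"
      using b rb by (simp add: bases_def addr_def algebra_simps)
    show "12 + 3 * j \<noteq> 6" by presburger
    show "snd ?s1 (addr W (12 + 3 * j) v) = (if v \<in> X j then 2 ^ v else 0)" if "v < n" for v
      using M jm that unfolding prepared_def by simp
  qed (use k b in \<open>simp_all add: bases_def\<close>)
  show ?thesis
    unfolding filter_child_def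
  proof (rule wp_assign_seq_le[where v = j and b = "153 * ?n"], goal_cases)
    case 1
    show ?case using rj by simp
  next
    case 2
    show ?case
    proof (rule wp_seq_le[OF sums, where b' = "58 * ?n + 15"], goal_cases)
      case (1 s2)
      note post = 1(1) and frame = 1(2)
      have sm2: "same_outside W {6} (snd s) (snd s2)" using post by simp
      have b2: "bases (fst s2)" "fst s2 ''j'' = j" using b frame by (simp_all add: bases_def)
      have tab2: "tabled j (snd s2)"
        unfolding tabled_def
      proof (intro allI impI)
        fix P assume P: "P \<subseteq> {..<n}"
        have "13 + 3 * j \<notin> {6}" by simp
        then show "snd s2 (addr W (13 + 3 * j) (set_encode P)) = (if marked j P then 1 else 0)"
          using same_outsideD[OF sm2 encode_less[OF P]] tab P by (simp add: tabled_def)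
      qed
      have fl2: "snd s2 (addr W 7 g) = (if \<Phi> (psets (bag i) ! g) then 1 else 0)" if "g < ?n" for g
        using same_outsideD[OF sm2, of g 7] that W fl by (simp add: flagged_def)
      show ?case
      proof (rule wp_assign_seq_le[where v = "addr W (13 + 3 * j) 0" and b = "58 * ?n + 6"], goal_cases)
        case 1
        have "snd s2 (addr W 9 j) = addr W (11 + 3 * j) 0"
          using same_outsideD[OF sm2 jW] rb by simp
        then show ?case using b2 by (simp add: bases_def addr_def algebra_simps)
      next
        case 2
        let ?s3 = "((fst s2)(''t'' := addr W (13 + 3 * j) 0), snd s2)"
        let ?body = "Cond (Eq (Mem_at ''t'' (Mem_at ''M'' (Reg ''g''))) (Const 0))
          (Store (Plus (Reg ''O'') (Reg ''g'')) (Const 0)) Skip"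
        define good where "good S \<longleftrightarrow> \<Phi> S \<and> marked j (S \<inter> X j)" for S
        define I where "I h s' \<longleftrightarrow> (\<forall>g'<?n. snd s' (addr W 7 g') =
          (if g' < h then if good (psets (bag i) ! g') then 1 else 0 else snd s2 (addr W 7 g'))) \<and>
        same_outside W {7} (snd s2) (snd s')" for h and s' :: state
        have "wp (For ''g'' ''z'' ?body) (\<lambda>c s'. c \<le> (\<Sum>g<?n. 40 + 8) + 6 \<and>
          (I ?n s' \<and> fst s' ''g'' = ?n)) ?s3"
        proof (rule wp_For)
          fix g s4
          assume g: "g < ?n" and I: "I g s4"
          and g': "fst s4 ''g'' = g"
            and frame4: "\<And>y. y \<notin> insert ''g'' (assigned ?body) \<Longrightarrow> fst s4 y = fst ?s3 y"
          have inv: "(\<forall>g'<?n. snd s4 (addr W 7 g') =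
            (if g' < g then if good (psets (bag i) ! g') then 1 else 0 else snd s2 (addr W 7 g'))) \<and>
          same_outside W {7} (snd s2) (snd s4)" using I unfolding I_def .
        let ?S = "psets (bag i) ! g"
          have regs: "fst s4 ''M'' = addr W 6 0" "fst s4 ''O'' = addr W 7 0"
            "fst s4 ''t'' = addr W (13 + 3 * j) 0"
            using frame4 b2 by (simp_all add: bases_def)
          have gW: "g < W" using g W by simp
          have S: "?S \<inter> X j \<subseteq> {..<n}" using psets_bag_subset[OF i g] Xn by blast
          have P: "snd s4 (addr W 6 g) = set_encode (?S \<inter> X j)"
            using same_outsideD[OF conjunct2[OF inv] gW, of 6] post g by simp
          have "13 + 3 * j \<notin> {7}" by simp
          then have t: "snd s4 (addr W (13 + 3 * j) (set_encode (?S \<inter> X j))) =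
              (if marked j (?S \<inter> X j) then 1 else 0)"
            using same_outsideD[OF conjunct2[OF inv] encode_less[OF S], of "13 + 3 * j"] tab2 S
            by (simp add: tabled_def)
          have bv: "bval (Eq (Mem_at ''t'' (Mem_at ''M'' (Reg ''g''))) (Const 0)) s4
              \<longleftrightarrow> \<not> marked j (?S \<inter> X j)"
            using regs g' P t by simp
          have old: "snd s4 (addr W 7 g) = (if \<Phi> ?S then 1 else 0)"
            using inv g fl2[OF g] by simp
          have upd: "(\<forall>g'<?n. ((snd s4)(addr W 7 g := (if good ?S then 1 else 0))) (addr W 7 g') =
            (if g' < Suc g then if good (psets (bag i) ! g') then 1 else 0 else snd s2 (addr W 7 g')))"
          by (intro allI impI flagged_update[OF g W, where
                A = "\<lambda>g. if good (psets (bag i) ! g) then 1 else 0" and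
                B = "\<lambda>g'. snd s2 (addr W 7 g')"]) (use inv in blast)+
          have same: "same_outside W {7} (snd s2) ((snd s4)(addr W 7 g := (if good ?S then 1 else 0)))"
            using inv gW by (intro same_outside_update) auto
          show "wp ?body (\<lambda>c s'. c \<le> 40 \<and> I (Suc g) ((fst s')(''g'' := Suc g), snd s')) s4"
          proof (cases "marked j (?S \<inter> X j)")
            case True
            \<comment> \<open>Nothing is stored in this case; the update is the identity because the
              flag already has the required value.\<close>
            then have "(snd s4)(addr W 7 g := (if good ?S then 1 else 0)) = snd s4"
              using old by (auto simp: good_def)
            then show ?thesis unfolding wp_Cond bv I_def using True upd same by simp
          next
            case False
            then have "\<not> good ?S" by (simp add: good_def)
            then show ?thesis unfolding wp_Cond bv I_def using False upd same regs g' by simp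
          qed
        qed (use post fl2 in \<open>simp_all add: I_def\<close>)
        then show ?case
        proof (rule wp_le_mono, goal_cases)
          case (2 s')
          have "same_outside W {6, 7} (snd s) (snd s')"
            using same_outside_trans[OF sm2, of "{7}" "snd s'" "{6, 7}"] 2 by (auto simp: I_def)
          then show ?case using 2 by (simp add: flagged_def good_def I_def)
        qed (simp add: algebra_simps)
      qed simp
    next
      case 2
      have "(1::nat) \<le> ?n" by simp
      then show ?case unfolding acost.simps by linarith
    qed
  next
    case 3
    have "(1::nat) \<le> ?n" by simp
    then show ?case unfolding acost.simps by linarith
  qed
qed

text \<open>The hypothesis \<open>blank\<close> supplies the zeros of the table, since the program
  only ever writes ones into it.\<close>

lemma wp_mark_table:
  assumes at: "at_node i s" and k: "fst s ''k'' = length (bag i)"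
    and fl: "flagged i (extendable i) (snd s)"
    and blank: "\<And>b. b < W \<Longrightarrow> snd s (addr W (13 + 3 * i) b) = 0"
  shows "wp mark_table (\<lambda>c s'. c \<le> 160 * 2 ^ length (bag i) \<and>
    (tabled i (snd s') \<and> same_outside W {6, 13 + 3 * i} (snd s) (snd s'))) s"
proof -
  let ?n = "2 ^ length (bag i) :: nat" and ?r = "13 + 3 * i"
  have i: "i < m" and b: "bases (fst s)" and M: "prepared (snd s)" and ri: "fst s ''i'' = i"
    using at by (auto simp: at_node_def)
  have W: "?n \<le> W" using pow_bag[OF i] by simp
  have Xn: "X i \<subseteq> {..<n}" by (rule bag_subset[OF i])
  have rb: "snd s (addr W 9 i) = addr W (11 + 3 * i) 0"
    using M i unfolding prepared_def by simp
  have iW: "i < W" using i stride by simp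
  obtain u where u: "u \<notin> work_rows" "snd s (addr W 3 i) = addr W u 0"
      "\<And>v. v < n \<Longrightarrow> snd s (addr W u v) = (if v \<in> parent_bag i then 2 ^ v else 0)"
    using M i unfolding prepared_def by blast
  have sums: "wp (subset_sums_into ''M'' (Mem_at ''U'' (Reg ''i''))) (\<lambda>c s'.
    c \<le> 70 * ?n + acost (Mem_at ''U'' (Reg ''i'')) + 3 \<and>
    (fst s' ''z'' = ?n \<and>
    (\<forall>g<?n. snd s' (addr W 6 g) = set_encode (psets (bag i) ! g \<inter> parent_bag i)) \<and>
    same_outside W {6} (snd s) (snd s'))) s"
  proof (rule wp_bag_sums[OF at k, where u = u])
    show "u \<noteq> 6" using u(1) by auto
  qed (use b u ri in \<open>simp_all add: bases_def\<close>)
  show ?thesis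
    unfolding mark_table_def
  proof (rule wp_seq_le[OF sums, where b' = "58 * ?n + 15"], goal_cases)
    case (1 s2)
    note post = 1(1) and frame = 1(2)
    have sm2: "same_outside W {6} (snd s) (snd s2)" using post by simp
    have b2: "bases (fst s2)" "fst s2 ''i'' = i" using b ri frame by (simp_all add: bases_def)
    have fl2: "snd s2 (addr W 7 g) = (if extendable i (psets (bag i) ! g) then 1 else 0)" if "g < ?n" for g
      using same_outsideD[OF sm2, of g 7] that W fl by (simp add: flagged_def)
    have row: "?r \<notin> {6}" by simp
    have blank2: "snd s2 (addr W ?r v) = 0" if "v < W" for v
      using same_outsideD[OF sm2 that row] blank[OF that] by simp
    show ?case
    proof (rule wp_assign_seq_le[where v = "addr W ?r 0" and b = "58 * ?n + 6"], goal_cases)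
      case 1
      have "snd s2 (addr W 9 i) = addr W (11 + 3 * i) 0"
        using same_outsideD[OF sm2 iW] rb by simp
      then show ?case using b2 by (simp add: bases_def addr_def algebra_simps)
    next
      case 2
      let ?s3 = "((fst s2)(''t'' := addr W ?r 0), snd s2)"
      let ?body = "Cond (Eq (Mem_at ''O'' (Reg ''g'')) (Const 1))
          (Store (Plus (Reg ''t'') (Mem_at ''M'' (Reg ''g''))) (Const 1)) Skip"
      \<comment> \<open>The traces reached by the first \<open>h\<close> subsets of the bag. Marks
        are never cleared, so subsets with the same trace do not interfere.\<close>
      define hit where "hit h P \<longleftrightarrow>
        (\<exists>g<h. extendable i (psets (bag i) ! g) \<and> psets (bag i) ! g \<inter> parent_bag i = P)" for h P
      have hit_Suc: "hit (Suc g) P \<longleftrightarrow> hit g P \<or>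
          extendable i (psets (bag i) ! g) \<and> psets (bag i) ! g \<inter> parent_bag i = P" for g P
        unfolding hit_def by (auto simp: less_Suc_eq)
      define I where "I h s' \<longleftrightarrow>
          (\<forall>P\<subseteq>{..<n}. snd s' (addr W ?r (set_encode P)) = (if hit h P then 1 else 0)) \<and>
          same_outside W {?r} (snd s2) (snd s')" for h and s' :: state
      have "wp (For ''g'' ''z'' ?body) (\<lambda>c s'. c \<le> (\<Sum>g<?n. 40 + 8) + 6 \<and>
          (I ?n s' \<and> fst s' ''g'' = ?n)) ?s3"
      proof (rule wp_For)
        show "I 0 ((fst ?s3)(''g'' := 0), snd ?s3)"
          using blank2 encode_less by (auto simp: I_def hit_def)
        fix g s4
        assume g: "g < ?n" and I: "I g s4" and g': "fst s4 ''g'' = g"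
          and frame4: "\<And>y. y \<notin> insert ''g'' (assigned ?body) \<Longrightarrow> fst s4 y = fst ?s3 y"
        let ?S = "psets (bag i) ! g"
        have regs: "fst s4 ''M'' = addr W 6 0" "fst s4 ''O'' = addr W 7 0" "fst s4 ''t'' = addr W ?r 0"
          using frame4 b2 by (simp_all add: bases_def)
        have gW: "g < W" using g W by simp
        have sm4: "same_outside W {?r} (snd s2) (snd s4)" using I by (simp add: I_def)
        have P: "?S \<inter> parent_bag i \<subseteq> {..<n}" using psets_bag_subset[OF i g] Xn by blast
        have "6 \<noteq> ?r" by presburger
        then have M4: "snd s4 (addr W 6 g) = set_encode (?S \<inter> parent_bag i)"
          using same_outsideD[OF sm4 gW, of 6] post g by simp
        have "7 \<noteq> ?r" by presburger
        then have "snd s4 (addr W 7 g) = (if extendable i ?S then 1 else 0)"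
          using same_outsideD[OF sm4 gW, of 7] fl2[OF g] by simp
        then have bv: "bval (Eq (Mem_at ''O'' (Reg ''g'')) (Const 1)) s4 \<longleftrightarrow> extendable i ?S"
          using regs g' by simp
        show "wp ?body (\<lambda>c s'. c \<le> 40 \<and> I (Suc g) ((fst s')(''g'' := Suc g), snd s')) s4"
        proof (cases "extendable i ?S")
          case True
          let ?M = "(snd s4)(addr W ?r (set_encode (?S \<inter> parent_bag i)) := 1)"
          have "same_outside W {?r} (snd s2) ?M"
            using sm4 encode_less[OF P] by (intro same_outside_update) auto
          moreover have "?M (addr W ?r (set_encode Q)) = (if hit (Suc g) Q then 1 else 0)"
            if "Q \<subseteq> {..<n}" for Q
            using that True I encode_less[OF P] encode_less[OF that] set_encode_eq_iff[OF that P]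
            by (auto simp: hit_Suc I_def)
          ultimately have "I (Suc g) ((fst s4)(''g'' := Suc g), ?M)" by (simp add: I_def)
          then show ?thesis unfolding wp_Cond bv using True regs g' M4 by simp
        next
          case False
          then have "I (Suc g) ((fst s4)(''g'' := Suc g), snd s4)"
            using I by (simp add: I_def hit_Suc)
          then show ?thesis unfolding wp_Cond bv using False by simp
        qed
      qed (use post in simp_all)
      then show ?case
      proof (rule wp_le_mono, goal_cases)
        case (2 s')
        have "same_outside W {6, ?r} (snd s) (snd s')"
          using same_outside_trans[OF sm2, of "{?r}" "snd s'" "{6, ?r}"] 2 by (auto simp: I_def)
        moreover have "hit ?n P \<longleftrightarrow> marked i P" for P
        proof
          assume "marked i P"
          then obtain S where S: "S \<subseteq> X i" "extendable i S" "S \<inter> parent_bag i = P"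
            unfolding marked_def by blast
          then obtain g where "g < ?n" "psets (bag i) ! g = S"
            using psets_surj[of S "bag i"] bag[OF i] by blast
          then show "hit ?n P" using S unfolding hit_def by blast
        qed (use psets_bag_subset[OF i] in \<open>auto simp: hit_def marked_def\<close>)
        ultimately show ?case using 2 by (simp add: I_def tabled_def)
      qed (simp add: algebra_simps)
    qed simp
  next
    case 2
    have "(1::nat) \<le> ?n" by simp
    then show ?case unfolding acost.simps by linarith
  qed
qed

lemma tabled_same:
  assumes "tabled j M" "same_outside W R M M'" "13 + 3 * j \<notin> R"
  shows "tabled j M'"
  using assms(1) same_outsideD[OF assms(2) encode_less assms(3)] by (simp add: tabled_def)

lemma clique_numbers_loop:
  assumes at: "at_node i s" and K: "fst s ''K'' = length (bag i)"
    and zero: "snd s (addr W 8 0) = 0"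
  shows "wp (For ''k'' ''K'' clique_number_step) (\<lambda>c s'. c \<le> 270 * 2 ^ length (bag i) \<and>
    (clique_numbers (snd s') (Pow (X i)) \<and> fst s' ''k'' = length (bag i) \<and>
     same_outside W {5, 6, 8} (snd s) (snd s'))) s"
proof -
  let ?l = "length (bag i)"
  have i: "i < m" using at by (simp add: at_node_def)
  define I where "I k s' \<longleftrightarrow> clique_numbers (snd s') (Pow (set (take k (bag i)))) \<and>
     same_outside W {5, 6, 8} (snd s) (snd s')" for k and s' :: state
  have "wp (For ''k'' ''K'' clique_number_step) (\<lambda>c s'. c \<le> (\<Sum>k<?l. 250 * 2 ^ k + 8) + 6 \<and>
    (I ?l s' \<and> fst s' ''k'' = ?l)) s"
  proof (rule wp_For)
    show "I 0 ((fst s)(''k'' := 0), snd s)"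
      using zero clique_number_empty by (simp add: I_def clique_numbers_def)
    fix k s1
    assume k: "k < ?l" and I: "I k s1" and k': "fst s1 ''k'' = k"
      and frame: "\<And>y. y \<notin> insert ''k'' (assigned clique_number_step) \<Longrightarrow> fst s1 y = fst s y"
    have sm: "same_outside W {5, 6, 8} (snd s) (snd s1)" using I by (simp add: I_def)
    have at1: "at_node i s1" by (rule at_node_step[OF at sm]) (simp, rule frame, auto)
    have "wp clique_number_step (\<lambda>c s'. c \<le> 250 * 2 ^ k \<and>
       (clique_numbers (snd s') (Pow (set (take (Suc k) (bag i)))) \<and>
        same_outside W {5, 6, 8} (snd s1) (snd s'))) s1"
      by (rule wp_clique_number_step) (use at1 k k' I in \<open>auto simp: at_node_def I_def\<close>)
    then show "wp clique_number_step
        (\<lambda>c s'. c \<le> 250 * 2 ^ k \<and> I (Suc k) ((fst s')(''k'' := Suc k), snd s')) s1"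
    proof (rule wp_le_mono)
      fix s' :: state assume post: "clique_numbers (snd s') (Pow (set (take (Suc k) (bag i)))) \<and>
        same_outside W {5, 6, 8} (snd s1) (snd s')"
      then show "I (Suc k) ((fst s')(''k'' := Suc k), snd s')"
        using same_outside_trans[OF sm, of "{5, 6, 8}" "snd s'" "{5, 6, 8}"] by (simp add: I_def)
    qed simp
  qed (use K in simp_all)
  then show ?thesis
  proof (rule wp_le_mono)
    \<comment> \<open>A geometric series again: all prefixes of the bag together cost as much, up to
      a constant, as the last one.\<close>
    have "(\<Sum>k<?l. 250 * 2 ^ k + 8) = 250 * (\<Sum>k<?l. 2 ^ k) + 8 * ?l"
      by (simp add: sum.distrib sum_distrib_left)
    then show "(\<Sum>k<?l. 250 * 2 ^ k + 8) + 6 \<le> 270 * (2 :: nat) ^ ?l"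
      using sum_pow2_less[of ?l] less_exp[of ?l] by linarith
  qed (use bag[OF i] in \<open>simp add: I_def\<close>)
qed

lemma filter_children_loop:
  assumes at: "at_node i s" and k: "fst s ''k'' = length (bag i)"
    and tab: "\<And>j. j \<in> ch i \<Longrightarrow> tabled j (snd s)" and fl: "flagged i \<Phi> (snd s)"
  shows "wp (For ''q'' ''c'' filter_child) (\<lambda>c s'. c \<le> 350 * 2 ^ length (bag i) \<and>
    (flagged i (\<lambda>S. \<Phi> S \<and> (\<forall>j\<in>ch i. marked j (S \<inter> X j))) (snd s') \<and>
     same_outside W {6, 7} (snd s) (snd s'))) s"
proof -
  let ?l = "length (children_list i)"
  have i: "i < m" and c: "fst s ''c'' = ?l" using at by (simp_all add: at_node_def)
  define \<Psi> where "\<Psi> q S \<longleftrightarrow> \<Phi> S \<and> (\<forall>j\<in>set (take q (children_list i)). marked j (S \<inter> X j))" for q S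
  define I where "I q s' \<longleftrightarrow> flagged i (\<Psi> q) (snd s') \<and>
     same_outside W {6, 7} (snd s) (snd s')" for q and s' :: state
  have "wp (For ''q'' ''c'' filter_child) (\<lambda>c s'. c \<le> (\<Sum>q<?l. 160 * 2 ^ length (bag i) + 8) + 6 \<and>
    (I ?l s' \<and> fst s' ''q'' = ?l)) s"
  proof (rule wp_For)
    show "I 0 ((fst s)(''q'' := 0), snd s)"
      using fl by (simp add: I_def \<Psi>_def flagged_def)
    show "fst s ''c'' = ?l" by (rule c)
    fix q s1
    assume q: "q < ?l" and I: "I q s1" and q': "fst s1 ''q'' = q"
      and frame: "\<And>y. y \<notin> insert ''q'' (assigned filter_child) \<Longrightarrow> fst s1 y = fst s y"
    let ?j = "children_list i ! q"
    have sm: "same_outside W {6, 7} (snd s) (snd s1)" using I by (simp add: I_def)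
    have at1: "at_node i s1" by (rule at_node_step[OF at sm]) (simp, rule frame, auto)
    have "?j \<in> ch i" using children_list[OF i] q nth_mem by metis
    moreover have "13 + 3 * ?j \<notin> {6, 7}" by simp
    ultimately have tab1: "tabled ?j (snd s1)" using tab tabled_same[OF _ sm] by blast
    have "wp filter_child (\<lambda>c s'. c \<le> 160 * 2 ^ length (bag i) \<and>
      (flagged i (\<lambda>S. \<Psi> q S \<and> marked ?j (S \<inter> X ?j)) (snd s') \<and>
       same_outside W {6, 7} (snd s1) (snd s'))) s1"
      by (rule wp_filter_child[OF at1]) (use frame k q q' tab1 I in \<open>auto simp: I_def\<close>)
    then show "wp filter_child (\<lambda>c s'. c \<le> 160 * 2 ^ length (bag i) \<and>
        I (Suc q) ((fst s')(''q'' := Suc q), snd s')) s1"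
    proof (rule wp_le_mono)
      fix s' :: state assume post: "flagged i (\<lambda>S. \<Psi> q S \<and> marked ?j (S \<inter> X ?j)) (snd s') \<and>
        same_outside W {6, 7} (snd s1) (snd s')"
      have "\<Psi> q S \<and> marked ?j (S \<inter> X ?j) \<longleftrightarrow> \<Psi> (Suc q) S" for S
        using q unfolding \<Psi>_def by (auto simp: take_Suc_conv_app_nth)
      then show "I (Suc q) ((fst s')(''q'' := Suc q), snd s')"
        using post same_outside_trans[OF sm, of "{6, 7}" "snd s'" "{6, 7}"] by (simp add: I_def)
    qed simp
  qed simp_all
  moreover have all: "\<Psi> ?l = (\<lambda>S. \<Phi> S \<and> (\<forall>j\<in>ch i. marked j (S \<inter> X j)))"
    using children_list[OF i] by (simp add: \<Psi>_def fun_eq_iff)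
  ultimately show ?thesis
  proof (elim wp_le_mono)
    have one: "(1::nat) \<le> 2 ^ length (bag i)" by simp
    \<comment> \<open>Each child costs one scan of the subsets of the bag; at most two children keep
      the total at a constant multiple of the number of subsets.\<close>
    have "(\<Sum>q<?l. 160 * 2 ^ length (bag i) + 8) \<le> 2 * (160 * 2 ^ length (bag i) + 8 :: nat)"
      using mult_le_mono1[OF few_children[OF i]] by (simp only: sum_constant card_lessThan of_nat_id)
    then show "(\<Sum>q<?l. 160 * 2 ^ length (bag i) + 8) + 6 \<le> 350 * (2::nat) ^ length (bag i)"
    proof (rule order_trans[OF add_right_mono])
      have "2 * (160 * x + 8) + 6 \<le> 350 * x" if "1 \<le> x" for x :: nat using that by presburger
      then show "2 * (160 * 2 ^ length (bag i) + 8) + 6 \<le> 350 * (2::nat) ^ length (bag i)"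
        using one by blast
    qed
  qed (simp add: I_def all)
qed

text \<open>The recursion in the form the program evaluates it: for a child of \<open>i\<close> the
  parent bag is \<open>X i\<close>, so its existential quantifier is a table entry.\<close>

lemma extendable_iff_marked:
  assumes "i < m" "S \<subseteq> X i"
  shows "extendable i S \<longleftrightarrow> clique_free G r S \<and> clique_free G r (X i - S) \<and>
    (\<forall>j\<in>ch i. marked j (S \<inter> X j))"
proof -
  have "(\<exists>S'\<subseteq>X j. extendable j S' \<and> S' \<inter> X i = S \<inter> X j) \<longleftrightarrow> marked j (S \<inter> X j)"
    if "j \<in> ch i" for j
    unfolding marked_def parent_bag_child[OF that] by blast
  then show ?thesis using extendable_iff[of i S] assms nodes by simp
qed

lemma wp_process_node:
  assumes i: "i < m" "fst s ''i'' = i" and b: "bases (fst s)" and M: "prepared (snd s)"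
    and tab: "\<And>j. j \<in> ch i \<Longrightarrow> tabled j (snd s)"
    and blank: "\<And>b. b < W \<Longrightarrow> snd s (addr W (13 + 3 * i) b) = 0"
  shows "wp (process_node r) (\<lambda>c s'. c \<le> 1000 * 2 ^ length (bag i) \<and>
    (tabled i (snd s') \<and> same_outside W {5, 6, 7, 8, 13 + 3 * i} (snd s) (snd s'))) s"
proof -
  let ?n = "2 ^ length (bag i) :: nat"
  have rec: "snd s (addr W 2 i) = start i" "snd s (start i) = length (children_list i)"
    "snd s (start i + 1 + length (children_list i)) = length (bag i)"
    using M i unfolding prepared_def by blast+
  define s1 where "s1 = ((fst s)(''p'' := start i, ''c'' := length (children_list i),
    ''y'' := start i + 1, ''a'' := start i + 2 + length (children_list i),
    ''K'' := length (bag i)), (snd s)(addr W 8 0 := 0))"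
  have "0 < W" using n_less_W by simp
  then have sm1: "same_outside W {8} (snd s) (snd s1)"
    by (auto simp: s1_def intro: same_outside_update)
  have at1: "at_node i s1"
    using i b prepared_same[OF M sm1] by (simp add: at_node_def bases_def s1_def)
  have K1: "fst s1 ''K'' = length (bag i)" and z1: "snd s1 (addr W 8 0) = 0"
    by (simp_all add: s1_def)
  have main: "wp (Seq (For ''k'' ''K'' clique_number_step)
    (Seq (init_flags r) (Seq (For ''q'' ''c'' filter_child) mark_table)))
    (\<lambda>c s'. c \<le> 930 * ?n \<and>
      (tabled i (snd s') \<and> same_outside W {5, 6, 7, 8, 13 + 3 * i} (snd s) (snd s'))) s1"
  proof (rule wp_seq_le[OF clique_numbers_loop[OF at1 K1 z1], where b' = "660 * ?n"], goal_cases)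
    case (1 s2)
    note post2 = 1(1) and frame2 = 1(2)
    have sm12: "same_outside W {5, 6, 8} (snd s1) (snd s2)" using post2 by simp
    have sm2: "same_outside W {5, 6, 8} (snd s) (snd s2)"
      by (rule same_outside_trans[OF sm1 sm12]) auto
    have at2: "at_node i s2" by (rule at_node_step[OF at1 sm12]) (simp, rule frame2, auto)
    show ?case
    proof (rule wp_seq_le[OF wp_init_flags[OF at2], where b' = "510 * ?n"], goal_cases)
      case (3 s3)
      note post3 = 3(1) and frame3 = 3(2)
      have sm23: "same_outside W {5, 7} (snd s2) (snd s3)" using post3 by simp
      have sm3: "same_outside W {5, 6, 7, 8} (snd s) (snd s3)"
        by (rule same_outside_trans[OF sm2 sm23]) auto
      have at3: "at_node i s3" by (rule at_node_step[OF at2 sm23]) (simp, rule frame3, auto)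
      have k3: "fst s3 ''k'' = length (bag i)" using frame3 post2 by simp
      have tab3: "tabled j (snd s3)" if "j \<in> ch i" for j
        by (rule tabled_same[OF tab[OF that] sm3]) simp
      show ?case
      proof (rule wp_seq_le[OF filter_children_loop[OF at3 k3 tab3 conjunct1[OF post3]],
            where b' = "160 * ?n"], goal_cases)
        case (2 s4)
        note post4 = 2(1) and frame4 = 2(2)
        have sm34: "same_outside W {6, 7} (snd s3) (snd s4)" using post4 by simp
        have sm4: "same_outside W {5, 6, 7, 8} (snd s) (snd s4)"
          by (rule same_outside_trans[OF sm3 sm34]) auto
        have at4: "at_node i s4" by (rule at_node_step[OF at3 sm34]) (simp, rule frame4, auto)
        have k4: "fst s4 ''k'' = length (bag i)" using frame4 k3 by simp
        \<comment> \<open>After initialisation and filtering, the flags satisfy the right-hand side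
          of the recursion, hence decide extendability at \<open>i\<close>.\<close>
        have fl4: "flagged i (extendable i) (snd s4)"
          using post4 extendable_iff_marked[OF i(1) psets_bag_subset[OF i(1)]]
          unfolding flagged_def by simp
        have row: "13 + 3 * i \<notin> {5, 6, 7, 8}" by simp
        have blank4: "snd s4 (addr W (13 + 3 * i) v) = 0" if "v < W" for v
          using same_outsideD[OF sm4 that row] blank[OF that] by simp
        show ?case
        proof (rule wp_le_mono[OF wp_mark_table[OF at4 k4 fl4 blank4]], goal_cases)
          case (3 s5)
          then have "same_outside W {5, 6, 7, 8, 13 + 3 * i} (snd s) (snd s5)"
            using same_outside_trans[OF sm4, of "{6, 13 + 3 * i}" "snd s5" "{5, 6, 7, 8, 13 + 3 * i}"]
            by blast
          then show ?case using 3 by simp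
        qed simp_all
      qed simp_all
    qed (use post2 in simp_all)
  qed simp
  have one: "1 \<le> ?n" by simp
  show ?thesis
    unfolding process_node_def
    apply (rule wp_assign_seq_le[where v = "start i" and b = "990 * ?n"])
    subgoal using rec i b by (simp add: bases_def)
    apply (rule wp_assign_seq_le[where v = "length (children_list i)" and b = "980 * ?n"])
    subgoal using rec by simp
    apply (rule wp_assign_seq_le[where v = "start i + 1" and b = "970 * ?n"])
    subgoal by simp
    apply (rule wp_assign_seq_le[where v = "start i + 2 + length (children_list i)" and b = "960 * ?n"])
    subgoal by simp
    apply (rule wp_assign_seq_le[where v = "length (bag i)" and b = "950 * ?n"])
    subgoal using rec by (simp add: add.assoc add.commute)
    apply (rule wp_store_seq_le[where p = "addr W 8 0" and v = 0 and b = "930 * ?n"])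
    subgoal using b by (simp add: bases_def)
    subgoal by simp
    subgoal using main unfolding s1_def by simp
    by (insert one, unfold acost.simps, linarith+)
qed

end

section \<open>Traversal of the tree\<close>

definition queue_step :: com where
  "queue_step =
    Seq (Assign ''i'' (Mem_at ''Q'' (Reg ''h'')))
    (Seq (Assign ''p'' (Mem_at ''S'' (Reg ''i'')))
    (Seq (Assign ''c'' (Mem (Reg ''p'')))
    (Seq (For ''e'' ''c'' (Store (Plus (Reg ''Q'') (Plus (Reg ''z'') (Reg ''e'')))
        (Mem_at ''p'' (Plus (Const 1) (Reg ''e'')))))
      (Assign ''z'' (Plus (Reg ''z'') (Reg ''c''))))))"

definition fill_queue :: com where
  "fill_queue =
    Seq (Store (Reg ''Q'') (Reg ''o''))
    (Seq (Assign ''z'' (Const 1)) (For ''h'' ''m'' queue_step))"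

definition process_queue :: "nat \<Rightarrow> com" where
  "process_queue r = For ''h'' ''m''
    (Seq (Assign ''i'' (Mem_at ''Q'' (Minus (Minus (Reg ''m'') (Const 1)) (Reg ''h'')))) (process_node r))"

definition answer :: com where
  "answer = Seq (Assign ''t'' (Plus (Plus (Mem_at ''B'' (Reg ''o'')) (Reg ''W'')) (Reg ''W'')))
    (Cond (Conj (Less (Const 1) (Reg ''n'')) (Eq (Mem (Reg ''t'')) (Const 1)))
      (Assign ''out'' (Const 1)) (Assign ''out'' (Const 0)))"

lemma assigned_process_node [simp]: "assigned (process_node r) =
    {''p'', ''c'', ''y'', ''a'', ''K'', ''k'', ''q'', ''v'', ''u'', ''t'', ''x'', ''g'', ''j'',
     ''D'', ''R'', ''z'', ''e'', ''w'', ''f''}"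
  by (auto simp: process_node_def)

lemma assigned_queue_step [simp]: "assigned queue_step = {''i'', ''p'', ''c'', ''e'', ''z''}"
  by (auto simp: queue_step_def)

lemma assigned_fill_queue [simp]: "assigned fill_queue = {''h'', ''i'', ''p'', ''c'', ''e'', ''z''}"
  by (auto simp: fill_queue_def)

lemma assigned_process_queue [simp]:
  "assigned (process_queue r) = {''h'', ''i''} \<union> assigned (process_node r)"
  by (auto simp: process_queue_def)

context encoded_decomposition
begin

text \<open>Breadth-first order; read backwards it lists children before their parents.\<close>

primrec queue :: "nat \<Rightarrow> nat list" where
  "queue 0 = [\<rho>]"
| "queue (Suc h) = queue h @ children_list (queue h ! h)"

text \<open>After \<open>h\<close> rounds the queue consists of the root and the children of its
  first \<open>h\<close> entries. Parents are unique and the root is no child, so nothing is entered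
  twice; the last clause says that the queue does not run empty early.\<close>

lemma queue_invariant:
  "h \<le> m \<Longrightarrow> distinct (queue h) \<and> set (queue h) = insert \<rho> (\<Union>h'<h. ch (queue h ! h')) \<and>
    set (queue h) \<subseteq> {..<m} \<and> h \<le> length (queue h) \<and> (h < m \<longrightarrow> h < length (queue h))"
proof (induction h)
  case 0
  then show ?case using root_node nodes by simp
next
  case (Suc h)
  then have h: "h < m" and IH: "distinct (queue h)"
    "set (queue h) = insert \<rho> (\<Union>h'<h. ch (queue h ! h'))" "set (queue h) \<subseteq> {..<m}"
    "h < length (queue h)" by auto
  let ?x = "queue h ! h"
  have x: "?x \<in> set (queue h)" using IH(4) by simp
  then have xm: "?x < m" using IH(3) by auto
  have cl: "distinct (children_list ?x)" "set (children_list ?x) = ch ?x"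
    using children_list[OF xm] by auto
  have nth: "queue (Suc h) ! h' = queue h ! h'" if "h' \<le> h" for h'
    using that IH(4) by (simp add: nth_append)
  \<comment> \<open>A child entered before would have been entered by an earlier entry, which would
    be a second parent.\<close>
  have disj: "y \<notin> set (queue h)" if y: "y \<in> ch ?x" for y
  proof
    assume "y \<in> set (queue h)"
    moreover have "y \<noteq> \<rho>" using y T.root_not_child by blast
    ultimately obtain h' where h': "h' < h" "y \<in> ch (queue h ! h')" using IH(2) by blast
    then have "queue h ! h' = ?x" using T.parent_unique y by blast
    then show False using h'(1) IH(1,4) by (simp add: nth_eq_iff_index_eq)
  qed
  have dist: "distinct (queue (Suc h))" using IH(1) cl disj by auto
  have "set (queue (Suc h)) = insert \<rho> (\<Union>h'<Suc h. ch (queue h ! h'))"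
    using IH(2) cl by (auto simp: less_Suc_eq)
  also have "(\<Union>h'<Suc h. ch (queue h ! h')) = (\<Union>h'<Suc h. ch (queue (Suc h) ! h'))"
    using nth by (intro SUP_cong) auto
  finally have st: "set (queue (Suc h)) = insert \<rho> (\<Union>h'<Suc h. ch (queue (Suc h) ! h'))" .
  have sub: "set (queue (Suc h)) \<subseteq> {..<m}"
    using IH(3) cl T.child_verts nodes by auto
  have len: "Suc h \<le> length (queue (Suc h))" using IH(4) by simp
  moreover have "Suc h < length (queue (Suc h))" if "Suc h < m"
  proof (rule ccontr)
    assume "\<not> Suc h < length (queue (Suc h))"
    then have l: "length (queue (Suc h)) = Suc h" using len by linarith
    \<comment> \<open>If the queue were exhausted, its entries would contain the root and be closed
      under children, hence be all \<open>m\<close> nodes, which is too many for its length.\<close>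
    have "y \<in> set (queue (Suc h))" if "y \<in> T.desc \<rho>" for y
      using that
    proof induction
      case self
      then show ?case using st by blast
    next
      case (step x y)
      then obtain h' where "h' < Suc h" "x = queue (Suc h) ! h'" using l by (metis in_set_conv_nth)
      then show ?case using step.hyps(2) st by blast
    qed
    then have "{..<m} \<subseteq> set (queue (Suc h))" using T.desc_root nodes by blast
    then have "m \<le> card (set (queue (Suc h)))" using card_mono[of "set (queue (Suc h))" "{..<m}"] by simp
    then have "m \<le> Suc h" using l card_length[of "queue (Suc h)"] by linarith
    then show False using \<open>Suc h < m\<close> by simp
  qed
  ultimately show ?case using dist st sub by blast
qed

lemma length_queue_le: "h \<le> m \<Longrightarrow> length (queue h) \<le> m"
  using queue_invariant[of h] card_mono[of "{..<m}" "set (queue h)"] distinct_card[of "queue h"]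
  by (metis card_lessThan finite_lessThan)

lemma queue_final: "length (queue m) = m" "distinct (queue m)" "set (queue m) = {..<m}"
proof -
  show l: "length (queue m) = m" and d: "distinct (queue m)"
    using queue_invariant[of m] length_queue_le[of m] by auto
  show "set (queue m) = {..<m}"
  proof (rule card_subset_eq)
    show "set (queue m) \<subseteq> {..<m}" using queue_invariant[of m] by blast
  qed (use l distinct_card[OF d] in simp_all)
qed

lemma queue_prefix: "h \<le> h' \<Longrightarrow> \<exists>ys. queue h' = queue h @ ys"
  by (induction rule: dec_induct) auto

text \<open>The children of entry \<open>h\<close> are appended behind \<open>queue h\<close>, whose
  length already exceeds \<open>h\<close>.\<close>

lemma queue_child:
  assumes "h < m" "j \<in> ch (queue m ! h)"
  obtains h' where "h < h'" "h' < m" "queue m ! h' = j"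
proof -
  have h: "h < length (queue h)" using queue_invariant[of h] assms(1) by simp
  obtain ys where ys: "queue m = queue (Suc h) @ ys" using queue_prefix assms(1) by (metis Suc_leI)
  then have eq: "queue m ! h = queue h ! h" using h by (simp add: nth_append)
  have "queue h ! h < m" using queue_invariant[of h] assms(1) nth_mem[OF h] by auto
  then have "j \<in> set (children_list (queue h ! h))" using children_list assms(2) eq by simp
  then obtain e where e: "e < length (children_list (queue h ! h))" "children_list (queue h ! h) ! e = j"
    by (metis in_set_conv_nth)
  then have "queue m ! (length (queue h) + e) = j" using ys by (simp add: nth_append)
  moreover have "length (queue h) + e < m"
    using e(1) length_queue_le[of "Suc h"] assms(1) by simp
  ultimately show ?thesis using that[of "length (queue h) + e"] h by simp
qed

text \<open>The time is constant because a node has at most two children to append.\<close>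

lemma wp_queue_step:
  assumes h: "h < m" "fst s ''h'' = h" and z: "fst s ''z'' = length (queue h)"
    and b: "bases (fst s)" and M: "prepared (snd s)"
    and q: "\<And>e. e < length (queue h) \<Longrightarrow> snd s (addr W 4 e) = queue h ! e"
  shows "wp queue_step (\<lambda>c s'. c \<le> 80 \<and> (fst s' ''z'' = length (queue (Suc h)) \<and>
    (\<forall>e<length (queue (Suc h)). snd s' (addr W 4 e) = queue (Suc h) ! e) \<and>
    same_outside W {4} (snd s) (snd s'))) s"
proof -
  let ?x = "queue h ! h" let ?cl = "children_list ?x"
  have hl: "h < length (queue h)" and xm: "?x < m"
    using queue_invariant[of h] h nth_mem[of h "queue h"] by auto
  have lq: "length (queue h) + length ?cl \<le> W"
    using length_queue_le[of "Suc h"] h stride by simp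
  have rec: "snd s (addr W 2 ?x) = start ?x" "snd s (start ?x) = length ?cl"
    "\<And>e. e < length ?cl \<Longrightarrow> snd s (start ?x + 1 + e) = ?cl ! e"
    using M xm unfolding prepared_def by blast+
  let ?s1 = "((fst s)(''i'' := ?x, ''p'' := start ?x, ''c'' := length ?cl), snd s)"
  let ?body = "Store (Plus (Reg ''Q'') (Plus (Reg ''z'') (Reg ''e'')))
        (Mem_at ''p'' (Plus (Const 1) (Reg ''e'')))"
  define I where "I e s' \<longleftrightarrow>
    (\<forall>e'<length (queue h) + e. snd s' (addr W 4 e') = (queue h @ ?cl) ! e') \<and>
    same_outside W {4} (snd s) (snd s')" for e and s' :: state
  have loop: "wp (For ''e'' ''c'' ?body) (\<lambda>c s'. c \<le> (\<Sum>e<length ?cl. 12 + 8) + 6 \<and>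
    (I (length ?cl) s' \<and> fst s' ''e'' = length ?cl)) ?s1"
  proof (rule wp_For)
    show "I 0 ((fst ?s1)(''e'' := 0), snd ?s1)"
      using q by (simp add: I_def nth_append)
    fix e s2
    assume e: "e < length ?cl" and I: "I e s2" and e': "fst s2 ''e'' = e"
      and frame: "\<And>y. y \<notin> insert ''e'' (assigned ?body) \<Longrightarrow> fst s2 y = fst ?s1 y"
    have regs: "fst s2 ''Q'' = addr W 4 0" "fst s2 ''z'' = length (queue h)" "fst s2 ''p'' = start ?x"
      using frame b z by (simp_all add: bases_def)
    have sm: "same_outside W {4} (snd s) (snd s2)" using I by (simp add: I_def)
    have "start ?x + 1 + e < W" using record_end[OF xm] e by linarith
    then have "snd s2 (start ?x + 1 + e) = ?cl ! e"
      using same_outside_input[OF sm] rec(3)[OF e] by simp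
    then have v: "aval (Mem_at ''p'' (Plus (Const 1) (Reg ''e''))) s2 = ?cl ! e"
      using regs e' by (simp add: add.assoc)
    have zW: "length (queue h) + e < W" using e lq by simp
    have "I (Suc e) ((fst s2)(''e'' := Suc e), (snd s2)(addr W 4 (length (queue h) + e) := ?cl ! e))"
      using I e zW same_outside_update[OF sm, of 4 "length (queue h) + e" "?cl ! e"]
      by (auto simp: I_def less_Suc_eq nth_append)
    then show "wp ?body (\<lambda>c s'. c \<le> 12 \<and> I (Suc e) ((fst s')(''e'' := Suc e), snd s')) s2"
      unfolding wp_Store v using regs e' by simp
  qed simp_all
  show ?thesis
    unfolding queue_step_def
    apply (rule wp_assign_seq_le[where v = ?x and b = 75])
    subgoal using q[OF hl] h b by (simp add: bases_def)
    apply (rule wp_assign_seq_le[where v = "start ?x" and b = 70])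
    subgoal using rec b by (simp add: bases_def)
    apply (rule wp_assign_seq_le[where v = "length ?cl" and b = 65])
    subgoal using rec by simp
    apply (simp only: fst_conv snd_conv)
    apply (rule wp_seq_le[OF loop, where b' = 4])
    using few_children[OF xm] z by (auto simp: I_def)
qed

lemma wp_fill_queue:
  assumes regs: "fst s ''m'' = m" "fst s ''o'' = \<rho>" and b: "bases (fst s)" and M: "prepared (snd s)"
  shows "wp fill_queue (\<lambda>c s'. c \<le> 88 * m + 20 \<and>
    ((\<forall>h<m. snd s' (addr W 4 h) = queue m ! h) \<and> same_outside W {4} (snd s) (snd s'))) s"
proof -
  let ?s1 = "((fst s)(''z'' := 1), (snd s)(addr W 4 0 := \<rho>))"
  have "0 < W" using n_less_W by simp
  then have sm1: "same_outside W {4} (snd s) (snd ?s1)" by (auto intro: same_outside_update)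
  define I where "I h s' \<longleftrightarrow> fst s' ''z'' = length (queue h) \<and>
    (\<forall>e<length (queue h). snd s' (addr W 4 e) = queue h ! e) \<and>
    same_outside W {4} (snd s) (snd s')" for h and s' :: state
  have loop: "wp (For ''h'' ''m'' queue_step) (\<lambda>c s'. c \<le> (\<Sum>h<m. 80 + 8) + 6 \<and>
    (I m s' \<and> fst s' ''h'' = m)) ?s1"
  proof (rule wp_For)
    show "I 0 ((fst ?s1)(''h'' := 0), snd ?s1)" using sm1 by (simp add: I_def)
    fix h s2
    assume h: "h < m" and I: "I h s2" and h': "fst s2 ''h'' = h"
      and frame: "\<And>y. y \<notin> insert ''h'' (assigned queue_step) \<Longrightarrow> fst s2 y = fst ?s1 y"
    have sm: "same_outside W {4} (snd s) (snd s2)" using I by (simp add: I_def)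
    have b2: "bases (fst s2)" using frame b by (simp add: bases_def)
    have M2: "prepared (snd s2)" by (rule prepared_same[OF M sm]) simp
    show "wp queue_step (\<lambda>c s'. c \<le> 80 \<and> I (Suc h) ((fst s')(''h'' := Suc h), snd s')) s2"
    proof (rule wp_le_mono[OF wp_queue_step[OF h h' _ b2 M2]], goal_cases)
      case (4 s')
      then have "same_outside W {4} (snd s) (snd s')" using same_outside_trans[OF sm] by blast
      then show ?case using 4 by (simp add: I_def)
    qed (use I in \<open>simp_all add: I_def\<close>)
  qed (use regs in simp_all)
  show ?thesis
    unfolding fill_queue_def
    apply (rule wp_store_seq_le[where p = "addr W 4 0" and v = \<rho> and b = "88 * m + 10"])
    subgoal using b by (simp add: bases_def)
    subgoal using regs by simp
    apply (rule wp_assign_seq_le[where v = 1 and b = "88 * m + 8"])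
    subgoal by simp
    apply (simp only: fst_conv snd_conv)
    apply (rule wp_le_mono[OF loop])
    using queue_final(1) by (simp_all add: I_def)
qed

lemma wp_process_queue:
  assumes regs: "fst s ''m'' = m" and b: "bases (fst s)" and M: "prepared (snd s)"
    and q: "\<And>h. h < m \<Longrightarrow> snd s (addr W 4 h) = queue m ! h"
    and blank: "\<And>i v. i < m \<Longrightarrow> v < W \<Longrightarrow> snd s (addr W (13 + 3 * i) v) = 0"
    and width: "\<And>i. i < m \<Longrightarrow> length (bag i) \<le> k"
  shows "wp (process_queue r) (\<lambda>c s'. c \<le> 1020 * 2 ^ k * m + 6 \<and>
    (tabled \<rho> (snd s') \<and> prepared (snd s'))) s"
proof -
  let ?q = "\<lambda>h. queue m ! (m - 1 - h)"
  let ?body = "Seq (Assign ''i'' (Mem_at ''Q'' (Minus (Minus (Reg ''m'') (Const 1)) (Reg ''h'')))) (process_node r)"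
  \<comment> \<open>The rows changed while the first \<open>h\<close> nodes were processed. The
    queue in row 4 is not among them, and neither is the table row of a node still to come, which is
    therefore still zero.\<close>
  define R where "R h = {5, 6, 7, 8} \<union> {13 + 3 * ?q h' | h'. h' < h}" for h
  have R: "R h \<subseteq> work_rows" for h unfolding R_def by auto
  have qm: "?q h < m" if "h < m" for h
    using queue_final nth_mem[of "m - 1 - h" "queue m"] that by auto
  have q_inj: "h = h'" if "h < m" "h' < m" "?q h = ?q h'" for h h'
    using that queue_final(1,2) nth_eq_iff_index_eq[of "queue m" "m - 1 - h" "m - 1 - h'"] by auto
  define I where "I h s' \<longleftrightarrow> (\<forall>h'<h. tabled (?q h') (snd s')) \<and>
    same_outside W (R h) (snd s) (snd s')" for h and s' :: state
  have loop: "wp (For ''h'' ''m'' ?body) (\<lambda>c s'. c \<le> (\<Sum>h<m. (1000 * 2 ^ k + 10) + 8) + 6 \<and>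
    (I m s' \<and> fst s' ''h'' = m)) s"
  proof (rule wp_For)
    show "I 0 ((fst s)(''h'' := 0), snd s)" by (simp add: I_def)
    fix h s1
    assume h: "h < m" and I: "I h s1" and h': "fst s1 ''h'' = h"
      and frame: "\<And>y. y \<notin> insert ''h'' (assigned ?body) \<Longrightarrow> fst s1 y = fst s y"
    let ?i = "?q h"
    have i: "?i < m" by (rule qm[OF h])
    have sm: "same_outside W (R h) (snd s) (snd s1)" using I by (simp add: I_def)
    have b1: "bases (fst s1)" "fst s1 ''m'' = m" using frame b regs by (simp_all add: bases_def)
    have M1: "prepared (snd s1)" by (rule prepared_same[OF M sm R])
    let ?s2 = "((fst s1)(''i'' := ?i), snd s1)"
    have hW: "m - 1 - h < W" using h stride by simp
    have "4 \<notin> R h" unfolding R_def by auto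
    then have "snd s1 (addr W 4 (m - 1 - h)) = ?i"
      using same_outsideD[OF sm hW] q[of "m - 1 - h"] h by simp
    then have v: "aval (Mem_at ''Q'' (Minus (Minus (Reg ''m'') (Const 1)) (Reg ''h''))) s1 = ?i"
      using b1 h' by (simp add: bases_def)
    \<comment> \<open>A child stands behind its parent in the queue, so reading backwards has
      already produced its table.\<close>
    have tab: "tabled j (snd s1)" if j: "j \<in> ch ?i" for j
    proof -
      obtain h2 where h2: "m - 1 - h < h2" "h2 < m" "queue m ! h2 = j"
        using queue_child[of "m - 1 - h" j] j h by auto
      then have "?q (m - 1 - h2) = j" "m - 1 - h2 < h" using h by auto
      then show ?thesis using I by (auto simp: I_def)
    qed
    have fresh: "13 + 3 * ?i \<notin> R h"
    proof
      assume "13 + 3 * ?i \<in> R h"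
      then obtain h2 where "h2 < h" "?q h2 = ?i" unfolding R_def by auto
      then show False using q_inj[of h2 h] h by simp
    qed
    have blank1: "snd s1 (addr W (13 + 3 * ?i) v) = 0" if "v < W" for v
      using same_outsideD[OF sm that fresh] blank[OF i that] by simp
    have node: "wp (process_node r) (\<lambda>c s'. c \<le> 1000 * 2 ^ length (bag ?i) \<and>
       (tabled ?i (snd s') \<and> same_outside W {5, 6, 7, 8, 13 + 3 * ?i} (snd ?s2) (snd s'))) ?s2"
      by (rule wp_process_node) (use i b1 M1 tab blank1 in \<open>simp_all add: bases_def\<close>)
    have pow: "2 ^ length (bag ?i) \<le> (2 :: nat) ^ k" using width[OF i] by (simp add: power_increasing)
    show "wp ?body (\<lambda>c s'. c \<le> 1000 * 2 ^ k + 10 \<and> I (Suc h) ((fst s')(''h'' := Suc h), snd s')) s1"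
    proof (rule wp_assign_seq_le[OF v, where b = "1000 * 2 ^ k"])
      show "wp (process_node r) (\<lambda>c s'. c \<le> 1000 * 2 ^ k \<and> I (Suc h) ((fst s')(''h'' := Suc h), snd s')) ?s2"
      proof (rule wp_le_mono[OF node], goal_cases)
        case (2 s')
        have sm2: "same_outside W {5, 6, 7, 8, 13 + 3 * ?i} (snd s1) (snd s')" using 2 by simp
        have "R (Suc h) = R h \<union> {5, 6, 7, 8, 13 + 3 * ?i}" unfolding R_def by (auto simp: less_Suc_eq)
        then have sm': "same_outside W (R (Suc h)) (snd s) (snd s')"
          using same_outside_trans[OF sm sm2] by blast
        have "tabled (?q h') (snd s')" if "h' < h" for h'
        proof (rule tabled_same[OF _ sm2])
          show "tabled (?q h') (snd s1)" using I that by (simp add: I_def)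
          show "13 + 3 * ?q h' \<notin> {5, 6, 7, 8, 13 + 3 * ?i}"
            using q_inj[of h' h] that h by auto
        qed
        then show ?case using 2 sm' by (auto simp: I_def less_Suc_eq)
      qed (use pow in simp)
    qed simp
  qed (use regs in simp_all)
  have "0 < m" using root_node nodes by auto
  show ?thesis
    unfolding process_queue_def
  proof (rule wp_le_mono[OF loop], goal_cases)
    case 1
    have "(1::nat) \<le> 2 ^ k" by simp
    then have "(1000 * 2 ^ k + 10) + 8 \<le> 1020 * (2::nat) ^ k" by linarith
    then have "m * ((1000 * 2 ^ k + 10) + 8) \<le> m * (1020 * (2::nat) ^ k)" by (rule mult_le_mono2)
    then show ?case by (simp add: mult.commute)
  next
    case (2 s')
    have "queue m ! 0 = \<rho>" using queue_prefix[of 0 m] by auto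
    then have "tabled \<rho> (snd s')" using 2 \<open>0 < m\<close> unfolding I_def by (metis diff_self_eq_0 diff_less less_one)
    moreover have "prepared (snd s')" using 2 prepared_same[OF M _ R] unfolding I_def by blast
    ultimately show ?case by blast
  qed
qed

text \<open>The root has an empty parent bag, so all sets extendable at the root share the trace
  with code 0, and one cell holds the result. The comparison with 1 accounts for the non-emptiness
  of both parts.\<close>

lemma wp_answer:
  assumes regs: "fst s ''n'' = n" "fst s ''o'' = \<rho>" and b: "bases (fst s)" and M: "prepared (snd s)"
    and tab: "tabled \<rho> (snd s)" and r: "2 \<le> r"
  shows "wp answer (\<lambda>c s'. c \<le> 30 \<and>
    fst s' ''out'' = (if has_bipartition_without_complete r G then 1 else 0)) s"
proof -
  have \<rho>: "\<rho> < m" using root_node nodes by simp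
  have "snd s (addr W 9 \<rho>) = addr W (11 + 3 * \<rho>) 0" using M \<rho> unfolding prepared_def by simp
  then have t: "aval (Plus (Plus (Mem_at ''B'' (Reg ''o'')) (Reg ''W'')) (Reg ''W'')) s = addr W (13 + 3 * \<rho>) 0"
    using b regs by (simp add: bases_def addr_def algebra_simps)
  have "snd s (addr W (13 + 3 * \<rho>) (set_encode {})) = (if marked \<rho> {} then 1 else 0)"
    using tab[unfolded tabled_def, rule_format, of "{}"] by simp
  moreover have "marked \<rho> {} \<longleftrightarrow> (\<exists>S\<subseteq>X \<rho>. extendable \<rho> S)"
    unfolding marked_def parent_bag_root by simp
  ultimately have cell: "snd s (addr W (13 + 3 * \<rho>) 0) = (if \<exists>S\<subseteq>X \<rho>. extendable \<rho> S then 1 else 0)"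
    by simp
  have eq: "has_bipartition_without_complete r G \<longleftrightarrow> 1 < n \<and> (\<exists>S\<subseteq>X \<rho>. extendable \<rho> S)"
    unfolding has_bipartition_iff_extendable[OF r] using vertices by auto
  show ?thesis
    unfolding answer_def
    by (rule wp_assign_seq_le[OF t, where b = 20]) (use cell eq regs in auto)
qed

end

section \<open>Reading the input\<close>

lemma length_concat_upt: "length (concat (map f [0..<n])) = (\<Sum>u<n. length (f u))"
  by (induction n) auto

lemma nth_concat_upt:
  assumes "v < n" "e < length (f v)"
  shows "concat (map f [0..<n]) ! ((\<Sum>u<v. length (f u)) + e) = f v ! e"
proof -
  have "[0..<n] = [0..<v] @ v # [Suc v..<n]"
    using assms(1) by (metis upt_add_eq_append upt_conv_Cons le_add_diff_inverse less_imp_le zero_le)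
  then have "concat (map f [0..<n]) = concat (map f [0..<v]) @ f v @ concat (map f [Suc v..<n])"
    by simp
  then show ?thesis
    using assms(2) length_concat_upt[of f v] by (simp add: nth_append)
qed

definition skip_list :: com where
  "skip_list = Assign ''p'' (Plus (Reg ''p'') (Plus (Mem (Reg ''p'')) (Const 1)))"

text \<open>A preliminary pass that writes nothing to memory: the length of the input is not given,
  but the stride, and with it every row address, depends on it. At the end \<open>''p''\<close> is
  that length, and it controls the doublings that yield \<open>''W''\<close>.\<close>

definition measure_input :: com where
  "measure_input =
    Seq (Assign ''n'' (Mem (Const 0)))
    (Seq (Assign ''p'' (Const 1))
    (Seq (For ''i'' ''n'' skip_list)
    (Seq (Assign ''m'' (Mem (Reg ''p'')))
    (Seq (Assign ''o'' (Mem_at ''p'' (Const 1)))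
    (Seq (Assign ''p'' (Plus (Reg ''p'') (Const 2)))
    (Seq (Assign ''s'' (Reg ''p''))
    (Seq (For ''i'' ''m'' (Seq skip_list skip_list))
    (Seq (Assign ''W'' (Const 1))
      (For ''i'' ''p'' (Assign ''W'' (Plus (Reg ''W'') (Reg ''W''))))))))))))"

definition set_bases :: com where
  "set_bases =
    Seq (Assign ''P'' (Reg ''W''))
    (Seq (Assign ''S'' (Plus (Reg ''P'') (Reg ''W'')))
    (Seq (Assign ''U'' (Plus (Reg ''S'') (Reg ''W'')))
    (Seq (Assign ''Q'' (Plus (Reg ''U'') (Reg ''W'')))
    (Seq (Assign ''L'' (Plus (Reg ''Q'') (Reg ''W'')))
    (Seq (Assign ''M'' (Plus (Reg ''L'') (Reg ''W'')))
    (Seq (Assign ''O'' (Plus (Reg ''M'') (Reg ''W'')))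
    (Seq (Assign ''G'' (Plus (Reg ''O'') (Reg ''W'')))
    (Seq (Assign ''B'' (Plus (Reg ''G'') (Reg ''W'')))
      (Assign ''x'' (Plus (Reg ''B'') (Plus (Reg ''W'') (Reg ''W''))))))))))))"

text \<open>Row 9 replaces the multiplication of a row number by the stride. Register
  \<open>''x''\<close> starts at row 11 and advances by three rows. The loop is bounded by the
  length of the input, which is at least \<open>n\<close> and at least \<open>m\<close>.\<close>

definition row_addresses :: com where
  "row_addresses = For ''i'' ''p'' (Seq (Store (Plus (Reg ''B'') (Reg ''i'')) (Reg ''x''))
    (Assign ''x'' (Plus (Reg ''x'') (Plus (Reg ''W'') (Plus (Reg ''W'') (Reg ''W''))))))"

definition powers :: com where
  "powers = Seq (Assign ''x'' (Const 1))
    (For ''i'' ''n'' (Seq (Store (Plus (Reg ''P'') (Reg ''i'')) (Reg ''x''))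
      (Assign ''x'' (Plus (Reg ''x'') (Reg ''x'')))))"

definition fill_marks :: com where
  "fill_marks = For ''e'' ''k''
    (Seq (Assign ''y'' (Mem_at ''p'' (Plus (Const 1) (Reg ''e''))))
      (Store (Plus (Reg ''R'') (Reg ''y'')) (Mem_at ''P'' (Reg ''y''))))"

definition read_adjacency :: com where
  "read_adjacency = Seq (Assign ''p'' (Const 1)) (For ''i'' ''n''
    (Seq (Assign ''k'' (Mem (Reg ''p'')))
    (Seq (Assign ''R'' (Mem_at ''B'' (Reg ''i'')))
    (Seq fill_marks (Assign ''p'' (Plus (Reg ''p'') (Plus (Reg ''k'') (Const 1))))))))"

definition fill_parents :: com where
  "fill_parents = For ''e'' ''k''
    (Store (Plus (Reg ''U'') (Mem_at ''p'' (Plus (Const 1) (Reg ''e'')))) (Reg ''R''))"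

text \<open>Register \<open>''R''\<close> serves twice: as the address entered for all children of
  the node in row 3, and as the row in which the bag of the node is then marked.\<close>

definition read_nodes :: com where
  "read_nodes = Seq (Assign ''p'' (Reg ''s'')) (For ''i'' ''m''
    (Seq (Store (Plus (Reg ''S'') (Reg ''i'')) (Reg ''p''))
    (Seq (Assign ''R'' (Plus (Mem_at ''B'' (Reg ''i'')) (Reg ''W'')))
    (Seq (Assign ''k'' (Mem (Reg ''p'')))
    (Seq fill_parents
    (Seq (Assign ''p'' (Plus (Reg ''p'') (Plus (Reg ''k'') (Const 1))))
    (Seq (Assign ''k'' (Mem (Reg ''p'')))
    (Seq fill_marks (Assign ''p'' (Plus (Reg ''p'') (Plus (Reg ''k'') (Const 1))))))))))))"

text \<open>The final store gives the root a parent bag: \<open>''B''\<close> is row 9, so the sum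
  is the address of row 10, which stays zero.\<close>

definition prepare_input :: com where
  "prepare_input = Seq measure_input (Seq set_bases (Seq row_addresses (Seq powers
    (Seq read_adjacency (Seq read_nodes
      (Store (Plus (Reg ''U'') (Reg ''o'')) (Plus (Reg ''B'') (Reg ''W''))))))))"

lemma assigned_parse [simp]:
  "assigned skip_list = {''p''}"
  "assigned measure_input = {''n'', ''p'', ''i'', ''m'', ''o'', ''s'', ''W''}"
  "assigned row_addresses = {''i'', ''x''}"
  "assigned powers = {''i'', ''x''}"
  "assigned fill_marks = {''e'', ''y''}"
  "assigned read_adjacency = {''p'', ''i'', ''k'', ''R'', ''e'', ''y''}"
  "assigned fill_parents = {''e''}"
  "assigned read_nodes = {''p'', ''i'', ''k'', ''R'', ''e'', ''y''}"
  by (auto simp: skip_list_def measure_input_def row_addresses_def powers_def fill_marks_def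
      read_adjacency_def fill_parents_def read_nodes_def)

section \<open>Positions in the input and correctness of reading it\<close>

locale encoded_input = rooted_decomposition G T \<rho> X r
  for G T :: "nat pair_pre_digraph" and \<rho> :: nat and X r +
  fixes n m :: nat and adj children_list bag :: "nat \<Rightarrow> nat list" and xs :: "nat list"
  assumes vertices: "pverts G = {..<n}" and nodes: "pverts T = {..<m}"
    and adj: "\<And>v. v < n \<Longrightarrow> distinct (adj v) \<and> set (adj v) = nbrs G v"
    and bag: "\<And>i. i < m \<Longrightarrow> distinct (bag i) \<and> set (bag i) = X i"
    and children_list: "\<And>i. i < m \<Longrightarrow> distinct (children_list i) \<and> set (children_list i) = ch i"
    and few_children: "\<And>i. i < m \<Longrightarrow> length (children_list i) \<le> 2"
    and input: "xs = [n] @ concat (map (\<lambda>v. with_length (adj v)) [0..<n]) @ [m, \<rho>] @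
      concat (map (\<lambda>i. with_length (children_list i) @ with_length (bag i)) [0..<m])"
begin

definition vertex_start :: "nat \<Rightarrow> nat" where
  "vertex_start v = 1 + (\<Sum>u<v. Suc (length (adj u)))"

text \<open>The summand 2 after \<open>vertex_start n\<close> skips the number of nodes and the
  root; in each record the 2 counts the two length fields. \<open>node_start m\<close> is the end of
  the input.\<close>

definition node_start :: "nat \<Rightarrow> nat" where
  "node_start i = vertex_start n + 2 + (\<Sum>j<i. length (children_list j) + length (bag j) + 2)"

lemma vertex_start_Suc: "vertex_start (Suc v) = vertex_start v + 1 + length (adj v)"
  by (simp add: vertex_start_def)

lemma node_start_Suc: "node_start (Suc i) = node_start i + length (children_list i) + length (bag i) + 2"
  by (simp add: node_start_def)

lemma vertex_start_mono: "u \<le> v \<Longrightarrow> vertex_start u \<le> vertex_start v"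
  unfolding vertex_start_def by (intro add_left_mono sum_mono2) auto

lemma node_start_mono: "i \<le> j \<Longrightarrow> node_start i \<le> node_start j"
  unfolding node_start_def by (intro add_left_mono sum_mono2) auto

lemma length_adjacency:
  "length (concat (map (\<lambda>v. with_length (adj v)) [0..<n])) = (\<Sum>u<n. Suc (length (adj u)))"
  by (simp add: length_concat_upt with_length_def)

lemma length_input: "length xs = node_start m"
  by (simp add: input node_start_def vertex_start_def length_concat_upt with_length_def
      add.commute add.left_commute)

lemma n_le: "n + 1 \<le> vertex_start n"
  unfolding vertex_start_def using sum_mono[of "{..<n}" "\<lambda>_. 1" "\<lambda>u. Suc (length (adj u))"] by simp

lemma m_le: "vertex_start n + 2 + 2 * m \<le> length xs"
  unfolding length_input node_start_def
  using sum_mono[of "{..<m}" "\<lambda>_. 2" "\<lambda>j. length (children_list j) + length (bag j) + 2"] by simp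

lemma input_n: "xs ! 0 = n"
  by (simp add: input)

lemma input_adj:
  assumes "v < n" "e \<le> length (adj v)"
  shows "xs ! (vertex_start v + e) = with_length (adj v) ! e"
proof -
  let ?A = "concat (map (\<lambda>v. with_length (adj v)) [0..<n])"
  let ?p = "(\<Sum>u<v. length (with_length (adj u))) + e"
  have p: "vertex_start v + e = Suc ?p" by (simp add: vertex_start_def with_length_def)
  have "vertex_start v + e < vertex_start (Suc v)" using assms(2) by (simp add: vertex_start_Suc)
  also have "\<dots> \<le> vertex_start n" using assms(1) by (intro vertex_start_mono) simp
  finally have "?p < length ?A" unfolding length_adjacency by (simp add: vertex_start_def with_length_def)
  then have "xs ! (vertex_start v + e) = ?A ! ?p"
    unfolding p input by (simp add: nth_append)
  also have "\<dots> = with_length (adj v) ! e"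
    by (rule nth_concat_upt) (use assms in \<open>simp_all add: with_length_def\<close>)
  finally show ?thesis .
qed

lemma input_m_root: "xs ! vertex_start n = m" "xs ! (vertex_start n + 1) = \<rho>"
  using length_adjacency by (simp_all add: input vertex_start_def nth_append)

lemma input_node:
  assumes "i < m" "e < length (children_list i) + length (bag i) + 2"
  shows "xs ! (node_start i + e) = (with_length (children_list i) @ with_length (bag i)) ! e"
proof -
  let ?f = "\<lambda>i. with_length (children_list i) @ with_length (bag i)"
  let ?A = "concat (map (\<lambda>v. with_length (adj v)) [0..<n])"
  let ?p = "(\<Sum>u<i. length (?f u)) + e"
  have p: "node_start i + e = length ([n] @ ?A @ [m, \<rho>]) + ?p"
    unfolding node_start_def vertex_start_def
    by (simp add: length_concat_upt with_length_def add.commute add.left_commute)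
  have xs: "xs = ([n] @ ?A @ [m, \<rho>]) @ concat (map ?f [0..<m])" by (simp add: input)
  have "xs ! (node_start i + e) = concat (map ?f [0..<m]) ! ?p"
    unfolding p by (subst xs) (rule nth_append_length_plus)
  also have "\<dots> = ?f i ! e"
    by (rule nth_concat_upt) (use assms in \<open>simp_all add: with_length_def\<close>)
  finally show ?thesis .
qed

lemma input_adj_simps:
  assumes "v < n"
  shows "xs ! vertex_start v = length (adj v)"
    "e < length (adj v) \<Longrightarrow> xs ! (vertex_start v + 1 + e) = adj v ! e"
  using input_adj[OF assms, of 0] input_adj[OF assms, of "1 + e"]
  by (simp_all add: with_length_def add.assoc)

lemma input_node_simps:
  assumes "i < m"
  shows "xs ! node_start i = length (children_list i)"
    "e < length (children_list i) \<Longrightarrow> xs ! (node_start i + 1 + e) = children_list i ! e"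
    "xs ! (node_start i + 1 + length (children_list i)) = length (bag i)"
    "e < length (bag i) \<Longrightarrow> xs ! (node_start i + 2 + length (children_list i) + e) = bag i ! e"
  using input_node[OF assms, of 0] input_node[OF assms, of "1 + e"]
    input_node[OF assms, of "1 + length (children_list i)"]
    input_node[OF assms, of "2 + length (children_list i) + e"]
  by (simp_all add: with_length_def nth_append add.assoc)

definition stride :: nat where
  "stride = 2 ^ length xs"

lemma length_less_stride: "length xs < stride"
  unfolding stride_def by (rule less_exp)

lemma vertex_start_less: "v \<le> n \<Longrightarrow> vertex_start v < length xs"
  using vertex_start_mono[of v n] m_le by linarith

lemma node_start_le: "i \<le> m \<Longrightarrow> node_start i \<le> length xs"
  unfolding length_input by (rule node_start_mono)

sublocale encoded_decomposition G T \<rho> X r n m stride children_list bag node_start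
proof unfold_locales
  have "n \<le> length xs" using n_le m_le by linarith
  then show "2 ^ n \<le> stride" unfolding stride_def by (intro power_increasing) auto
  show "m \<le> stride" using m_le length_less_stride by linarith
  show "node_start i + length (children_list i) + length (bag i) + 2 \<le> stride" if "i < m" for i
    using node_start_le[of "Suc i"] that length_less_stride by (simp add: node_start_Suc)
qed (use vertices nodes bag children_list few_children in auto)

definition loaded :: "(nat \<Rightarrow> nat) \<Rightarrow> bool" where
  "loaded M \<longleftrightarrow> (\<forall>p<length xs. M p = xs ! p)"

lemma loaded_same: "loaded M \<Longrightarrow> same_outside stride R M M' \<Longrightarrow> 0 \<notin> R \<Longrightarrow> loaded M'"
  unfolding loaded_def using same_outside_input length_less_stride by (metis less_trans)

lemma wp_measure_input:
  assumes "loaded (snd s)"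
  shows "wp measure_input (\<lambda>c s'. c \<le> 50 * length xs + 50 \<and> (snd s' = snd s \<and> fst s' ''n'' = n \<and>
    fst s' ''m'' = m \<and> fst s' ''o'' = \<rho> \<and> fst s' ''s'' = node_start 0 \<and>
    fst s' ''p'' = length xs \<and> fst s' ''W'' = stride)) s"
proof -
  have M: "snd s p = xs ! p" if "p < length xs" for p using assms that by (simp add: loaded_def)
  have len: "0 < length xs" using m_le by linarith
  let ?s1 = "((fst s)(''n'' := n, ''p'' := 1), snd s)"
  define I where "I v s' \<longleftrightarrow> snd s' = snd s \<and> fst s' ''p'' = vertex_start v" for v and s' :: state
  have loop1: "wp (For ''i'' ''n'' skip_list) (\<lambda>c s'. c \<le> (\<Sum>v<n. 7 + 8) + 6 \<and>
    (I n s' \<and> fst s' ''i'' = n)) ?s1"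
  proof (rule wp_For)
    show "I 0 ((fst ?s1)(''i'' := 0), snd ?s1)" by (simp add: I_def vertex_start_def)
    fix v s2 assume v: "v < n" and I: "I v s2"
    have "snd s2 (vertex_start v) = length (adj v)"
      using I M[OF vertex_start_less[of v]] v input_adj_simps(1) by (simp add: I_def)
    then show "wp skip_list (\<lambda>c s'. c \<le> 7 \<and> I (Suc v) ((fst s')(''i'' := Suc v), snd s')) s2"
      using I by (simp add: skip_list_def I_def vertex_start_Suc)
  qed simp_all
  define J where "J i s' \<longleftrightarrow> snd s' = snd s \<and> fst s' ''p'' = node_start i" for i and s' :: state
  have loop2: "wp (For ''i'' ''m'' (Seq skip_list skip_list)) (\<lambda>c s'. c \<le> (\<Sum>v<m. 14 + 8) + 6 \<and>
    (J m s' \<and> fst s' ''i'' = m)) s2" if "J 0 s2" "fst s2 ''m'' = m" for s2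
  proof (rule wp_For)
    show "J 0 ((fst s2)(''i'' := 0), snd s2)" using that by (simp add: J_def)
    fix i s3 assume i: "i < m" and J: "J i s3"
    have "node_start i + 1 + length (children_list i) < length xs"
      using node_start_le[of "Suc i"] i by (simp add: node_start_Suc)
    then have "snd s3 (node_start i) = length (children_list i)"
      "snd s3 (node_start i + 1 + length (children_list i)) = length (bag i)"
      using J M input_node_simps[OF i] by (simp_all add: J_def)
    then show "wp (Seq skip_list skip_list)
        (\<lambda>c s'. c \<le> 14 \<and> J (Suc i) ((fst s')(''i'' := Suc i), snd s')) s3"
      using J by (simp add: skip_list_def J_def node_start_Suc add.commute add.left_commute)
  qed (use that in simp_all)
  define K where "K i s' \<longleftrightarrow> snd s' = snd s \<and> fst s' ''W'' = 2 ^ i" for i and s' :: state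
  have loop3: "wp (For ''i'' ''p'' (Assign ''W'' (Plus (Reg ''W'') (Reg ''W''))))
      (\<lambda>c s'. c \<le> (\<Sum>v<length xs. 4 + 8) + 6 \<and> (K (length xs) s' \<and> fst s' ''i'' = length xs)) s2"
    if "K 0 s2" "fst s2 ''p'' = length xs" for s2
    by (rule wp_For) (use that in \<open>simp_all add: K_def\<close>)
  have ns: "node_start 0 = vertex_start n + 2" by (simp add: node_start_def)
  have n: "snd s 0 = n" using M[OF len] input_n by simp
  have vm: "snd s (vertex_start n) = m" "snd s (Suc (vertex_start n)) = \<rho>"
    using M[of "vertex_start n"] M[of "Suc (vertex_start n)"] m_le input_m_root by simp_all
  show ?thesis
    unfolding measure_input_def
    apply (rule wp_assign_seq_le[where v = n and b = "50 * length xs + 46"])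
    subgoal using n by simp
    apply (rule wp_assign_seq_le[where v = 1 and b = "50 * length xs + 44"])
    subgoal by simp
    apply (simp only: fst_conv snd_conv)
    apply (rule wp_seq_le[OF loop1, where b' = "22 * m + 12 * length xs + 38"])
    subgoal for s2
      apply (rule wp_assign_seq_le[where v = m and b = "22 * m + 12 * length xs + 34"])
      subgoal using vm by (simp add: I_def)
      apply (rule wp_assign_seq_le[where v = \<rho> and b = "22 * m + 12 * length xs + 27"])
      subgoal using vm by (simp add: I_def)
      apply (rule wp_assign_seq_le[where v = "node_start 0" and b = "22 * m + 12 * length xs + 20"])
      subgoal by (simp add: I_def ns)
      apply (rule wp_assign_seq_le[where v = "node_start 0" and b = "22 * m + 12 * length xs + 16"])
      subgoal by simp
      apply (simp only: fst_conv snd_conv)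
      apply (rule wp_seq_le[OF loop2, where b' = "12 * length xs + 10"])
      subgoal by (simp add: I_def J_def)
      subgoal by simp
      subgoal for s3
        apply (rule wp_assign_seq_le[where v = 1 and b = "12 * length xs + 6"])
        subgoal by simp
        apply (rule wp_le_mono[OF loop3])
        by (simp_all add: K_def J_def I_def length_input stride_def)
      by simp_all
    using m_le n_le by simp_all
qed

lemma wp_set_bases:
  assumes "fst s ''W'' = stride"
  shows "wp set_bases (\<lambda>c s'. c \<le> 60 \<and> (snd s' = snd s \<and> bases (fst s') \<and>
    fst s' ''x'' = addr stride 11 0 \<and>
    (\<forall>y\<in>{''n'', ''m'', ''o'', ''s'', ''p''}. fst s' y = fst s y))) s"
  using assms by (simp add: set_bases_def bases_def addr_def)

lemma wp_row_addresses:
  assumes b: "bases (fst s)" and regs: "fst s ''x'' = addr stride 11 0" "fst s ''p'' = length xs"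
  shows "wp row_addresses (\<lambda>c s'. c \<le> 25 * length xs + 6 \<and>
    ((\<forall>q<max n m. snd s' (addr stride 9 q) = addr stride (11 + 3 * q) 0) \<and>
    same_outside stride {9} (snd s) (snd s'))) s"
proof -
  let ?body = "Seq (Store (Plus (Reg ''B'') (Reg ''i'')) (Reg ''x''))
    (Assign ''x'' (Plus (Reg ''x'') (Plus (Reg ''W'') (Plus (Reg ''W'') (Reg ''W'')))))"
  define I where "I i s' \<longleftrightarrow> fst s' ''x'' = addr stride (11 + 3 * i) 0 \<and>
    (\<forall>q<i. snd s' (addr stride 9 q) = addr stride (11 + 3 * q) 0) \<and>
    same_outside stride {9} (snd s) (snd s')" for i and s' :: state
  have "wp (For ''i'' ''p'' ?body) (\<lambda>c s'. c \<le> (\<Sum>q<length xs. 17 + 8) + 6 \<and>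
    (I (length xs) s' \<and> fst s' ''i'' = length xs)) s"
  proof (rule wp_For)
    show "I 0 ((fst s)(''i'' := 0), snd s)" using regs by (simp add: I_def)
    fix i s1 assume i: "i < length xs" and I: "I i s1" and i': "fst s1 ''i'' = i"
      and frame: "\<And>y. y \<notin> insert ''i'' (assigned ?body) \<Longrightarrow> fst s1 y = fst s y"
    have b1: "fst s1 ''B'' = addr stride 9 0" "fst s1 ''W'' = stride"
      using frame b by (simp_all add: bases_def)
    have iW: "i < stride" using i length_less_stride by simp
    have next_row: "addr stride (11 + 3 * i) (stride + (stride + stride)) = addr stride (11 + 3 * Suc i) 0"
      by (simp add: addr_def algebra_simps)
    have "\<forall>q<Suc i. ((snd s1)(addr stride 9 i := addr stride (11 + 3 * i) 0)) (addr stride 9 q)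
        = addr stride (11 + 3 * q) 0"
      using I iW by (auto simp: I_def less_Suc_eq)
    then show "wp ?body (\<lambda>c s'. c \<le> 17 \<and> I (Suc i) ((fst s')(''i'' := Suc i), snd s')) s1"
      using I b1 i' iW next_row by (simp add: I_def same_outside_update)
  qed (use regs in simp_all)
  then show ?thesis
    unfolding row_addresses_def
  proof (rule wp_le_mono, goal_cases)
    case (2 s')
    have "n \<le> length xs" "m \<le> length xs" using n_le m_le by linarith+
    then show ?case using 2 by (auto simp: I_def)
  qed simp
qed

lemma wp_powers:
  assumes b: "bases (fst s)" and regs: "fst s ''n'' = n"
  shows "wp powers (\<lambda>c s'. c \<le> 20 * n + 10 \<and>
    ((\<forall>v<n. snd s' (addr stride 1 v) = 2 ^ v) \<and> same_outside stride {1} (snd s) (snd s'))) s"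
proof -
  let ?body = "Seq (Store (Plus (Reg ''P'') (Reg ''i'')) (Reg ''x''))
      (Assign ''x'' (Plus (Reg ''x'') (Reg ''x'')))"
  let ?s1 = "((fst s)(''x'' := 1), snd s)"
  define I where "I i s' \<longleftrightarrow> fst s' ''x'' = 2 ^ i \<and>
    (\<forall>v<i. snd s' (addr stride 1 v) = 2 ^ v) \<and>
    same_outside stride {1} (snd s) (snd s')" for i and s' :: state
  have loop: "wp (For ''i'' ''n'' ?body) (\<lambda>c s'. c \<le> (\<Sum>q<n. 12 + 8) + 6 \<and>
    (I n s' \<and> fst s' ''i'' = n)) ?s1"
  proof (rule wp_For)
    show "I 0 ((fst ?s1)(''i'' := 0), snd ?s1)" by (simp add: I_def)
    fix i s1 assume i: "i < n" and I: "I i s1" and i': "fst s1 ''i'' = i"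
      and frame: "\<And>y. y \<notin> insert ''i'' (assigned ?body) \<Longrightarrow> fst s1 y = fst ?s1 y"
    have b1: "fst s1 ''P'' = addr stride 1 0" using frame b by (simp_all add: bases_def)
    have iW: "i < stride" using i n_less_W by simp
    have "\<forall>v<Suc i. ((snd s1)(addr stride 1 i := 2 ^ i)) (addr stride 1 v) = 2 ^ v"
      using I iW by (auto simp: I_def less_Suc_eq)
    then show "wp ?body (\<lambda>c s'. c \<le> 12 \<and> I (Suc i) ((fst s')(''i'' := Suc i), snd s')) s1"
      using I b1 i' iW by (simp add: I_def same_outside_update)
  qed (use regs in simp_all)
  show ?thesis
    unfolding powers_def
    apply (rule wp_assign_seq_le[where v = 1 and b = "20 * n + 6"])
    subgoal by simp
    apply (rule wp_le_mono[OF loop])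
    by (simp_all add: I_def)
qed

lemma wp_fill_marks:
  assumes b: "bases (fst s)" and regs: "fst s ''R'' = addr stride u 0" "fst s ''k'' = length ys"
    and ys: "set ys \<subseteq> {..<n}" "\<And>e. e < length ys \<Longrightarrow> snd s (fst s ''p'' + 1 + e) = ys ! e"
      "fst s ''p'' + 1 + length ys \<le> stride"
    and pw: "\<And>v. v < n \<Longrightarrow> snd s (addr stride 1 v) = 2 ^ v" and u: "u \<noteq> 0" "u \<noteq> 1"
    and blank: "\<And>v. v < n \<Longrightarrow> snd s (addr stride u v) = 0"
  shows "wp fill_marks (\<lambda>c s'. c \<le> 25 * length ys + 6 \<and>
    ((\<forall>v<n. snd s' (addr stride u v) = (if v \<in> set ys then 2 ^ v else 0)) \<and>
    same_outside stride {u} (snd s) (snd s'))) s"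
proof -
  let ?body = "Seq (Assign ''y'' (Mem_at ''p'' (Plus (Const 1) (Reg ''e''))))
      (Store (Plus (Reg ''R'') (Reg ''y'')) (Mem_at ''P'' (Reg ''y'')))"
  define I where "I e s' \<longleftrightarrow>
    (\<forall>v<n. snd s' (addr stride u v) = (if v \<in> set (take e ys) then 2 ^ v else 0)) \<and>
    same_outside stride {u} (snd s) (snd s')" for e and s' :: state
  have "wp (For ''e'' ''k'' ?body) (\<lambda>c s'. c \<le> (\<Sum>q<length ys. 17 + 8) + 6 \<and>
    (I (length ys) s' \<and> fst s' ''e'' = length ys)) s"
  proof (rule wp_For)
    show "I 0 ((fst s)(''e'' := 0), snd s)" using blank by (simp add: I_def)
    fix e s1 assume e: "e < length ys" and I: "I e s1" and e': "fst s1 ''e'' = e"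
      and frame: "\<And>y. y \<notin> insert ''e'' (assigned ?body) \<Longrightarrow> fst s1 y = fst s y"
    have b1: "fst s1 ''P'' = addr stride 1 0" "fst s1 ''R'' = addr stride u 0" "fst s1 ''p'' = fst s ''p''"
      using frame b regs by (simp_all add: bases_def)
    have sm: "same_outside stride {u} (snd s) (snd s1)" using I by (simp add: I_def)
    have yn: "ys ! e < n" using ys(1) e nth_mem by blast
    then have yW: "ys ! e < stride" using n_less_W by simp
    have "snd s1 (fst s ''p'' + 1 + e) = ys ! e"
      using same_outside_input[OF sm, of "fst s ''p'' + 1 + e"] ys(2)[OF e] ys(3) e u by simp
    then have y: "snd s1 (Suc (fst s ''p'' + e)) = ys ! e" by simp
    have p: "snd s1 (addr stride 1 (ys ! e)) = 2 ^ (ys ! e)"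
      using same_outsideD[OF sm yW, of 1] u pw[OF yn] by simp
    have val: "\<forall>v<n. ((snd s1)(addr stride u (ys ! e) := 2 ^ (ys ! e))) (addr stride u v)
        = (if v \<in> set (take (Suc e) ys) then 2 ^ v else 0)"
      using I yW n_less_W e by (auto simp: I_def take_Suc_conv_app_nth)
    show "wp ?body (\<lambda>c s'. c \<le> 17 \<and> I (Suc e) ((fst s')(''e'' := Suc e), snd s')) s1"
      using val sm b1 e' y p yW by (simp add: I_def same_outside_update)
  qed (use regs in simp_all)
  then show ?thesis
    unfolding fill_marks_def
    by (rule wp_le_mono) (simp_all add: I_def)
qed

lemma wp_read_adjacency:
  assumes b: "bases (fst s)" and regs: "fst s ''n'' = n" and inp: "loaded (snd s)"
    and rb: "\<And>q. q < max n m \<Longrightarrow> snd s (addr stride 9 q) = addr stride (11 + 3 * q) 0"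
    and pw: "\<And>v. v < n \<Longrightarrow> snd s (addr stride 1 v) = 2 ^ v"
    and blank: "\<And>v w. v < n \<Longrightarrow> w < n \<Longrightarrow> snd s (addr stride (11 + 3 * v) w) = 0"
  shows "wp read_adjacency (\<lambda>c s'. c \<le> 40 * length xs \<and>
    ((\<forall>v<n. \<forall>w<n. snd s' (addr stride (11 + 3 * v) w) = (if w \<in> nbrs G v then 2 ^ w else 0)) \<and>
    same_outside stride (range (\<lambda>v. 11 + 3 * v)) (snd s) (snd s'))) s"
proof -
  let ?body = "Seq (Assign ''k'' (Mem (Reg ''p'')))
    (Seq (Assign ''R'' (Mem_at ''B'' (Reg ''i'')))
    (Seq fill_marks (Assign ''p'' (Plus (Reg ''p'') (Plus (Reg ''k'') (Const 1))))))"
  let ?s1 = "((fst s)(''p'' := 1), snd s)"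
  define I where "I v s' \<longleftrightarrow> fst s' ''p'' = vertex_start v \<and>
    (\<forall>u<v. \<forall>w<n. snd s' (addr stride (11 + 3 * u) w) = (if w \<in> nbrs G u then 2 ^ w else 0)) \<and>
    same_outside stride {11 + 3 * u | u. u < v} (snd s) (snd s')" for v and s' :: state
  have loop: "wp (For ''i'' ''n'' ?body) (\<lambda>c s'. c \<le> (\<Sum>v<n. (25 * length (adj v) + 25) + 8) + 6 \<and>
    (I n s' \<and> fst s' ''i'' = n)) ?s1"
  proof (rule wp_For)
    show "I 0 ((fst ?s1)(''i'' := 0), snd ?s1)" by (simp add: I_def vertex_start_def)
    fix v s1 assume v: "v < n" and I: "I v s1" and i': "fst s1 ''i'' = v"
      and frame: "\<And>y. y \<notin> insert ''i'' (assigned ?body) \<Longrightarrow> fst s1 y = fst ?s1 y"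
    have b1: "bases (fst s1)" using frame b by (simp add: bases_def)
    have p: "fst s1 ''p'' = vertex_start v" using I by (simp add: I_def)
    have sm: "same_outside stride {11 + 3 * u | u. u < v} (snd s) (snd s1)" using I by (simp add: I_def)
    have zero: "0 \<notin> {11 + 3 * u | u. u < v}" by auto
    have inp1: "loaded (snd s1)" by (rule loaded_same[OF inp sm zero])
    have fin: "vertex_start v + 1 + length (adj v) \<le> length xs"
      using vertex_start_less[of "Suc v"] v by (simp add: vertex_start_Suc)
    have len: "snd s1 (vertex_start v) = length (adj v)"
      using inp1 input_adj_simps(1)[OF v] fin by (simp add: loaded_def)
    have el: "snd s1 (vertex_start v + 1 + e) = adj v ! e" if "e < length (adj v)" for e
      using inp1 input_adj_simps(2)[OF v that] fin that by (simp add: loaded_def)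
    have cell: "snd s1 (addr stride a w) = snd s (addr stride a w)"
      if "w < stride" "a \<notin> {11 + 3 * u | u. u < v}" for a w
      by (rule same_outsideD[OF sm that])
    have vW: "v < stride" and small: "w < stride" if "w < n" for w
      using v that n_less_W by simp_all
    let ?s2 = "((fst s1)(''k'' := length (adj v), ''R'' := addr stride (11 + 3 * v) 0), snd s1)"
    have "9 \<notin> {11 + 3 * u | u. u < v}" by auto
    then have R: "snd s1 (addr stride 9 v) = addr stride (11 + 3 * v) 0"
      using cell[of v 9] vW[OF v] rb[of v] v by simp
    have one: "1 \<notin> {11 + 3 * u | u. u < v}" by auto
    have new: "11 + 3 * v \<notin> {11 + 3 * u | u. u < v}" by auto
    have fill: "wp fill_marks (\<lambda>c s'. c \<le> 25 * length (adj v) + 6 \<and>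
      ((\<forall>w<n. snd s' (addr stride (11 + 3 * v) w) = (if w \<in> set (adj v) then 2 ^ w else 0)) \<and>
       same_outside stride {11 + 3 * v} (snd ?s2) (snd s'))) ?s2"
    proof (rule wp_fill_marks)
      show "set (adj v) \<subseteq> {..<n}"
        using adj[OF v] G.wellformed'(2) vertices by (auto simp: nbrs_def)
      show "snd ?s2 (fst ?s2 ''p'' + 1 + e) = adj v ! e" if "e < length (adj v)" for e
        using el[OF that] p by simp
      show "fst ?s2 ''p'' + 1 + length (adj v) \<le> stride"
        using fin p length_less_stride by simp
      show "snd ?s2 (addr stride 1 w) = 2 ^ w" if "w < n" for w
        using cell[OF small[OF that] one] pw[OF that] by simp
      show "snd ?s2 (addr stride (11 + 3 * v) w) = 0" if "w < n" for w
        using cell[OF small[OF that] new] blank[OF v that] by simp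
      show "11 + 3 * v \<noteq> 1" by presburger
    qed (use b1 in \<open>simp_all add: bases_def\<close>)
    show "wp ?body (\<lambda>c s'. c \<le> 25 * length (adj v) + 25 \<and> I (Suc v) ((fst s')(''i'' := Suc v), snd s')) s1"
      apply (rule wp_assign_seq_le[where v = "length (adj v)" and b = "25 * length (adj v) + 20"])
      subgoal using p len by simp
      apply (rule wp_assign_seq_le[where v = "addr stride (11 + 3 * v) 0" and b = "25 * length (adj v) + 15"])
      subgoal using b1 i' R by (simp add: bases_def)
      apply (simp only: fst_conv snd_conv)
      apply (rule wp_seq_le[OF fill, where b' = 6])
      subgoal for s3
      proof -
        assume post: "(\<forall>w<n. snd s3 (addr stride (11 + 3 * v) w) = (if w \<in> set (adj v) then 2 ^ w else 0)) \<and>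
            same_outside stride {11 + 3 * v} (snd ?s2) (snd s3)"
          and frame3: "\<And>x. x \<notin> assigned fill_marks \<Longrightarrow> fst s3 x = fst ?s2 x"
        have sm3: "same_outside stride {11 + 3 * v} (snd s1) (snd s3)" using post by simp
        have r3: "fst s3 ''p'' = vertex_start v" "fst s3 ''k'' = length (adj v)"
          using frame3 p by simp_all
        have "same_outside stride {11 + 3 * u | u. u < Suc v} (snd s) (snd s3)"
          by (rule same_outside_trans[OF sm sm3]) auto
        moreover have "snd s3 (addr stride (11 + 3 * u) w) = (if w \<in> nbrs G u then 2 ^ w else 0)"
          if "u < Suc v" "w < n" for u w
        proof (cases "u = v")
          case True
          then show ?thesis using post adj[OF v] that by simp
        next
          case False
          then have "11 + 3 * u \<notin> {11 + 3 * v}" by simp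
          then show ?thesis
            using same_outsideD[OF sm3 small[OF that(2)]] I that False by (simp add: I_def)
        qed
        ultimately show ?thesis
          using r3 by (simp add: I_def vertex_start_Suc)
      qed
      by simp_all
  qed (use regs in simp_all)
  show ?thesis
    unfolding read_adjacency_def
    \<comment> \<open>The 2 is the cost of the first assignment. The input is longer than the
      adjacency lists by at least three entries, which pays for it and for the 6 of the
      loop.\<close>
    apply (rule wp_assign_seq_le[where v = 1 and b = "40 * length xs - 2"])
    subgoal by simp
    apply (rule wp_le_mono[OF loop])
    subgoal
    proof -
      have "(\<Sum>v<n. (25 * length (adj v) + 25) + 8) + 6 \<le> (\<Sum>v<n. 40 * Suc (length (adj v))) + 6"
        by (intro add_right_mono sum_mono) simp
      also have "\<dots> = 40 * (\<Sum>v<n. Suc (length (adj v))) + 6" by (simp only: sum_distrib_left)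
      also have "\<dots> \<le> 40 * length xs - 2"
        using m_le unfolding vertex_start_def by linarith
      finally show ?thesis .
    qed
    subgoal for s'
    proof -
      assume post: "I n s' \<and> fst s' ''i'' = n"
      have "same_outside stride (range (\<lambda>v. 11 + 3 * v)) (snd s) (snd s')"
        by (rule same_outside_trans[of _ _ _ _ "{}" _, OF _ same_outside_refl])
          (use post in \<open>auto simp: I_def\<close>)
      then show ?thesis using post by (simp add: I_def)
    qed
    using length_less_stride m_le by simp
qed

lemma wp_fill_parents:
  assumes b: "bases (fst s)" and i: "i < m" and regs: "fst s ''R'' = addr stride (12 + 3 * i) 0"
    "fst s ''k'' = length (children_list i)" "fst s ''p'' = node_start i"
    and inp: "loaded (snd s)"
  shows "wp fill_parents (\<lambda>c s'. c \<le> 20 * length (children_list i) + 6 \<and>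
    ((\<forall>j<m. snd s' (addr stride 3 j) = (if j \<in> ch i then addr stride (12 + 3 * i) 0
        else snd s (addr stride 3 j))) \<and>
    same_outside stride {3} (snd s) (snd s'))) s"
proof -
  let ?cl = "children_list i"
  let ?body = "Store (Plus (Reg ''U'') (Mem_at ''p'' (Plus (Const 1) (Reg ''e'')))) (Reg ''R'')"
  define I where "I e s' \<longleftrightarrow>
    (\<forall>j<m. snd s' (addr stride 3 j) = (if j \<in> set (take e ?cl) then addr stride (12 + 3 * i) 0
        else snd s (addr stride 3 j))) \<and>
    same_outside stride {3} (snd s) (snd s')" for e and s' :: state
  have "wp (For ''e'' ''k'' ?body) (\<lambda>c s'. c \<le> (\<Sum>q<length ?cl. 10 + 8) + 6 \<and>
    (I (length ?cl) s' \<and> fst s' ''e'' = length ?cl)) s"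
  proof (rule wp_For)
    show "I 0 ((fst s)(''e'' := 0), snd s)" by (simp add: I_def)
    fix e s1 assume e: "e < length ?cl" and I: "I e s1" and e': "fst s1 ''e'' = e"
      and frame: "\<And>y. y \<notin> insert ''e'' (assigned ?body) \<Longrightarrow> fst s1 y = fst s y"
    have b1: "fst s1 ''U'' = addr stride 3 0" "fst s1 ''R'' = addr stride (12 + 3 * i) 0"
      "fst s1 ''p'' = node_start i"
      using frame b regs by (simp_all add: bases_def)
    have sm: "same_outside stride {3} (snd s) (snd s1)" using I by (simp add: I_def)
    have "loaded (snd s1)" by (rule loaded_same[OF inp sm]) simp
    moreover have "node_start i + 1 + e < length xs"
      using node_start_le[of "Suc i"] i e by (simp add: node_start_Suc)
    ultimately have y: "snd s1 (Suc (node_start i + e)) = ?cl ! e"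
      using input_node_simps(2)[OF i e] by (simp add: loaded_def)
    have "?cl ! e \<in> ch i" using children_list[OF i] e nth_mem by metis
    then have "?cl ! e < m" using T.child_verts nodes by auto
    then have yW: "?cl ! e < stride" using stride(2) by simp
    have small: "j < stride" if "j < m" for j using that stride(2) by simp
    have val: "\<forall>j<m. ((snd s1)(addr stride 3 (?cl ! e) := addr stride (12 + 3 * i) 0)) (addr stride 3 j)
        = (if j \<in> set (take (Suc e) ?cl) then addr stride (12 + 3 * i) 0 else snd s (addr stride 3 j))"
      using I yW small e by (auto simp: I_def take_Suc_conv_app_nth)
    show "wp ?body (\<lambda>c s'. c \<le> 10 \<and> I (Suc e) ((fst s')(''e'' := Suc e), snd s')) s1"
      using val sm b1 e' y yW by (simp add: I_def same_outside_update)
  qed (use regs in simp_all)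
  then show ?thesis
    unfolding fill_parents_def
    by (rule wp_le_mono) (use children_list[OF i] in \<open>simp_all add: I_def\<close>)
qed

text \<open>Row 3 is filled from above: reading a node writes the entries of its children, so the
  last clause concerns them and not the entry of \<open>i\<close>.\<close>

definition node_read :: "nat \<Rightarrow> (nat \<Rightarrow> nat) \<Rightarrow> bool" where
  "node_read i M \<longleftrightarrow> M (addr stride 2 i) = node_start i \<and>
    (\<forall>v<n. M (addr stride (12 + 3 * i) v) = (if v \<in> X i then 2 ^ v else 0)) \<and>
    (\<forall>j\<in>ch i. M (addr stride 3 j) = addr stride (12 + 3 * i) 0)"

lemma wp_read_nodes:
  assumes b: "bases (fst s)" and regs: "fst s ''m'' = m" "fst s ''s'' = node_start 0"
    and inp: "loaded (snd s)"
    and rb: "\<And>q. q < max n m \<Longrightarrow> snd s (addr stride 9 q) = addr stride (11 + 3 * q) 0"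
    and pw: "\<And>v. v < n \<Longrightarrow> snd s (addr stride 1 v) = 2 ^ v"
    and blank: "\<And>i w. i < m \<Longrightarrow> w < n \<Longrightarrow> snd s (addr stride (12 + 3 * i) w) = 0"
  shows "wp read_nodes (\<lambda>c s'. c \<le> 40 * length xs + 10 \<and>
    ((\<forall>i<m. node_read i (snd s')) \<and>
    same_outside stride ({2, 3} \<union> range (\<lambda>i. 12 + 3 * i)) (snd s) (snd s'))) s"
proof -
  let ?body = "Seq (Store (Plus (Reg ''S'') (Reg ''i'')) (Reg ''p''))
    (Seq (Assign ''R'' (Plus (Mem_at ''B'' (Reg ''i'')) (Reg ''W'')))
    (Seq (Assign ''k'' (Mem (Reg ''p'')))
    (Seq fill_parents
    (Seq (Assign ''p'' (Plus (Reg ''p'') (Plus (Reg ''k'') (Const 1))))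
    (Seq (Assign ''k'' (Mem (Reg ''p'')))
    (Seq fill_marks (Assign ''p'' (Plus (Reg ''p'') (Plus (Reg ''k'') (Const 1))))))))))"
  \<comment> \<open>The rows changed by the first \<open>i\<close> nodes. The row for the bag of
    \<open>i\<close> is not among them, so it is still blank when its marks are written.\<close>
  define rows where "rows i = {2, 3} \<union> {12 + 3 * j | j. j < i}" for i :: nat
  have rows: "0 \<notin> rows i" "1 \<notin> rows i" "9 \<notin> rows i" "12 + 3 * i \<notin> rows i" for i
    unfolding rows_def by auto
  define I where "I i s' \<longleftrightarrow> fst s' ''p'' = node_start i \<and> (\<forall>j<i. node_read j (snd s')) \<and>
    same_outside stride (rows i) (snd s) (snd s')" for i and s' :: state
  let ?s1 = "((fst s)(''p'' := node_start 0), snd s)"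
  define B where "B i = 25 * (length (children_list i) + length (bag i)) + 50" for i
  have loop: "wp (For ''i'' ''m'' ?body) (\<lambda>c s'. c \<le> (\<Sum>i<m. B i + 8) + 6 \<and>
    (I m s' \<and> fst s' ''i'' = m)) ?s1"
  proof (rule wp_For)
    show "I 0 ((fst ?s1)(''i'' := 0), snd ?s1)" by (simp add: I_def)
    fix i s1 assume i: "i < m" and I: "I i s1" and i': "fst s1 ''i'' = i"
      and frame: "\<And>y. y \<notin> insert ''i'' (assigned ?body) \<Longrightarrow> fst s1 y = fst ?s1 y"
    let ?l = "length (children_list i)" and ?k = "length (bag i)" and ?u = "12 + 3 * i"
    have b1: "bases (fst s1)" using frame b by (simp add: bases_def)
    have p: "fst s1 ''p'' = node_start i" using I by (simp add: I_def)
    have sm1: "same_outside stride (rows i) (snd s) (snd s1)" using I by (simp add: I_def)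
    have fin: "node_start i + ?l + ?k + 2 \<le> length xs"
      using node_start_le[of "Suc i"] i by (simp add: node_start_Suc)
    have iW: "i < stride" using i stride(2) by simp
    have smW: "v < stride" if "v < n" for v using that n_less_W by simp
    let ?M2 = "(snd s1)(addr stride 2 i := node_start i)"
    have sm2: "same_outside stride {2} (snd s1) ?M2"
      using iW by (intro same_outside_update) auto
    have sm02: "same_outside stride (rows i) (snd s) ?M2"
      by (rule same_outside_trans[OF sm1 sm2]) (auto simp: rows_def)
    have inp2: "loaded ?M2" by (rule loaded_same[OF inp sm02 rows(1)])
    let ?s2 = "((fst s1)(''R'' := addr stride ?u 0, ''k'' := ?l), ?M2)"
    have R: "?M2 (addr stride 9 i) = addr stride (11 + 3 * i) 0"
      using same_outsideD[OF sm02 iW rows(3)] rb[of i] i by simp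
    have k2: "?M2 (node_start i) = ?l"
      using inp2 input_node_simps(1)[OF i] fin by (simp add: loaded_def)
    have fp: "wp fill_parents (\<lambda>c s'. c \<le> 20 * ?l + 6 \<and>
      ((\<forall>j<m. snd s' (addr stride 3 j) = (if j \<in> ch i then addr stride ?u 0
        else snd ?s2 (addr stride 3 j))) \<and>
       same_outside stride {3} (snd ?s2) (snd s'))) ?s2"
      by (rule wp_fill_parents) (use b1 i p inp2 in \<open>simp_all add: bases_def\<close>)
    have main: "wp (Seq fill_parents
      (Seq (Assign ''p'' (Plus (Reg ''p'') (Plus (Reg ''k'') (Const 1))))
      (Seq (Assign ''k'' (Mem (Reg ''p'')))
      (Seq fill_marks (Assign ''p'' (Plus (Reg ''p'') (Plus (Reg ''k'') (Const 1))))))))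
      (\<lambda>c s'. c \<le> 25 * (?l + ?k) + 32 \<and> I (Suc i) ((fst s')(''i'' := Suc i), snd s')) ?s2"
    proof (rule wp_seq_le[OF fp, where b' = "25 * ?k + 26"], goal_cases)
      case (1 s3)
      note post3 = 1(1) and frame3 = 1(2)
      have sm3: "same_outside stride {3} ?M2 (snd s3)" using post3 by simp
      have sm03: "same_outside stride (rows i) (snd s) (snd s3)"
        by (rule same_outside_trans[OF sm02 sm3]) (auto simp: rows_def)
      have inp3: "loaded (snd s3)" by (rule loaded_same[OF inp sm03 rows(1)])
      have r3: "bases (fst s3)" "fst s3 ''p'' = node_start i" "fst s3 ''k'' = ?l"
        "fst s3 ''R'' = addr stride ?u 0"
        using frame3 b1 p by (simp_all add: bases_def)
      let ?s4 = "((fst s3)(''p'' := node_start i + 1 + ?l, ''k'' := ?k), snd s3)"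
      have k3: "snd s3 (node_start i + 1 + ?l) = ?k"
        using inp3 input_node_simps(3)[OF i] fin by (simp add: loaded_def)
      have fm: "wp fill_marks (\<lambda>c s'. c \<le> 25 * ?k + 6 \<and>
        ((\<forall>v<n. snd s' (addr stride ?u v) = (if v \<in> set (bag i) then 2 ^ v else 0)) \<and>
         same_outside stride {?u} (snd ?s4) (snd s'))) ?s4"
      proof (rule wp_fill_marks)
        show "set (bag i) \<subseteq> {..<n}" using bag[OF i] bag_subset[OF i] by simp
        show "snd ?s4 (fst ?s4 ''p'' + 1 + e) = bag i ! e" if "e < ?k" for e
          using inp3 input_node_simps(4)[OF i that] fin that by (simp add: loaded_def add.commute add.left_commute)
        show "fst ?s4 ''p'' + 1 + ?k \<le> stride" using fin length_less_stride by simp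
        show "snd ?s4 (addr stride 1 v) = 2 ^ v" if "v < n" for v
          using same_outsideD[OF sm03 smW[OF that] rows(2)] pw[OF that] by simp
        show "snd ?s4 (addr stride ?u v) = 0" if "v < n" for v
          using same_outsideD[OF sm03 smW[OF that] rows(4)] blank[OF i that] by simp
        show "?u \<noteq> 1" by presburger
      qed (use r3 in \<open>simp_all add: bases_def\<close>)
      show ?case
        apply (rule wp_assign_seq_le[where v = "node_start i + 1 + ?l" and b = "25 * ?k + 20"])
        subgoal using r3 by simp
        apply (rule wp_assign_seq_le[where v = ?k and b = "25 * ?k + 15"])
        subgoal using k3 by simp
        apply (simp only: fst_conv snd_conv)
        apply (rule wp_seq_le[OF fm, where b' = 6])
        subgoal for s5
        proof -
          assume post5: "(\<forall>v<n. snd s5 (addr stride ?u v) = (if v \<in> set (bag i) then 2 ^ v else 0)) \<and>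
              same_outside stride {?u} (snd ?s4) (snd s5)"
            and frame5: "\<And>x. x \<notin> assigned fill_marks \<Longrightarrow> fst s5 x = fst ?s4 x"
          have sm5: "same_outside stride {?u} (snd s3) (snd s5)" using post5 by simp
          have "same_outside stride (rows (Suc i)) (snd s) (snd s5)"
            by (rule same_outside_trans[OF sm03 sm5]) (auto simp: rows_def)
          moreover have "node_read j (snd s5)" if j: "j < Suc i" for j
          proof -
            have jW: "j < stride" using j iW by simp
            have u23: "2 \<notin> {?u}" "3 \<notin> {?u}" by auto
            have start: "snd s5 (addr stride 2 a) = ?M2 (addr stride 2 a)" if "a < stride" for a
              using same_outsideD[OF sm5 that u23(1)] same_outsideD[OF sm3 that, of 2] by simp
            have par: "snd s5 (addr stride 3 a) = (if a \<in> ch i then addr stride ?u 0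
                else snd s1 (addr stride 3 a))" if "a < m" for a
              using same_outsideD[OF sm5 _ u23(2), of a] post3 that stride(2) iW by simp
            have chm: "a < m" if "a \<in> ch j" for a using that T.child_verts nodes by auto
            show ?thesis
            proof (cases "j = i")
              case True
              then show ?thesis
                using start[OF iW] par chm post5 bag[OF i] by (simp add: node_read_def)
            next
              case False
              then have rd: "node_read j (snd s1)" using I j by (simp add: I_def)
              have "snd s5 (addr stride (12 + 3 * j) v) = (if v \<in> X j then 2 ^ v else 0)" if "v < n" for v
              proof -
                have a: "12 + 3 * j \<notin> {?u}" using False by simp
                have b: "12 + 3 * j \<notin> {3}" "12 + 3 * j \<notin> {2}" by auto
                show ?thesis
                  using same_outsideD[OF sm5 smW[OF that] a] same_outsideD[OF sm3 smW[OF that] b(1)]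
                    same_outsideD[OF sm2 smW[OF that] b(2)] rd that by (simp add: node_read_def)
              qed
              moreover have "snd s5 (addr stride 2 j) = node_start j"
                using start[OF jW] rd False iW jW by (simp add: node_read_def)
              moreover have "snd s5 (addr stride 3 a) = addr stride (12 + 3 * j) 0" if "a \<in> ch j" for a
              proof -
                \<comment> \<open>Uniqueness of parents protects the entry written for
                  \<open>j\<close>: reading \<open>i\<close> cannot overwrite it.\<close>
                have "a \<notin> ch i" using that False T.parent_unique by blast
                then show ?thesis using par[OF chm[OF that]] rd that by (simp add: node_read_def)
              qed
              ultimately show ?thesis by (simp add: node_read_def)
            qed
          qed
          moreover have "fst s5 ''p'' = node_start i + 1 + ?l" "fst s5 ''k'' = ?k"
            using frame5 by simp_all
          ultimately show ?thesis by (simp add: I_def node_start_Suc)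
        qed
        by simp_all
    qed simp
    show "wp ?body (\<lambda>c s'. c \<le> B i \<and> I (Suc i) ((fst s')(''i'' := Suc i), snd s')) s1"
      unfolding B_def
      apply (rule wp_store_seq_le[where p = "addr stride 2 i" and v = "node_start i"
            and b = "25 * (?l + ?k) + 45"])
      subgoal using b1 i' by (simp add: bases_def)
      subgoal using p by simp
      apply (rule wp_assign_seq_le[where v = "addr stride ?u 0" and b = "25 * (?l + ?k) + 37"])
      subgoal using b1 i' R by (simp add: bases_def addr_def algebra_simps)
      apply (rule wp_assign_seq_le[where v = ?l and b = "25 * (?l + ?k) + 32"])
      subgoal using p k2 by simp
      apply (simp only: fst_conv snd_conv)
      apply (rule main)
      by simp_all
  qed (use regs in simp_all)
  show ?thesis
    unfolding read_nodes_def
    apply (rule wp_assign_seq_le[where v = "node_start 0" and b = "40 * length xs + 8"])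
    subgoal using regs by simp
    apply (rule wp_le_mono[OF loop])
    subgoal
    proof -
      have "(\<Sum>i<m. B i + 8) + 6 \<le> (\<Sum>i<m. 40 * (length (children_list i) + length (bag i) + 2)) + 6"
        unfolding B_def by (intro add_right_mono sum_mono) simp
      also have "\<dots> = 40 * (\<Sum>i<m. length (children_list i) + length (bag i) + 2) + 6"
        by (simp only: sum_distrib_left)
      also have "\<dots> \<le> 40 * length xs + 8"
        unfolding length_input node_start_def by simp
      finally show ?thesis .
    qed
    subgoal for s'
    proof -
      assume post: "I m s' \<and> fst s' ''i'' = m"
      have "rows m \<subseteq> {2, 3} \<union> range (\<lambda>i. 12 + 3 * i)" unfolding rows_def by auto
      then have "same_outside stride ({2, 3} \<union> range (\<lambda>i. 12 + 3 * i)) (snd s) (snd s')"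
        using post same_outside_trans[OF _ same_outside_refl, of _ "rows m" "snd s" "snd s'" _ "{}"]
        unfolding I_def by blast
      then show ?thesis using post by (simp add: I_def)
    qed
    by simp
qed

end

section \<open>Running time of the whole program\<close>

definition decide_bipartition :: "nat \<Rightarrow> com" where
  "decide_bipartition r = Seq prepare_input (Seq fill_queue (Seq (process_queue r) answer))"

context encoded_input
begin

text \<open>The coefficient 175 is 50 + 25 + 20 + 40 + 40, for measuring, row addresses, powers of
  2, adjacency lists and nodes; the number of vertices is bounded by the length of the
  input.\<close>

lemma wp_prepare_input:
  "wp prepare_input (\<lambda>c s'. c \<le> 175 * length xs + 150 \<and>
    (prepared (snd s') \<and> bases (fst s') \<and> fst s' ''n'' = n \<and> fst s' ''m'' = m \<and> fst s' ''o'' = \<rho> \<and>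
    (\<forall>i v. v < stride \<longrightarrow> snd s' (addr stride (13 + 3 * i) v) = 0))) (initial_state xs)"
proof -
  let ?s0 = "initial_state xs"
  \<comment> \<open>The stride exceeds the length of the input, so all rows except row 0 lie beyond
    it.\<close>
  have zero: "snd ?s0 (addr stride a v) = 0" if "0 < a" for a v
  proof -
    have "1 * stride \<le> a * stride" using that by (intro mult_le_mono1) simp
    then have "length xs \<le> addr stride a v" using length_less_stride unfolding addr_def by linarith
    then show ?thesis by (simp add: initial_state_def)
  qed
  have inp: "loaded (snd ?s0)" by (simp add: loaded_def initial_state_def)
  have small: "v < stride" if "v < n" for v using that n_less_W by simp
  have smalli: "i < stride" if "i < m" for i using that stride(2) by simp
  have smallq: "q < stride" if "q < max n m" for q using that small smalli by (auto simp: less_max_iff_disj)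
  have nl: "n \<le> length xs" using n_le m_le by linarith
  show ?thesis
    unfolding prepare_input_def
  proof (rule wp_seq_le[OF wp_measure_input[OF inp], where b' = "125 * length xs + 100"], goal_cases)
    case (1 s1)
    note post1 = this(1)
    show ?case
    proof (rule wp_seq_le[OF wp_set_bases, where b' = "125 * length xs + 40"], goal_cases)
      case 1
      show ?case using post1 by simp
    next
      case (2 s2)
      note post2 = this(1)
      have M2: "snd s2 = snd ?s0" using post1 post2 by simp
      have r2: "bases (fst s2)" "fst s2 ''x'' = addr stride 11 0" "fst s2 ''p'' = length xs"
        "fst s2 ''n'' = n" "fst s2 ''m'' = m" "fst s2 ''o'' = \<rho>" "fst s2 ''s'' = node_start 0"
        using post1 post2 by simp_all
      show ?case
      proof (rule wp_seq_le[OF wp_row_addresses[OF r2(1-3)], where b' = "100 * length xs + 34"], goal_cases)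
        case (1 s3)
        note post3 = this(1) and frame3 = this(2)
        have r3: "bases (fst s3)" "fst s3 ''n'' = n" "fst s3 ''m'' = m" "fst s3 ''o'' = \<rho>"
          "fst s3 ''s'' = node_start 0"
          using frame3 r2 by (simp_all add: bases_def)
        have sm3: "same_outside stride {9} (snd ?s0) (snd s3)" using post3 M2 by simp
        show ?case
        proof (rule wp_seq_le[OF wp_powers[OF r3(1,2)], where b' = "80 * length xs + 24"], goal_cases)
          case (1 s4)
          note post4 = this(1) and frame4 = this(2)
          have r4: "bases (fst s4)" "fst s4 ''n'' = n" "fst s4 ''m'' = m" "fst s4 ''o'' = \<rho>"
            "fst s4 ''s'' = node_start 0"
            using frame4 r3 by (simp_all add: bases_def)
          have sm34: "same_outside stride {1} (snd s3) (snd s4)" using post4 by simp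
          have sm4: "same_outside stride {1, 9} (snd ?s0) (snd s4)"
            by (rule same_outside_trans[OF sm3 sm34]) auto
          have inp4: "loaded (snd s4)" by (rule loaded_same[OF inp sm4]) simp
          have rb4: "snd s4 (addr stride 9 q) = addr stride (11 + 3 * q) 0" if "q < max n m" for q
            using same_outsideD[OF sm34 smallq[OF that], of 9] post3 that by simp
          have pw4: "snd s4 (addr stride 1 v) = 2 ^ v" if "v < n" for v
            using post4 that by simp
          have zero4: "snd s4 (addr stride a v) = 0" if "v < stride" "a \<notin> {0, 1, 9}" for a v
            using same_outsideD[OF sm4 that(1), of a] zero[of a v] that(2) by simp
          show ?case
          proof (rule wp_seq_le[OF wp_read_adjacency[OF r4(1,2) inp4 rb4 pw4],
                where b' = "40 * length xs + 24"], goal_cases)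
            case (3 v w)
            then show ?case using zero4[OF small] by simp
          next
            case (4 s5)
            note post5 = this(1) and frame5 = this(2)
            have r5: "bases (fst s5)" "fst s5 ''m'' = m" "fst s5 ''s'' = node_start 0"
              "fst s5 ''n'' = n" "fst s5 ''o'' = \<rho>"
              using frame5 r4 by (simp_all add: bases_def)
            let ?A = "range (\<lambda>v. 11 + 3 * v) :: nat set"
            have sm45: "same_outside stride ?A (snd s4) (snd s5)" using post5 by simp
            have A: "0 \<notin> ?A" "1 \<notin> ?A" "2 \<notin> ?A" "3 \<notin> ?A" "9 \<notin> ?A" "10 \<notin> ?A" "12 + 3 * i \<notin> ?A"
              "13 + 3 * i \<notin> ?A" for i
              by auto presburger+
            have inp5: "loaded (snd s5)" by (rule loaded_same[OF inp4 sm45 A(1)])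
            have rb5: "snd s5 (addr stride 9 q) = addr stride (11 + 3 * q) 0" if "q < max n m" for q
              using same_outsideD[OF sm45 smallq[OF that] A(5)] rb4[OF that] by simp
            have pw5: "snd s5 (addr stride 1 v) = 2 ^ v" if "v < n" for v
              using same_outsideD[OF sm45 small[OF that] A(2)] pw4[OF that] by simp
            have zero5: "snd s5 (addr stride a v) = 0" if "v < stride" "a \<notin> {0, 1, 9}" "a \<notin> ?A" for a v
              using same_outsideD[OF sm45 that(1,3)] zero4[OF that(1,2)] by simp
            show ?case
            proof (rule wp_seq_le[OF wp_read_nodes[OF r5(1-3) inp5 rb5 pw5], where b' = 10], goal_cases)
              case (3 i w)
              have "12 + 3 * i \<notin> {0, 1, 9}" by auto
              then show ?case using zero5[OF small _ A(7)] 3 by blast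
            next
              case (4 s6)
              note post6 = this(1) and frame6 = this(2)
              have r6: "bases (fst s6)" "fst s6 ''m'' = m" "fst s6 ''n'' = n" "fst s6 ''o'' = \<rho>"
                using frame6 r5 by (simp_all add: bases_def)
              let ?B = "{2, 3} \<union> range (\<lambda>i. 12 + 3 * i) :: nat set"
              have sm56: "same_outside stride ?B (snd s5) (snd s6)" using post6 by simp
              let ?M = "(snd s6)(addr stride 3 \<rho> := addr stride 10 0)"
              have \<rho>: "\<rho> < m" using root_node nodes by simp
              have sm67: "same_outside stride {3} (snd s6) ?M"
                using smalli[OF \<rho>] by (intro same_outside_update) auto
              have sm57: "same_outside stride ?B (snd s5) ?M"
                by (rule same_outside_trans[OF sm56 sm67]) auto
              have B: "0 \<notin> ?B" "1 \<notin> ?B" "9 \<notin> ?B" "10 \<notin> ?B" "11 + 3 * i \<notin> ?B" "13 + 3 * i \<notin> ?B" for i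
                by auto presburger+
              have inp7: "loaded ?M" by (rule loaded_same[OF inp5 sm57 B(1)])
              have blank: "?M (addr stride a v) = 0"
                if "v < stride" "a \<notin> {0, 1, 9}" "a \<notin> ?A" "a \<notin> ?B" for a v
                using same_outsideD[OF sm57 that(1,4)] zero5[OF that(1,2,3)] by simp
              have nr: "node_read i (snd s6)" if "i < m" for i using post6 that by simp
              have other: "?M (addr stride a v) = snd s6 (addr stride a v)" if "v < stride" "a \<noteq> 3" for a v
                using same_outsideD[OF sm67 that(1)] that(2) by simp
              have "prepared ?M"
                unfolding prepared_def
              proof (intro conjI allI impI)
                fix v assume v: "v < n"
                show "?M (addr stride 1 v) = 2 ^ v"
                  using same_outsideD[OF sm57 small[OF v] B(2)] pw5[OF v] by simp
              next
                fix i assume i: "i < m"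
                show "?M (addr stride 2 i) = node_start i"
                  using other[OF smalli[OF i], of 2] nr[OF i] by (simp add: node_read_def)
              next
                fix i assume i: "i < m"
                show "\<exists>u. u \<notin> work_rows \<and> ?M (addr stride 3 i) = addr stride u 0 \<and>
                  (\<forall>v<n. ?M (addr stride u v) = (if v \<in> parent_bag i then 2 ^ v else 0))"
                \<comment> \<open>The root is nobody's child, so its entry comes from the final
                  store. Every other node has a parent, whose reading wrote the entry, and the final
                  store leaves it alone.\<close>
                proof (cases "i = \<rho>")
                  case True
                  have "?M (addr stride 10 v) = 0" if "v < n" for v
                    using blank[OF small[OF that], of 10] A(6) B(4) by simp
                  then show ?thesis
                    using True by (intro exI[of _ 10]) (simp add: parent_bag_root)
                next
                  case False
                  have "i \<in> T.desc \<rho>" using T.desc_root nodes i by simp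
                  then obtain j where j: "i \<in> ch j" using T.desc_cases[of i \<rho>] False by blast
                  then have jm: "j < m" using T.child_verts nodes by auto
                  have "?M (addr stride (12 + 3 * j) v) = (if v \<in> parent_bag i then 2 ^ v else 0)"
                    if "v < n" for v
                    using other[OF small[OF that], of "12 + 3 * j"] nr[OF jm] that
                    by (simp add: node_read_def parent_bag_child[OF j])
                  moreover have "?M (addr stride 3 i) = addr stride (12 + 3 * j) 0"
                    using nr[OF jm] j False smalli[OF i] smalli[OF \<rho>] by (simp add: node_read_def)
                  ultimately show ?thesis by (intro exI[of _ "12 + 3 * j"]) simp
                qed
              next
                fix q assume q: "q < max n m"
                show "?M (addr stride 9 q) = addr stride (11 + 3 * q) 0"
                  using same_outsideD[OF sm57 smallq[OF q] B(3)] rb5[OF q] by simp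
              next
                fix v w assume v: "v < n" and w: "w < n"
                show "?M (addr stride (11 + 3 * v) w) = (if w \<in> nbrs G v then 2 ^ w else 0)"
                  using same_outsideD[OF sm57 small[OF w] B(5)] post5 v w by simp
              next
                fix i v assume i: "i < m" and v: "v < n"
                show "?M (addr stride (12 + 3 * i) v) = (if v \<in> X i then 2 ^ v else 0)"
                  using other[OF small[OF v], of "12 + 3 * i"] nr[OF i] v by (simp add: node_read_def)
              next
                fix i assume i: "i < m"
                have fin: "node_start i + length (children_list i) + length (bag i) + 2 \<le> length xs"
                  using node_start_le[of "Suc i"] i by (simp add: node_start_Suc)
                have ld: "?M p = xs ! p" if "p < length xs" for p
                  using inp7 that unfolding loaded_def by blast
                show "?M (node_start i) = length (children_list i)"
                  using ld[of "node_start i"] fin input_node_simps(1)[OF i] by simp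
                show "?M (node_start i + 1 + e) = children_list i ! e" if "e < length (children_list i)" for e
                  using ld[of "node_start i + 1 + e"] fin that input_node_simps(2)[OF i that] by simp
                show "?M (node_start i + 1 + length (children_list i)) = length (bag i)"
                  using ld[of "node_start i + 1 + length (children_list i)"] fin input_node_simps(3)[OF i]
                  by simp
                show "?M (node_start i + 2 + length (children_list i) + e) = bag i ! e"
                  if "e < length (bag i)" for e
                  using ld[of "node_start i + 2 + length (children_list i) + e"] fin that
                    input_node_simps(4)[OF i that] by simp
              qed
              moreover have "?M (addr stride (13 + 3 * i) v) = 0" if "v < stride" for i v
              proof (rule blank[OF that _ A(8) B(6)])
                show "13 + 3 * i \<notin> {0, 1, 9}" by auto
              qed
              moreover have "aval (Plus (Reg ''U'') (Reg ''o'')) s6 = addr stride 3 \<rho>"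
                "aval (Plus (Reg ''B'') (Reg ''W'')) s6 = addr stride 10 0"
                using r6 by (simp_all add: bases_def addr_def)
              ultimately show ?case
                unfolding wp_Store using r6 by simp
            qed simp_all
          qed simp_all
        qed (use nl in simp_all)
      qed simp
    qed simp
  qed simp
qed

lemma wp_decide_bipartition:
  assumes r: "2 \<le> r" and width: "\<And>i. i < m \<Longrightarrow> length (bag i) \<le> k"
  shows "wp (decide_bipartition r) (\<lambda>c s'. c \<le> 175 * length xs + 88 * m + 1020 * 2 ^ k * m + 206 \<and>
    fst s' ''out'' = (if has_bipartition_without_complete r G then 1 else 0)) (initial_state xs)"
  unfolding decide_bipartition_def
proof (rule wp_seq_le[OF wp_prepare_input, where b' = "88 * m + 1020 * 2 ^ k * m + 56"], goal_cases)
  case (1 s1)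
  note post1 = this(1)
  have r1: "fst s1 ''m'' = m" "fst s1 ''o'' = \<rho>" "bases (fst s1)" "prepared (snd s1)"
    using post1 by simp_all
  show ?case
  proof (rule wp_seq_le[OF wp_fill_queue[OF r1], where b' = "1020 * 2 ^ k * m + 36"], goal_cases)
    case (1 s2)
    note post2 = this(1) and frame2 = this(2)
    have sm: "same_outside stride {4} (snd s1) (snd s2)" using post2 by simp
    have r2: "fst s2 ''m'' = m" "bases (fst s2)" "fst s2 ''n'' = n" "fst s2 ''o'' = \<rho>"
      using frame2 post1 by (simp_all add: bases_def)
    have M2: "prepared (snd s2)" by (rule prepared_same[OF r1(4) sm]) simp
    have q2: "snd s2 (addr stride 4 h) = queue m ! h" if "h < m" for h using post2 that by simp
    have blank2: "snd s2 (addr stride (13 + 3 * i) v) = 0" if "i < m" "v < stride" for i v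
      using same_outsideD[OF sm that(2), of "13 + 3 * i"] post1 that by simp
    show ?case
    proof (rule wp_seq_le[OF wp_process_queue[OF r2(1,2) M2 q2 blank2 width], where b' = 30], goal_cases)
      case (5 s3)
      note post3 = this(1) and frame3 = this(2)
      have r3: "fst s3 ''n'' = n" "fst s3 ''o'' = \<rho>" "bases (fst s3)"
        using frame3 r2 by (simp_all add: bases_def)
      show ?case
        by (rule wp_answer[OF r3 _ _ r]) (use post3 in simp_all)
    qed simp_all
  qed simp
qed simp

text \<open>Each arc lies in the square of some bag, so there are at most \<open>m * k ^ 2\<close>
  arcs; this bounds the adjacency lists. A record has two length fields, at most two children and at
  most \<open>k\<close> bag elements, and the 3 counts the two numbers of vertices and nodes and the
  root.\<close>

lemma length_input_le:
  assumes width: "\<And>i. i < m \<Longrightarrow> length (bag i) \<le> k"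
  shows "length xs \<le> 3 + n + m * k\<^sup>2 + m * (k + 4)"
proof -
  have cov: "parcs G \<subseteq> (\<Union>i<m. X i \<times> X i)"
  proof clarify
    fix u v assume "(u, v) \<in> parcs G"
    then obtain i where "i \<in> pverts T" "u \<in> X i" "v \<in> X i"
      using decomposition by (auto simp: tree_decomposition_def)
    then show "(u, v) \<in> (\<Union>i<m. X i \<times> X i)" using nodes by auto
  qed
  have "(\<Sum>v<n. length (adj v)) = (\<Sum>v<n. card (nbrs G v))"
  proof (rule sum.cong)
    fix v assume "v \<in> {..<n}"
    then show "length (adj v) = card (nbrs G v)"
      using adj[of v] distinct_card[of "adj v"] by simp
  qed simp
  also have "\<dots> = card (SIGMA v:{..<n}. nbrs G v)"
  proof (rule card_SigmaI[symmetric])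
    show "\<forall>v\<in>{..<n}. finite (nbrs G v)"
      using adj by (metis List.finite_set lessThan_iff)
  qed simp
  also have "(SIGMA v:{..<n}. nbrs G v) = parcs G"
    using G.wellformed'(1) vertices by (auto simp: nbrs_def)
  also have "card (parcs G) \<le> card (\<Union>i<m. X i \<times> X i)"
    using cov finite_bag nodes by (intro card_mono) auto
  also have "\<dots> \<le> (\<Sum>i<m. card (X i \<times> X i))" by (rule card_UN_le) simp
  also have "\<dots> \<le> (\<Sum>i<m. k\<^sup>2)"
  proof (rule sum_mono)
    fix i assume "i \<in> {..<m}"
    then have "card (X i) \<le> k" using bag[of i] width[of i] distinct_card[of "bag i"] by simp
    then show "card (X i \<times> X i) \<le> k\<^sup>2" by (simp add: card_cartesian_product power2_eq_square mult_le_mono)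
  qed
  finally have arcs: "(\<Sum>v<n. length (adj v)) \<le> m * k\<^sup>2" by simp
  have "(\<Sum>v<n. Suc (length (adj v))) = (\<Sum>v<n. length (adj v)) + n"
    by (simp add: sum_Suc)
  then have "vertex_start n \<le> 1 + n + m * k\<^sup>2" using arcs by (simp add: vertex_start_def)
  moreover have "(\<Sum>j<m. length (children_list j) + length (bag j) + 2) \<le> (\<Sum>j<m. k + 4)"
  proof (rule sum_mono)
    fix j assume "j \<in> {..<m}"
    then show "length (children_list j) + length (bag j) + 2 \<le> k + 4"
      using few_children[of j] width[of j] by simp
  qed
  ultimately show ?thesis unfolding length_input node_start_def by simp
qed

end

text \<open>In HOL \<open>log 2 0\<close> is 0, so at \<open>t = 0\<close> the left-hand side is 1;
  the maximum expresses the same convention without logarithms.\<close>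

lemma powr_eq_max:
  "2 powr (real t + real r * log 2 (real t)) = 2 ^ t * real (max 1 t) ^ r"
proof (cases "t = 0")
  case True
  then show ?thesis by (simp add: log_def)
next
  case False
  then have "2 powr (real r * log 2 (real t)) = real t powr real r"
    by (simp add: powr_def log_def)
  then show ?thesis using False by (simp add: powr_add powr_realpow max_def)
qed

text \<open>With \<open>2 \<le> r\<close> the quantity \<open>?y\<close> dominates both
  \<open>2 ^ t\<close> and, up to the factor 4, \<open>(t + 1) ^ 2\<close>. Every term is thus at
  most a constant times \<open>n * ?y\<close> or \<open>m * ?y\<close>. The exponent
  \<open>t + 1\<close> is the largest bag size for width \<open>t\<close>.\<close>

lemma running_time_le:
  fixes n m d r t l :: nat
  assumes "2 \<le> r" "1 \<le> n" "m \<le> d * n"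
    and l: "l \<le> 3 + n + m * (t + 1)\<^sup>2 + m * (t + 1 + 4)"
  shows "real (175 * l + 88 * m + 1020 * 2 ^ (t + 1) * m + 206)
    \<le> real (4300 * (d + 1)) * (2 powr (real t + real r * log 2 (real t)) * real n)"
proof -
  let ?a = "max 1 t" and ?y = "2 ^ t * max 1 t ^ r :: nat"
  have one: "1 \<le> ?a ^ r" by simp
  have p: "1 \<le> (2::nat) ^ t" by simp
  have y1: "1 \<le> ?y" using mult_le_mono[OF p one] by simp
  have pt: "2 ^ t \<le> ?y" using mult_le_mono2[OF one, of "2 ^ t"] by simp
  have "t + 1 \<le> 2 * ?a" by simp
  then have "(t + 1)\<^sup>2 \<le> (2 * ?a)\<^sup>2" by (rule power_mono) simp
  also have "\<dots> = 4 * ?a ^ 2" by (simp add: power2_eq_square)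
  also have "?a ^ 2 \<le> ?a ^ r" using assms(1) by (intro power_increasing) auto
  also have "?a ^ r \<le> ?y" using mult_le_mono1[OF p, of "?a ^ r"] by simp
  finally have sq: "(t + 1)\<^sup>2 \<le> 4 * ?y" by simp
  have "t + 1 \<le> (t + 1)\<^sup>2" by (simp add: power2_eq_square)
  then have lin: "t + 1 + 4 \<le> 8 * ?y" using sq y1 by linarith
  have ny: "n \<le> n * ?y" and n1: "1 \<le> n * ?y"
    using mult_le_mono2[OF y1, of n] mult_le_mono[OF assms(2) y1] by simp_all
  have my: "m \<le> m * ?y" using mult_le_mono2[OF y1, of m] by simp
  have "m * (t + 1)\<^sup>2 \<le> m * (4 * ?y)" using sq by (rule mult_le_mono2)
  then have m1: "m * (t + 1)\<^sup>2 \<le> 4 * (m * ?y)" by (simp add: mult.left_commute)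
  have "m * (t + 1 + 4) \<le> m * (8 * ?y)" using lin by (rule mult_le_mono2)
  then have m2: "m * (t + 1 + 4) \<le> 8 * (m * ?y)" by (simp add: mult.left_commute)
  have "1020 * 2 ^ (t + 1) * m = 2040 * (m * 2 ^ t)" by simp
  also have "m * 2 ^ t \<le> m * ?y" using pt by (rule mult_le_mono2)
  finally have m3: "1020 * 2 ^ (t + 1) * m \<le> 2040 * (m * ?y)" by simp
  have ll: "l \<le> 4 * (n * ?y) + 12 * (m * ?y)" using l ny n1 m1 m2 by linarith
  \<comment> \<open>The coefficient of \<open>n * ?y\<close> is 175 * 4 + 206 = 906, that of
    \<open>m * ?y\<close> is 175 * 12 + 88 + 2040 = 4228; both are rounded up.\<close>
  have "175 * l + 88 * m + 1020 * 2 ^ (t + 1) * m + 206 \<le> 1000 * (n * ?y) + 4300 * (m * ?y)"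
    using ll m3 my n1 by linarith
  also have "m * ?y \<le> d * n * ?y" using assms(3) by (rule mult_le_mono1)
  finally have "175 * l + 88 * m + 1020 * 2 ^ (t + 1) * m + 206 \<le> 4300 * (d + 1) * (?y * n)"
    by (simp add: algebra_simps)
  then have "real (175 * l + 88 * m + 1020 * 2 ^ (t + 1) * m + 206) \<le> real (4300 * (d + 1) * (?y * n))"
    by (rule of_nat_mono)
  then show ?thesis unfolding powr_eq_max by simp
qed

lemma nice_children_le_2:
  assumes "nice_tree_decomposition G T \<rho> X" "i \<in> pverts T"
  shows "card (children T \<rho> i) \<le> 2"
proof -
  have "children T \<rho> i = {} \<or> (\<exists>j. children T \<rho> i = {j}) \<or> (\<exists>j k. children T \<rho> i = {j, k})"
    using assms unfolding nice_tree_decomposition_def by blast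
  then show ?thesis by (auto simp: card_insert_if)
qed

lemma card_bag_le:
  assumes "finite (pverts T)" "width T X \<le> t" "i \<in> pverts T"
  shows "card (X i) \<le> t + 1"
proof -
  have "card (X i) \<le> Max ((\<lambda>i. card (X i)) ` pverts T)" using assms(1,3) by (intro Max_ge) auto
  then show ?thesis using assms(2) unfolding width_def by linarith
qed

theorem theorem2:
  fixes r :: nat
  assumes "2 \<le> r"
  shows "\<exists>c :: com. \<forall>d :: nat. \<exists>C :: real.
    \<forall>(G :: nat pair_pre_digraph) (T :: nat pair_pre_digraph) (\<rho> :: nat) (X :: nat \<Rightarrow> nat set)
      (n :: nat) (t :: nat) (xs :: nat list).
      pair_graph G \<and> card (pverts G) = n \<and> treewidth G \<le> t \<and>
      nice_tree_decomposition G T \<rho> X \<and> width T X \<le> t \<and> card (pverts T) \<le> d * n \<and>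
      encodes xs G T \<rho> X \<longrightarrow>
      answers_within c xs (has_bipartition_without_complete r G)
        (C * (2 powr (real t + real r * log 2 (real t)) * real n))"
proof (intro exI[of _ "decide_bipartition r"] allI)
  fix d :: nat
  show "\<exists>C :: real.
    \<forall>(G :: nat pair_pre_digraph) (T :: nat pair_pre_digraph) (\<rho> :: nat) (X :: nat \<Rightarrow> nat set)
      (n :: nat) (t :: nat) (xs :: nat list).
      pair_graph G \<and> card (pverts G) = n \<and> treewidth G \<le> t \<and>
      nice_tree_decomposition G T \<rho> X \<and> width T X \<le> t \<and> card (pverts T) \<le> d * n \<and>
      encodes xs G T \<rho> X \<longrightarrow>
      answers_within (decide_bipartition r) xs (has_bipartition_without_complete r G)
        (C * (2 powr (real t + real r * log 2 (real t)) * real n))"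
  proof (intro exI[of _ "real (4300 * (d + 1))"] allI impI, elim conjE)
    fix G T :: "nat pair_pre_digraph" and \<rho> :: nat and X :: "nat \<Rightarrow> nat set" and n t :: nat
      and xs :: "nat list"
    assume G: "pair_graph G" and n: "card (pverts G) = n"
      and nice: "nice_tree_decomposition G T \<rho> X" and width: "width T X \<le> t"
      and size: "card (pverts T) \<le> d * n" and enc: "encodes xs G T \<rho> X"
    obtain n' m adj cl bag where
      "pverts G = {..<n'} \<and> pverts T = {..<m} \<and>
        (\<forall>v<n'. distinct (adj v) \<and> set (adj v) = {w. (v, w) \<in> parcs G}) \<and>
        (\<forall>i<m. distinct (cl i) \<and> set (cl i) = children T \<rho> i) \<and>
        (\<forall>i<m. distinct (bag i) \<and> set (bag i) = X i) \<and>
        xs = [n'] @ concat (map (\<lambda>v. with_length (adj v)) [0..<n']) @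
             [m, \<rho>] @ concat (map (\<lambda>i. with_length (cl i) @ with_length (bag i)) [0..<m])"
      using enc unfolding encodes_def by (elim exE) (rule that)
    then have e: "pverts G = {..<n'}" "pverts T = {..<m}"
        "\<And>v. v < n' \<Longrightarrow> distinct (adj v) \<and> set (adj v) = {w. (v, w) \<in> parcs G}"
        "\<And>i. i < m \<Longrightarrow> distinct (cl i) \<and> set (cl i) = children T \<rho> i"
        "\<And>i. i < m \<Longrightarrow> distinct (bag i) \<and> set (bag i) = X i"
        "xs = [n'] @ concat (map (\<lambda>v. with_length (adj v)) [0..<n']) @
             [m, \<rho>] @ concat (map (\<lambda>i. with_length (cl i) @ with_length (bag i)) [0..<m])"
      by (elim conjE, simp)+
    have n': "n' = n" using n e(1) by simp
    have m: "m \<le> d * n" using size e(2) by simp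
    have cl2: "length (cl i) \<le> 2" if "i < m" for i
      using nice_children_le_2[OF nice, of i] that e(2) e(4)[OF that] distinct_card[of "cl i"] by simp
    have bagt: "length (bag i) \<le> t + 1" if "i < m" for i
      using card_bag_le[OF _ width, of i] that e(2) e(5)[OF that] distinct_card[of "bag i"] by simp
    interpret encoded_input G T \<rho> X r n m adj cl bag xs
    proof (intro encoded_input.intro encoded_input_axioms.intro rooted_decomposition.intro)
      show "tree_decomposition G T X" "\<rho> \<in> pverts T"
        using nice unfolding nice_tree_decomposition_def by blast+
      show "distinct (adj v) \<and> set (adj v) = nbrs G v" if "v < n" for v
        using e(3) that n' by (simp add: nbrs_def)
    qed (use G e cl2 n' in simp_all)
    \<comment> \<open>The tree has a root, so the bound on the number of nodes forces
      \<open>n\<close> to be positive. Without this the additive constants could not be absorbed by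
      a multiple of \<open>n\<close>.\<close>
    have "m > 0" using root_node e(2) by auto
    then have n1: "1 \<le> n" using m by (cases n) auto
    obtain k s where ks: "exec (decide_bipartition r) (initial_state xs) k s"
      "k \<le> 175 * length xs + 88 * m + 1020 * 2 ^ (t + 1) * m + 206"
      "fst s ''out'' = (if has_bipartition_without_complete r G then 1 else 0)"
      using wp_decide_bipartition[OF assms bagt] unfolding wp_def by blast
    have "real k \<le> real (175 * length xs + 88 * m + 1020 * 2 ^ (t + 1) * m + 206)"
      using ks(2) by (rule of_nat_mono)
    also have "\<dots> \<le> real (4300 * (d + 1)) * (2 powr (real t + real r * log 2 (real t)) * real n)"
      by (rule running_time_le[OF assms n1 m length_input_le[OF bagt]])
    finally show "answers_within (decide_bipartition r) xs (has_bipartition_without_complete r G)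
        (real (4300 * (d + 1)) * (2 powr (real t + real r * log 2 (real t)) * real n))"
      using ks unfolding answers_within_def by blast
  qed
qed

end
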